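(* Let $c\in\mathbb C$, $n\ge0$, and let $\mathcal O_n(\mathbf z)=\sum_{\mathcal G^n}\mathcal L_\alpha(W(\mathcal G^n))$ be the genus two Virasoro differential operator of order $n$, the sum being over all inequivalent order $n$ Virasoro graphs ($\mathcal O_0=1$). For $\gamma=\begin{bmatrix}A&B\\C&D\end{bmatrix}\in\mathrm{Sp}(4,\mathbb Z)$ let $M=C\Omega+D$ and let $\mathcal O_n^\gamma(\mathbf z)$ be the operator obtained from $\mathcal O_n(\mathbf z)$ by replacing $\omega,\nu_a,s,\partial/\partial\Omega_{ab}$ by their $\gamma$-transforms $\omega^\gamma,\nu_a^\gamma,s^\gamma,\partial/\partial\Omega^\gamma_{ab}$. Then for every (sufficiently often) differentiable function $F=F(\Omega)$ and all $\gamma\in\mathrm{Sp}(4,\mathbb Z)$, $$\mathcal O_n^\gamma(\mathbf z)\left(\det(M)^{c/2}F\right)=\det(M)^{c/2}\,\mathcal O_n(\mathbf z)F.$$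
   Context: **Differentials.** On a compact genus two Riemann surface with canonical homology basis $\alpha^i,\beta^i$ ($i=1,2$), $\omega(x,y)$ is the unique symmetric bidifferential, holomorphic for $x\ne y$, with $\oint_{\alpha^i}\omega(x,\cdot)=0$ and $\omega(x,y)=\frac{dx\,dy}{(x-y)^2}+\frac16s(x)+O(x-y)$ in local coordinates; this defines the projective connection $s(x)$ (relative to the chosen local coordinate). $\nu_i(x)=\oint_{\beta^i}\omega(x,\cdot)$ are the holomorphic 1-differentials, normalised by $\oint_{\alpha^i}\nu_j=2\pi i\delta_{ij}$; $\boldsymbol\nu=[\nu_1,\nu_2]$ is a row vector; $\Omega_{ij}=\frac1{2\pi i}\oint_{\beta^i}\nu_j$ is the period matrix in the Siegel upper half plane $\mathbb H_2$. $\omega,\nu_a,s$ are regarded as functions of $\Omega$ and of points on the surface, and $\partial/\partial\Omega_{ab}$ ($1\le a\le b\le 2$) are derivatives in the independent coordinates $\Omega_{11},\Omega_{12},\Omega_{22}$. Put $\nabla_x=\sum_{1\le a\le b\le2}\nu_a(x)\nu_b(x)\frac{\partial}{\partial\Omega_{ab}}$. **Virasoro graphs and $\mathcal O_n$.** An order $n$ Virasoro graph is a directed graph with vertices labelled $z_1,\dots,z_n$, each of degree 0, 1 or 2; degree 1 vertices have indegree 1 or outdegree 1, degree 2 vertices have indegree 1 and outdegree 1 (a loop gives degree 2). Components are $r$-cycles ($r\ge1$) or chains, a degree 0 vertex being a degenerate chain. Inequivalent graphs (up to label-preserving isomorphism) correspond to partial injective self-maps of $\{1,\dots,n\}$. An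 edge between $z_i,z_j$ has weight $\frac16s(z_i)$ if $i=j$ and $\omega(z_i,z_j)$ if $i\neq j$. A chain with first vertex $z_k$ and last vertex $z_\ell$ along its direction ($k=\ell$ if degenerate) has weight $A(z_k,z_\ell)=\sum_{1\le a\le b\le2}\nu_a(z_k)\nu_b(z_\ell)\alpha_{ab}$ with free commuting parameters $\alpha_{ab}=\alpha_{ba}$. If $\mathcal G^n$ has $K$ cycles, $W(\mathcal G^n)=(c/2)^K\prod(\text{edge weights})\prod(\text{chain weights})$, over all edges and all chains. $\mathcal L_\alpha$ is linear, sends $\alpha_{a_1b_1}\cdots\alpha_{a_Mb_M}$ to $\frac{\partial^M}{\partial\Omega_{a_1b_1}\cdots\partial\Omega_{a_Mb_M}}$, and leaves $\omega,\nu_a,s$ as coefficients to the left of the derivatives. For example $\mathcal O_1(z_1)=\nabla_{z_1}+\frac c{12}s(z_1)$. **Modular action.** $\mathrm{Sp}(4,\mathbb Z)$ consists of integral matrices $\gamma=\begin{bmatrix}A&B\\C&D\end{bmatrix}$ ($2\times2$ blocks) with $A^TD-C^TB=I$, $AB^T=BA^T$, $CD^T=DC^T$, $A^TC=C^TA$, $B^TD=D^TB$. With $M=C\Omega+D$, $N=M^{-1}$, $$\boldsymbol\nu^\gamma(x)=\boldsymbol\nu(x)N,\quad\Omega^\gamma=(A\Omega+B)N,\quad\nabla_x^\gamma=\nabla_x,$$ $$\omega^\gamma(x,y)=\omega(x,y)-\tfrac12\sum_{1\le a\le b\le2}(\nu_a(x)\nu_b(y)+\nu_b(x)\nu_a(y))\frac{\partial}{\partial\Omega_{ab}}\log\det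 M,$$ $$s^\gamma(x)=s(x)-6\nabla_x\log\det M,$$ and $\partial/\partial\Omega^\gamma_{ab}$ are the derivatives with respect to the coordinates $\Omega^\gamma_{ab}$ (so $\nabla^\gamma_x=\sum_{a\le b}\nu_a^\gamma(x)\nu^\gamma_b(x)\partial/\partial\Omega_{ab}^\gamma$). A fixed branch of $\det(M)^{c/2}$ on $\mathbb H_2$ is used on both sides. *)

theory Defs
  imports
    "HOL-Complex_Analysis.Complex_Analysis"
    "HOL-Homology.Homology"
    "HOL-Library.Poly_Mapping"
    "HOL-Library.Landau_Symbols"
begin

section \<open>Compact Riemann surfaces\<close>

text \<open>A local coordinate is a pair of its domain and its coordinate function; the function is
  irrelevant outside the domain.\<close>

type_synonym 'a chart = "'a set \<times> ('a \<Rightarrow> complex)"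

definition chart_inv :: "'a chart \<Rightarrow> complex \<Rightarrow> 'a" where
  "chart_inv \<kappa> = inv_into (fst \<kappa>) (snd \<kappa>)"

text \<open>Atlases are not required to be maximal, so any further compatible coordinate may be
  assumed to belong to the atlas.\<close>

definition compact_riemann_surface :: "'a topology \<Rightarrow> 'a chart set \<Rightarrow> bool" where
  "compact_riemann_surface X \<A> \<longleftrightarrow>
     topspace X \<noteq> {} \<and> compact_space X \<and> connected_space X \<and> Hausdorff_space X \<and>
     \<Union> (fst ` \<A>) = topspace X \<and>
     (\<forall>\<kappa>\<in>\<A>. openin X (fst \<kappa>) \<and> open (snd \<kappa> ` fst \<kappa>) \<and>
        homeomorphic_map (subtopology X (fst \<kappa>)) (top_of_set (snd \<kappa> ` fst \<kappa>)) (snd \<kappa>)) \<and>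
     (\<forall>\<kappa>\<in>\<A>. \<forall>\<mu>\<in>\<A>. (snd \<mu> \<circ> chart_inv \<kappa>) holomorphic_on snd \<kappa> ` (fst \<kappa> \<inter> fst \<mu>))"

text \<open>A 1-form is given by its component in each chart: the form is \<open>\<theta> \<kappa> p d(snd \<kappa>)\<close> at \<open>p\<close>.
  Hence \<open>\<theta> \<kappa> p\<close> equals \<open>\<theta> \<mu> p\<close> times the following factor.\<close>

type_synonym 'a form = "'a chart \<Rightarrow> 'a \<Rightarrow> complex"

definition transition_deriv :: "'a chart \<Rightarrow> 'a chart \<Rightarrow> 'a \<Rightarrow> complex" where
  "transition_deriv \<kappa> \<mu> p = deriv (snd \<mu> \<circ> chart_inv \<kappa>) (snd \<kappa> p)"

definition holomorphic_form :: "'a chart set \<Rightarrow> 'a form \<Rightarrow> bool" where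
  "holomorphic_form \<A> \<theta> \<longleftrightarrow>
     (\<forall>\<kappa>\<in>\<A>. (\<theta> \<kappa> \<circ> chart_inv \<kappa>) holomorphic_on snd \<kappa> ` fst \<kappa>) \<and>
     (\<forall>\<kappa>\<in>\<A>. \<forall>\<mu>\<in>\<A>. \<forall>p \<in> fst \<kappa> \<inter> fst \<mu>. \<theta> \<kappa> p = \<theta> \<mu> p * transition_deriv \<kappa> \<mu> p)"

text \<open>A subdivision of \<open>[0,1]\<close> into \<open>m\<close> intervals such that the \<open>j\<close>-th piece of the curve is a
  piecewise continuously differentiable path in the chart \<open>\<kappa> j\<close>.\<close>

definition chart_subdivision ::
  "'a chart set \<Rightarrow> (real \<Rightarrow> 'a) \<Rightarrow> nat \<Rightarrow> (nat \<Rightarrow> real) \<Rightarrow> (nat \<Rightarrow> 'a chart) \<Rightarrow> bool" where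
  "chart_subdivision \<A> g m t \<kappa> \<longleftrightarrow>
     t 0 = 0 \<and> t m = 1 \<and>
     (\<forall>j<m. t j < t (Suc j) \<and> \<kappa> j \<in> \<A> \<and> g ` {t j..t (Suc j)} \<subseteq> fst (\<kappa> j) \<and>
        valid_path (subpath (t j) (t (Suc j)) (snd (\<kappa> j) \<circ> g)))"

definition smooth_loop :: "'a topology \<Rightarrow> 'a chart set \<Rightarrow> (real \<Rightarrow> 'a) \<Rightarrow> bool" where
  "smooth_loop X \<A> g \<longleftrightarrow>
     pathin X g \<and> g 0 = g 1 \<and> (\<exists>m t \<kappa>. chart_subdivision \<A> g m t \<kappa>)"

definition has_line_integral :: "'a chart set \<Rightarrow> 'a form \<Rightarrow> complex \<Rightarrow> (real \<Rightarrow> 'a) \<Rightarrow> bool" where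
  "has_line_integral \<A> \<theta> I g \<longleftrightarrow>
     (\<exists>m t \<kappa> J. chart_subdivision \<A> g m t \<kappa> \<and>
        (\<forall>j<m. ((\<theta> (\<kappa> j) \<circ> chart_inv (\<kappa> j)) has_contour_integral J j)
                  (subpath (t j) (t (Suc j)) (snd (\<kappa> j) \<circ> g))) \<and>
        I = (\<Sum>j<m. J j))"

section \<open>Canonical homology bases\<close>

definition loop_chain :: "(real \<Rightarrow> 'a) \<Rightarrow> 'a chain" where
  "loop_chain g = frag_of (restrict (\<lambda>x. g (x 1)) (standard_simplex 1))"

definition crossings :: "(real \<Rightarrow> 'a) \<Rightarrow> (real \<Rightarrow> 'a) \<Rightarrow> (real \<times> real) set" where
  "crossings g h = {(u, v). u \<in> {0..1} \<and> v \<in> {0..1} \<and> g u = h v}"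

definition chart_at :: "'a chart set \<Rightarrow> 'a \<Rightarrow> 'a chart" where
  "chart_at \<A> p = (SOME \<kappa>. \<kappa> \<in> \<A> \<and> p \<in> fst \<kappa>)"

text \<open>The oriented area spanned by the two tangent vectors at a crossing. Its sign does not depend
  on the chart, because transition maps preserve the orientation.\<close>

definition crossing_area ::
  "'a chart set \<Rightarrow> (real \<Rightarrow> 'a) \<Rightarrow> (real \<Rightarrow> 'a) \<Rightarrow> real \<Rightarrow> real \<Rightarrow> real" where
  "crossing_area \<A> g h u v =
     (let \<phi> = snd (chart_at \<A> (g u)) in
        Im (cnj (vector_derivative (\<phi> \<circ> g) (at u)) * vector_derivative (\<phi> \<circ> h) (at v)))"

definition transverse :: "'a chart set \<Rightarrow> (real \<Rightarrow> 'a) \<Rightarrow> (real \<Rightarrow> 'a) \<Rightarrow> bool" where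
  "transverse \<A> g h \<longleftrightarrow>
     finite (crossings g h) \<and>
     (\<forall>(u, v) \<in> crossings g h. 0 < u \<and> u < 1 \<and> 0 < v \<and> v < 1 \<and>
        (snd (chart_at \<A> (g u)) \<circ> g) differentiable (at u) \<and>
        (snd (chart_at \<A> (g u)) \<circ> h) differentiable (at v) \<and>
        crossing_area \<A> g h u v \<noteq> 0)"

definition intersection_number ::
  "'a chart set \<Rightarrow> (real \<Rightarrow> 'a) \<Rightarrow> (real \<Rightarrow> 'a) \<Rightarrow> real" where
  "intersection_number \<A> g h = (\<Sum>(u, v) \<in> crossings g h. sgn (crossing_area \<A> g h u v))"

text \<open>The first homology has a basis of four elements, so the genus is two. The loops are
  chosen transverse to one another, which is possible for every canonical basis of homology.
  The orientation (\<open>\<alpha>\<^sub>i \<cdot> \<beta>\<^sub>i = 1\<close>) is the one for which the period matrix has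
  positive definite imaginary part.\<close>

definition canonical_homology_basis ::
  "'a topology \<Rightarrow> 'a chart set \<Rightarrow> (2 \<Rightarrow> real \<Rightarrow> 'a) \<Rightarrow> (2 \<Rightarrow> real \<Rightarrow> 'a) \<Rightarrow> bool" where
  "canonical_homology_basis X \<A> \<alpha> \<beta> \<longleftrightarrow>
     (\<forall>i. smooth_loop X \<A> (\<alpha> i) \<and> smooth_loop X \<A> (\<beta> i)) \<and>
     (\<forall>z. singular_relcycle 1 X {} z \<longrightarrow>
        (\<exists>!(k, l). homologous_rel 1 X {} z
           (\<Sum>i\<in>UNIV. frag_cmul (k i) (loop_chain (\<alpha> i)) + frag_cmul (l i) (loop_chain (\<beta> i))))) \<and>
     (\<forall>i j. transverse \<A> (\<alpha> i) (\<beta> j) \<and>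
        intersection_number \<A> (\<alpha> i) (\<beta> j) = (if i = j then 1 else 0)) \<and>
     (\<forall>i j. i \<noteq> j \<longrightarrow>
        transverse \<A> (\<alpha> i) (\<alpha> j) \<and> intersection_number \<A> (\<alpha> i) (\<alpha> j) = 0 \<and>
        transverse \<A> (\<beta> i) (\<beta> j) \<and> intersection_number \<A> (\<beta> i) (\<beta> j) = 0)"

section \<open>Differentials and periods\<close>

text \<open>\<open>\<omega> \<kappa> x \<mu> y\<close> is the component of the bidifferential for the coordinate \<open>\<kappa>\<close> at \<open>x\<close> and \<open>\<mu>\<close> at
  \<open>y\<close>; its values on the diagonal carry no meaning.\<close>

type_synonym 'a biform = "'a chart \<Rightarrow> 'a \<Rightarrow> 'a form"

definition normalised_bidifferential ::
  "'a chart set \<Rightarrow> (2 \<Rightarrow> real \<Rightarrow> 'a) \<Rightarrow> 'a biform \<Rightarrow> 'a form \<Rightarrow> bool" where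
  "normalised_bidifferential \<A> \<alpha> \<omega> s \<longleftrightarrow>
     (\<forall>\<kappa>\<in>\<A>. \<forall>\<mu>\<in>\<A>. \<forall>x\<in>fst \<kappa>. \<forall>y\<in>fst \<mu>. x \<noteq> y \<longrightarrow>
        \<omega> \<kappa> x \<mu> y = \<omega> \<mu> y \<kappa> x \<and>
        (\<forall>\<kappa>'\<in>\<A>. x \<in> fst \<kappa>' \<longrightarrow> \<omega> \<kappa> x \<mu> y = \<omega> \<kappa>' x \<mu> y * transition_deriv \<kappa> \<kappa>' x) \<and>
        (\<exists>a b. ((\<lambda>(u, v). \<omega> \<kappa> (chart_inv \<kappa> u) \<mu> (chart_inv \<mu> v)) has_derivative
                  (\<lambda>(h, k). a * h + b * k)) (at (snd \<kappa> x, snd \<mu> y)))) \<and>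
     (\<forall>\<kappa>\<in>\<A>. \<forall>x\<in>fst \<kappa>.
        (\<lambda>v. \<omega> \<kappa> x \<kappa> (chart_inv \<kappa> v) - 1 / (snd \<kappa> x - v)\<^sup>2 - s \<kappa> x / 6)
          \<in> O[at (snd \<kappa> x)](\<lambda>v. snd \<kappa> x - v)) \<and>
     (\<forall>i. \<forall>\<kappa>\<in>\<A>. \<forall>x\<in>fst \<kappa>. x \<notin> \<alpha> i ` {0..1} \<longrightarrow> has_line_integral \<A> (\<omega> \<kappa> x) 0 (\<alpha> i))"

text \<open>For \<open>x\<close> on \<open>\<beta> i\<close> the integral defining \<open>\<nu>\<^sub>i(x)\<close> is improper, and \<open>\<nu>\<^sub>i(x)\<close> is determined there
  by holomorphy.\<close>

definition normalised_differentials ::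
  "'a chart set \<Rightarrow> (2 \<Rightarrow> real \<Rightarrow> 'a) \<Rightarrow> (2 \<Rightarrow> real \<Rightarrow> 'a) \<Rightarrow> 'a biform \<Rightarrow>
   ('a chart \<Rightarrow> 'a \<Rightarrow> complex^2) \<Rightarrow> bool" where
  "normalised_differentials \<A> \<alpha> \<beta> \<omega> \<nu> \<longleftrightarrow>
     (\<forall>i. holomorphic_form \<A> (\<lambda>\<kappa> p. \<nu> \<kappa> p $ i)) \<and>
     (\<forall>i. \<forall>\<kappa>\<in>\<A>. \<forall>x\<in>fst \<kappa>. x \<notin> \<beta> i ` {0..1} \<longrightarrow>
        has_line_integral \<A> (\<omega> \<kappa> x) (\<nu> \<kappa> x $ i) (\<beta> i)) \<and>
     (\<forall>i j. has_line_integral \<A> (\<lambda>\<kappa> p. \<nu> \<kappa> p $ j) (if i = j then 2 * pi * \<i> else 0) (\<alpha> i))"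

definition period_matrix ::
  "'a chart set \<Rightarrow> (2 \<Rightarrow> real \<Rightarrow> 'a) \<Rightarrow> ('a chart \<Rightarrow> 'a \<Rightarrow> complex^2) \<Rightarrow> complex^2^2 \<Rightarrow> bool" where
  "period_matrix \<A> \<beta> \<nu> \<Omega> \<longleftrightarrow>
     (\<forall>i j. has_line_integral \<A> (\<lambda>\<kappa> p. \<nu> \<kappa> p $ j) (2 * pi * \<i> * \<Omega> $ i $ j) (\<beta> i))"

section \<open>Functions on the Siegel upper half plane\<close>

definition symmetric_matrices :: "(complex^2^2) set" where
  "symmetric_matrices = {\<Omega>. transpose \<Omega> = \<Omega>}"

definition siegel :: "(complex^2^2) set" where
  "siegel = {\<Omega> \<in> symmetric_matrices.
     \<forall>x::real^2. x \<noteq> 0 \<longrightarrow> x \<bullet> ((\<chi> i j. Im (\<Omega> $ i $ j)) *v x) > 0}"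

text \<open>The index pairs \<open>1 \<le> a \<le> b \<le> 2\<close>. They are listed because in the type \<open>2\<close> the numeral \<open>2\<close>
  denotes \<open>0\<close>, so that its order does not match the labels.\<close>

definition idx :: "(2 \<times> 2) set" where
  "idx = {(1, 1), (1, 2), (2, 2)}"

text \<open>The independent coordinate \<open>\<Omega>\<^sub>1\<^sub>2\<close> moves both off-diagonal entries.\<close>

definition pd :: "2 \<Rightarrow> 2 \<Rightarrow> (complex^2^2 \<Rightarrow> complex) \<Rightarrow> complex^2^2 \<Rightarrow> complex" where
  "pd a b F \<Omega> =
     deriv (\<lambda>t. F (\<Omega> + (\<chi> i j. if (i, j) = (a, b) \<or> (i, j) = (b, a) then t else 0))) 0"

definition complex_differentiable_at :: "(complex^2^2 \<Rightarrow> complex) \<Rightarrow> complex^2^2 \<Rightarrow> bool" where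
  "complex_differentiable_at F \<Omega> \<longleftrightarrow>
     (\<exists>p. (F has_derivative (\<lambda>H. \<Sum>(a, b)\<in>idx. p a b * H $ a $ b)) (at \<Omega> within symmetric_matrices))"

fun times_differentiable_on :: "nat \<Rightarrow> (complex^2^2 \<Rightarrow> complex) \<Rightarrow> (complex^2^2) set \<Rightarrow> bool" where
  "times_differentiable_on 0 F U \<longleftrightarrow> True"
| "times_differentiable_on (Suc k) F U \<longleftrightarrow>
     (\<forall>\<Omega>\<in>U. complex_differentiable_at F \<Omega>) \<and>
     (\<forall>(a, b)\<in>idx. times_differentiable_on k (pd a b F) U)"

section \<open>Virasoro graphs and the operators\<close>

text \<open>A graph on the labelled vertices \<open>{1..n}\<close> is given by its set of directed edges. Since
  the labels are fixed, distinct sets are inequivalent graphs; the degree conditions exclude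
  parallel edges.\<close>

definition indeg :: "(nat \<times> nat) set \<Rightarrow> nat \<Rightarrow> nat" where
  "indeg E i = card {j. (j, i) \<in> E}"

definition outdeg :: "(nat \<times> nat) set \<Rightarrow> nat \<Rightarrow> nat" where
  "outdeg E i = card {j. (i, j) \<in> E}"

definition virasoro_graphs :: "nat \<Rightarrow> (nat \<times> nat) set set" where
  "virasoro_graphs n = {E. E \<subseteq> {1..n} \<times> {1..n} \<and>
     (\<forall>i\<in>{1..n}. indeg E i + outdeg E i \<le> 2 \<and>
        (indeg E i + outdeg E i = 2 \<longrightarrow> indeg E i = 1 \<and> outdeg E i = 1))}"

definition cycles :: "(nat \<times> nat) set \<Rightarrow> nat set set" where
  "cycles E = {E\<^sup>+ `` {i} | i. (i, i) \<in> E\<^sup>+}"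

text \<open>A chain is represented by its first and last vertex.\<close>

definition chains :: "nat \<Rightarrow> (nat \<times> nat) set \<Rightarrow> (nat \<times> nat) set" where
  "chains n E = {(k, l). k \<in> {1..n} \<and> l \<in> {1..n} \<and> indeg E k = 0 \<and> outdeg E l = 0 \<and> (k, l) \<in> E\<^sup>*}"

text \<open>Polynomials over \<open>\<complex>\<close> in commuting variables indexed by pairs.\<close>

type_synonym param_poly = "((2 \<times> 2) \<Rightarrow>\<^sub>0 nat) \<Rightarrow>\<^sub>0 complex"

definition param :: "2 \<Rightarrow> 2 \<Rightarrow> param_poly" where
  "param a b = Poly_Mapping.single (Poly_Mapping.single (a, b) 1) 1"

definition const :: "complex \<Rightarrow> param_poly" where
  "const x = Poly_Mapping.single 0 x"

text \<open>Here \<open>s i\<close>, \<open>\<omega> i j\<close>, \<open>\<nu> i\<close> stand for the values at the points \<open>z\<^sub>i\<close>, \<open>z\<^sub>j\<close>.\<close>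

definition chain_weight :: "(nat \<Rightarrow> complex^2) \<Rightarrow> nat \<Rightarrow> nat \<Rightarrow> param_poly" where
  "chain_weight \<nu> k l = (\<Sum>(a, b)\<in>idx. const (\<nu> k $ a * \<nu> l $ b) * param a b)"

definition edge_weight :: "(nat \<Rightarrow> complex) \<Rightarrow> (nat \<Rightarrow> nat \<Rightarrow> complex) \<Rightarrow> nat \<Rightarrow> nat \<Rightarrow> complex" where
  "edge_weight s \<omega> i j = (if i = j then s i / 6 else \<omega> i j)"

definition graph_weight ::
  "nat \<Rightarrow> complex \<Rightarrow> (nat \<Rightarrow> complex) \<Rightarrow> (nat \<Rightarrow> nat \<Rightarrow> complex) \<Rightarrow> (nat \<Rightarrow> complex^2) \<Rightarrow>
   (nat \<times> nat) set \<Rightarrow> param_poly" where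
  "graph_weight n c s \<omega> \<nu> E =
     const ((c / 2) ^ card (cycles E) * (\<Prod>(i, j)\<in>E. edge_weight s \<omega> i j)) *
     (\<Prod>(k, l)\<in>chains n E. chain_weight \<nu> k l)"

type_synonym diff_op = "(complex^2^2 \<Rightarrow> complex) \<Rightarrow> complex^2^2 \<Rightarrow> complex"

text \<open>The map \<open>\<L>\<^sub>\<alpha>\<close>, with \<open>D a b\<close> as the derivative substituted for the variable with index
  \<open>(a, b)\<close>.\<close>

definition quantise :: "(2 \<Rightarrow> 2 \<Rightarrow> diff_op) \<Rightarrow> param_poly \<Rightarrow> diff_op" where
  "quantise D W F \<Omega> =
     (\<Sum>m\<in>Poly_Mapping.keys W. Poly_Mapping.lookup W m *
        ((D 1 1 ^^ Poly_Mapping.lookup m (1, 1))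
          ((D 1 2 ^^ Poly_Mapping.lookup m (1, 2))
            ((D 2 2 ^^ Poly_Mapping.lookup m (2, 2)) F))) \<Omega>)"

text \<open>The coefficients stand to the left of all derivatives, so they enter only through their
  values at the surface where the result is evaluated.\<close>

definition virasoro_op ::
  "nat \<Rightarrow> complex \<Rightarrow> (nat \<Rightarrow> complex) \<Rightarrow> (nat \<Rightarrow> nat \<Rightarrow> complex) \<Rightarrow> (nat \<Rightarrow> complex^2) \<Rightarrow>
   (2 \<Rightarrow> 2 \<Rightarrow> diff_op) \<Rightarrow> diff_op" where
  "virasoro_op n c s \<omega> \<nu> D F \<Omega> =
     (\<Sum>E\<in>virasoro_graphs n. quantise D (graph_weight n c s \<omega> \<nu> E) F \<Omega>)"

section \<open>The modular action\<close>

definition sp4 :: "int^2^2 \<Rightarrow> int^2^2 \<Rightarrow> int^2^2 \<Rightarrow> int^2^2 \<Rightarrow> bool" where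
  "sp4 A B C D \<longleftrightarrow>
     transpose A ** D - transpose C ** B = mat 1 \<and>
     A ** transpose B = B ** transpose A \<and>
     C ** transpose D = D ** transpose C \<and>
     transpose A ** C = transpose C ** A \<and>
     transpose B ** D = transpose D ** B"

definition cmat :: "int^2^2 \<Rightarrow> complex^2^2" where
  "cmat A = (\<chi> i j. of_int (A $ i $ j))"

definition modM :: "int^2^2 \<Rightarrow> int^2^2 \<Rightarrow> complex^2^2 \<Rightarrow> complex^2^2" where
  "modM C D \<Omega> = cmat C ** \<Omega> + cmat D"

definition modN :: "int^2^2 \<Rightarrow> int^2^2 \<Rightarrow> complex^2^2 \<Rightarrow> complex^2^2" where
  "modN C D \<Omega> = matrix_inv (modM C D \<Omega>)"

definition modact ::
  "int^2^2 \<Rightarrow> int^2^2 \<Rightarrow> int^2^2 \<Rightarrow> int^2^2 \<Rightarrow> complex^2^2 \<Rightarrow> complex^2^2" where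
  "modact A B C D \<Omega> = (cmat A ** \<Omega> + cmat B) ** modN C D \<Omega>"

text \<open>The derivative with respect to the coordinates \<open>\<Omega>\<^sup>\<gamma> = modact A B C D \<Omega>\<close>: express the function
  in these coordinates, differentiate, and go back.\<close>

definition pd_gamma :: "int^2^2 \<Rightarrow> int^2^2 \<Rightarrow> int^2^2 \<Rightarrow> int^2^2 \<Rightarrow> 2 \<Rightarrow> 2 \<Rightarrow> diff_op" where
  "pd_gamma A B C D a b F \<Omega> =
     pd a b (F \<circ> inv_into siegel (modact A B C D)) (modact A B C D \<Omega>)"

text \<open>A holomorphic logarithm of \<open>det M\<close> on the Siegel upper half plane. It fixes the branch
  \<open>det M\<^bsup>c/2\<^esup> = exp (c/2 * l)\<close>, and is \<open>log det M\<close> in the transformation of \<open>\<omega>\<close> and \<open>s\<close>, where the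
  choice of branch is immaterial.\<close>

definition log_det_branch :: "int^2^2 \<Rightarrow> int^2^2 \<Rightarrow> (complex^2^2 \<Rightarrow> complex) \<Rightarrow> bool" where
  "log_det_branch C D l \<longleftrightarrow>
     continuous_on siegel l \<and> (\<forall>\<Omega>\<in>siegel. exp (l \<Omega>) = det (modM C D \<Omega>))"

definition nabla :: "complex^2 \<Rightarrow> diff_op" where
  "nabla v F \<Omega> = (\<Sum>(a, b)\<in>idx. v $ a * v $ b * pd a b F \<Omega>)"

definition nu_gamma ::
  "int^2^2 \<Rightarrow> int^2^2 \<Rightarrow> complex^2^2 \<Rightarrow> (nat \<Rightarrow> complex^2) \<Rightarrow> nat \<Rightarrow> complex^2" where
  "nu_gamma C D \<Omega> \<nu> i = \<nu> i v* modN C D \<Omega>"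

definition omega_gamma ::
  "(complex^2^2 \<Rightarrow> complex) \<Rightarrow> complex^2^2 \<Rightarrow> (nat \<Rightarrow> complex^2) \<Rightarrow> (nat \<Rightarrow> nat \<Rightarrow> complex) \<Rightarrow>
   nat \<Rightarrow> nat \<Rightarrow> complex" where
  "omega_gamma l \<Omega> \<nu> \<omega> i j =
     \<omega> i j - 1 / 2 * (\<Sum>(a, b)\<in>idx. (\<nu> i $ a * \<nu> j $ b + \<nu> j $ a * \<nu> i $ b) * pd a b l \<Omega>)"

definition s_gamma ::
  "(complex^2^2 \<Rightarrow> complex) \<Rightarrow> complex^2^2 \<Rightarrow> (nat \<Rightarrow> complex^2) \<Rightarrow> (nat \<Rightarrow> complex) \<Rightarrow>
   nat \<Rightarrow> complex" where
  "s_gamma l \<Omega> \<nu> s i = s i - 6 * nabla (\<nu> i) l \<Omega>"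

end

theory Submission
  imports Defs
begin

text \<open>Write \<open>e\<^sub>i\<^sub>j\<close> for the edge weights, and let all of \<open>e\<^sub>i\<^sub>j\<close>, \<open>\<nu>\<^sub>i\<close> and \<open>\<Omega>\<close> be independent variables;
  of the geometry only the symmetry of \<open>e\<close> matters. Removing the vertex \<open>v = n + 1\<close> from the
  graphs of order \<open>n + 1\<close> gives \<open>\<O>\<^sub>n\<^sub>+\<^sub>1 = c/2 e\<^sub>v\<^sub>v \<O>\<^sub>n + \<delta>\<^sub>v \<O>\<^sub>n\<close>, where \<open>\<delta>\<^sub>v\<close> is the derivative along the
  vector field \<open>e\<^sub>i\<^sub>j \<mapsto> e\<^sub>i\<^sub>v e\<^sub>v\<^sub>j\<close>, \<open>\<nu>\<^sub>i \<mapsto> e\<^sub>i\<^sub>v \<nu>\<^sub>v\<close>, \<open>\<Omega> \<mapsto> \<nu>\<^sub>v\<^sup>T \<nu>\<^sub>v\<close>. The modular transformation is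
  \<open>e\<^sub>i\<^sub>j \<mapsto> e\<^sub>i\<^sub>j - \<nu>\<^sub>i S \<nu>\<^sub>j\<^sup>T\<close>, \<open>\<nu>\<^sub>i \<mapsto> \<nu>\<^sub>i N\<close> with the symmetric matrix \<open>S = N C\<close>. It maps this vector field to
  itself, because \<open>dS = - S d\<Omega> S\<close>, \<open>dN = - S d\<Omega> N\<close> and \<open>d\<Omega>\<^sup>\<gamma> = N\<^sup>T d\<Omega> N\<close>. The change
  \<open>- c/2 \<nu>\<^sub>v S \<nu>\<^sub>v\<^sup>T\<close> of the first term cancels the derivative of \<open>det M\<^bsup>c/2\<^esup>\<close>, since \<open>d log det M\<close> is the
  trace of \<open>S d\<Omega>\<close>. The theorem follows by induction on \<open>n\<close>, for all values of the variables at once.\<close>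

no_notation fps_nth (infixl "$" 75)

section \<open>Paths and cycles of Virasoro graphs\<close>

text \<open>Independent variables are what makes the induction possible: the identity of order n is
  differentiated along a curve, so it must be known at all nearby values of the variables and not
  only at those that come from a surface. The derivatives of \<open>F\<close> become variables as
  well: a graph sum is a function of a family \<open>J\<close> of numbers indexed by exponents, and
  the vector field acts on this family by the shift that stands for one more derivative of
  \<open>F\<close>. The transformed side is treated in the same way, with the weighted function
  written in the transformed coordinates; no formula for its higher derivatives is needed, and only
  the first derivative of the Moebius map is ever computed. Two restrictions shape the analysis. All
  functions live on symmetric matrices, where only the three independent coordinates give directions
  of differentiation. And \<open>F\<close> is differentiable only finitely often, so that orders of
  differentiation are counted throughout and the symmetry of mixed derivatives has to follow from
  differentiability alone.\<close>

definition partial_injection :: "nat \<Rightarrow> (nat \<times> nat) set \<Rightarrow> bool" where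
  "partial_injection n E \<longleftrightarrow>
     E \<subseteq> {1..n} \<times> {1..n} \<and> single_valued E \<and> single_valued (E\<inverse>)"

lemma partial_injection_finite:
  assumes "partial_injection n E"
  shows "finite E" "finite {j. (j, i) \<in> E}" "finite {j. (i, j) \<in> E}"
proof -
  show "finite E"
    using assms finite_subset[of E "{1..n} \<times> {1..n}"] by (auto simp: partial_injection_def)
  have "{j. (j, i) \<in> E} \<subseteq> {1..n}" "{j. (i, j) \<in> E} \<subseteq> {1..n}"
    using assms by (auto simp: partial_injection_def)
  then show "finite {j. (j, i) \<in> E}" "finite {j. (i, j) \<in> E}"
    by (auto intro: finite_subset)
qed

text \<open>Two edges leaving one vertex would force the total degree to be exactly 2, and then the
  degree condition allows only one of them to leave. The same argument applies to incoming
  edges.\<close>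

lemma virasoro_graphs_iff: "E \<in> virasoro_graphs n \<longleftrightarrow> partial_injection n E"
proof
  assume E: "E \<in> virasoro_graphs n"
  then have sub: "E \<subseteq> {1..n} \<times> {1..n}" by (simp add: virasoro_graphs_def)
  have fin: "finite {j. (j, i) \<in> E}" "finite {j. (i, j) \<in> E}" for i
  proof -
    have "{j. (j, i) \<in> E} \<subseteq> {1..n}" "{j. (i, j) \<in> E} \<subseteq> {1..n}" using sub by auto
    then show "finite {j. (j, i) \<in> E}" "finite {j. (i, j) \<in> E}" by (auto intro: finite_subset)
  qed
  have deg: "indeg E i \<le> 1 \<and> outdeg E i \<le> 1" if "i \<in> {1..n}" for i
  proof -
    from E that have "indeg E i + outdeg E i \<le> 2"
      "indeg E i + outdeg E i = 2 \<longrightarrow> indeg E i = 1 \<and> outdeg E i = 1"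
      by (simp_all add: virasoro_graphs_def)
    then show ?thesis by linarith
  qed
  have "single_valued E"
  proof (rule single_valuedI)
    fix x y z assume a: "(x, y) \<in> E" "(x, z) \<in> E"
    with sub deg have "card {j. (x, j) \<in> E} \<le> 1" by (auto simp: outdeg_def)
    with a fin show "y = z" by (auto simp: card_le_Suc0_iff_eq)
  qed
  moreover have "single_valued (E\<inverse>)"
  proof (rule single_valuedI)
    fix x y z assume a: "(x, y) \<in> E\<inverse>" "(x, z) \<in> E\<inverse>"
    with sub deg have "card {j. (j, x) \<in> E} \<le> 1" by (auto simp: indeg_def)
    with a fin show "y = z" by (auto simp: card_le_Suc0_iff_eq)
  qed
  ultimately show "partial_injection n E" using sub by (simp add: partial_injection_def)
next
  assume E: "partial_injection n E"
  have "indeg E i \<le> 1 \<and> outdeg E i \<le> 1" for i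
    using E partial_injection_finite[OF E]
    by (auto simp: indeg_def outdeg_def card_le_Suc0_iff_eq partial_injection_def single_valued_def)
  then have "indeg E i + outdeg E i \<le> 2 \<and>
      (indeg E i + outdeg E i = 2 \<longrightarrow> indeg E i = 1 \<and> outdeg E i = 1)" for i
    by (smt (verit) nat_1_add_1 add_le_mono le_antisym add_right_imp_eq add_left_imp_eq
        nat_add_left_cancel_le)
  then show "E \<in> virasoro_graphs n"
    using E unfolding virasoro_graphs_def partial_injection_def by blast
qed

lemma mem_chains:
  assumes "partial_injection n E"
  shows "(k, l) \<in> chains n E \<longleftrightarrow> k \<in> {1..n} \<and> l \<in> {1..n} \<and>
    (\<forall>j. (j, k) \<notin> E) \<and> (\<forall>j. (l, j) \<notin> E) \<and> (k, l) \<in> E\<^sup>*"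
  using partial_injection_finite[OF assms] by (auto simp: chains_def indeg_def outdeg_def)

lemma finite_chains: "finite (chains n E)"
  by (rule finite_subset[of _ "{1..n} \<times> {1..n}"]) (auto simp: chains_def)

text \<open>Going backwards from \<open>l\<close> there is no choice, so one of \<open>k\<close> and
  \<open>k'\<close> is reached from the other; a vertex without predecessor is reached only from
  itself.\<close>

lemma chain_start_unique:
  assumes "single_valued (E\<inverse>)" "(k, l) \<in> E\<^sup>*" "(k', l) \<in> E\<^sup>*"
    "\<forall>j. (j, k) \<notin> E" "\<forall>j. (j, k') \<notin> E"
  shows "k = k'"
proof -
  have "(l, k) \<in> (E\<inverse>)\<^sup>*" "(l, k') \<in> (E\<inverse>)\<^sup>*"
    using assms by (auto simp: rtrancl_converse)
  then have "(k, k') \<in> (E\<inverse>)\<^sup>* \<or> (k', k) \<in> (E\<inverse>)\<^sup>*"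
    using single_valued_confluent[OF assms(1)] by blast
  then have "(k', k) \<in> E\<^sup>* \<or> (k, k') \<in> E\<^sup>*" by (auto simp: rtrancl_converse)
  then show ?thesis using assms(4,5) by (metis rtranclE)
qed

lemma chain_end_unique:
  assumes "single_valued E" "(k, l) \<in> E\<^sup>*" "(k, l') \<in> E\<^sup>*"
    "\<forall>j. (l, j) \<notin> E" "\<forall>j. (l', j) \<notin> E"
  shows "l = l'"
  using chain_start_unique[of "E\<inverse>" l k l'] assms by (auto simp: rtrancl_converse)

text \<open>If every vertex from which \<open>l\<close> can be reached had a predecessor, then \<open>E\<close> would map this
  finite set without \<open>l\<close> onto the whole set.\<close>

lemma chain_start_exists:
  assumes E: "finite E" "single_valued E" and l: "\<forall>j. (l, j) \<notin> E"
  shows "\<exists>k. (\<forall>j. (j, k) \<notin> E) \<and> (k, l) \<in> E\<^sup>*"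
proof (rule ccontr)
  assume neg: "\<not> ?thesis"
  define P where "P = {x. (x, l) \<in> E\<^sup>*}"
  have "P \<subseteq> insert l (fst ` E)"
  proof
    fix x assume "x \<in> P"
    then have "(x, l) \<in> E\<^sup>*" by (simp add: P_def)
    then show "x \<in> insert l (fst ` E)" by (cases rule: converse_rtranclE) force+
  qed
  with E(1) have fin: "finite P" by (meson finite.insertI finite_imageI finite_subset)
  have "P \<subseteq> (\<lambda>x. THE y. (x, y) \<in> E) ` (P - {l})"
  proof
    fix x assume "x \<in> P"
    with neg obtain j where j: "(j, x) \<in> E" "(x, l) \<in> E\<^sup>*" by (auto simp: P_def)
    then have "j \<in> P - {l}" using l by (auto simp: P_def)
    moreover have "(THE y. (j, y) \<in> E) = x"
      using j E(2) by (auto simp: single_valued_def)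
    ultimately show "x \<in> (\<lambda>x. THE y. (x, y) \<in> E) ` (P - {l})" by blast
  qed
  with fin have "card P \<le> card (P - {l})" by (meson card_image_le card_mono finite_Diff
      finite_imageI order_trans)
  moreover have "l \<in> P" by (simp add: P_def)
  ultimately show False using card_Diff1_less[OF fin, of l] by simp
qed

lemma chain_end_exists:
  assumes "finite E" "single_valued (E\<inverse>)" "\<forall>j. (j, k) \<notin> E"
  shows "\<exists>l. (\<forall>j. (l, j) \<notin> E) \<and> (k, l) \<in> E\<^sup>*"
  using chain_start_exists[of "E\<inverse>" k] assms by (auto simp: rtrancl_converse)

section \<open>The number of cycles when a vertex is added\<close>

lemma finite_cycles:
  assumes "finite E" shows "finite (cycles E)"
proof -
  have "i \<in> fst ` E" if "(i, i) \<in> E\<^sup>+" for i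
    using tranclD[OF that] by force
  then have "cycles E \<subseteq> (\<lambda>i. E\<^sup>+ `` {i}) ` (fst ` E)"
    unfolding cycles_def by blast
  then show ?thesis using assms by (meson finite_imageI finite_subset)
qed

text \<open>Deleting \<open>v\<close> from the vertex sets is a bijection between the cycles of the
  two graphs. The assumption \<open>via\<close> excludes a cycle that consists of \<open>v\<close>
  alone, which would become empty.\<close>

lemma card_cycles_extend:
  assumes v: "v \<notin> Field E"
    and iff: "\<And>x y. x \<noteq> v \<Longrightarrow> y \<noteq> v \<Longrightarrow> (x, y) \<in> E'\<^sup>+ \<longleftrightarrow> (x, y) \<in> E\<^sup>+"
    and via: "(v, v) \<in> E'\<^sup>+ \<Longrightarrow> \<exists>x. x \<noteq> v \<and> (x, v) \<in> E'\<^sup>+ \<and> (v, x) \<in> E'\<^sup>+"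
  shows "card (cycles E') = card (cycles E)"
proof -
  have vE: "(x, v) \<notin> E\<^sup>+" "(v, x) \<notin> E\<^sup>+" for x
    using v by (auto dest: tranclD tranclD2 simp: Field_def)
  \<comment> \<open>Every cycle has a representative other than \<open>v\<close>, and for such
    representatives reachability is the same in both graphs.\<close>
  have cyc': "cycles E' = {E'\<^sup>+ `` {x} | x. x \<noteq> v \<and> (x, x) \<in> E\<^sup>+}"
  proof (intro equalityI subsetI)
    fix S assume "S \<in> cycles E'"
    then obtain x where x: "(x, x) \<in> E'\<^sup>+" "S = E'\<^sup>+ `` {x}" by (auto simp: cycles_def)
    show "S \<in> {E'\<^sup>+ `` {x} | x. x \<noteq> v \<and> (x, x) \<in> E\<^sup>+}"
    proof (cases "x = v")
      case True
      with x via obtain y where y: "y \<noteq> v" "(y, v) \<in> E'\<^sup>+" "(v, y) \<in> E'\<^sup>+" by auto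
      then have "E'\<^sup>+ `` {v} = E'\<^sup>+ `` {y}" by (auto intro: trancl_trans)
      moreover have "(y, y) \<in> E\<^sup>+" using y iff by (meson trancl_trans)
      ultimately show ?thesis using x y True by blast
    next
      case False
      then show ?thesis using x iff by blast
    qed
  next
    fix S assume "S \<in> {E'\<^sup>+ `` {x} | x. x \<noteq> v \<and> (x, x) \<in> E\<^sup>+}"
    then show "S \<in> cycles E'" using iff by (auto simp: cycles_def)
  qed
  have eq: "E'\<^sup>+ `` {x} - {v} = E\<^sup>+ `` {x}" if "x \<noteq> v" for x
  proof -
    have "y \<in> E'\<^sup>+ `` {x} - {v} \<longleftrightarrow> y \<in> E\<^sup>+ `` {x}" for y
      using that iff[of x y] vE(1)[of x] by (cases "y = v") auto
    then show ?thesis by blast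
  qed
  have "(\<lambda>S. S - {v}) ` cycles E' = cycles E"
  proof (intro equalityI subsetI)
    fix T assume "T \<in> (\<lambda>S. S - {v}) ` cycles E'"
    then obtain x where "x \<noteq> v" "(x, x) \<in> E\<^sup>+" "T = E'\<^sup>+ `` {x} - {v}"
      unfolding cyc' by auto
    then show "T \<in> cycles E" unfolding cycles_def eq[OF \<open>x \<noteq> v\<close>] by blast
  next
    fix T assume "T \<in> cycles E"
    then obtain x where x: "(x, x) \<in> E\<^sup>+" "T = E\<^sup>+ `` {x}" by (auto simp: cycles_def)
    with vE have "x \<noteq> v" by auto
    with x eq[OF this] have "T = E'\<^sup>+ `` {x} - {v}" "E'\<^sup>+ `` {x} \<in> cycles E'"
      unfolding cyc' by auto
    then show "T \<in> (\<lambda>S. S - {v}) ` cycles E'" by blast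
  qed
  moreover have "inj_on (\<lambda>S. S - {v}) (cycles E')"
  proof (rule inj_onI)
    fix S T assume ST: "S \<in> cycles E'" "T \<in> cycles E'" "S - {v} = T - {v}"
    then obtain x y where xy: "S = E'\<^sup>+ `` {x}" "x \<noteq> v" "(x, x) \<in> E'\<^sup>+"
        "T = E'\<^sup>+ `` {y}" "y \<noteq> v" "(y, y) \<in> E'\<^sup>+"
      unfolding cyc' using iff by (smt (verit) mem_Collect_eq)
    with ST(3) have "y \<in> S" "x \<in> T" by blast+
    with xy show "S = T" by (auto intro: trancl_trans)
  qed
  ultimately show ?thesis by (metis card_image)
qed

lemma rtrancl_iff_trancl: "(x, y) \<in> R\<^sup>* \<longleftrightarrow> x = y \<or> (x, y) \<in> R\<^sup>+"
  by (auto simp: rtrancl_eq_or_trancl)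

lemma trancl_insert_end:
  assumes "v \<notin> Field E" "i \<noteq> v"
  shows "(x, y) \<in> (insert (i, v) E)\<^sup>+ \<longleftrightarrow> (x, y) \<in> E\<^sup>+ \<or> (y = v \<and> (x, i) \<in> E\<^sup>*)"
proof -
  have "(v, y) \<in> E\<^sup>* \<longleftrightarrow> y = v" for y
    using assms by (auto elim: converse_rtranclE simp: Field_def)
  then show ?thesis by (auto simp: trancl_insert)
qed

lemma trancl_insert_start:
  assumes "v \<notin> Field E" "i \<noteq> v"
  shows "(x, y) \<in> (insert (v, i) E)\<^sup>+ \<longleftrightarrow> (x, y) \<in> E\<^sup>+ \<or> (x = v \<and> (i, y) \<in> E\<^sup>*)"
proof -
  have "(x, v) \<in> E\<^sup>* \<longleftrightarrow> x = v" for x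
    using assms by (auto elim: rtranclE simp: Field_def)
  then show ?thesis by (auto simp: trancl_insert)
qed

lemma trancl_insert_loop:
  assumes "v \<notin> Field E"
  shows "(x, y) \<in> (insert (v, v) E)\<^sup>+ \<longleftrightarrow> (x, y) \<in> E\<^sup>+ \<or> (x = v \<and> y = v)"
proof -
  have "(x, v) \<in> E\<^sup>* \<longleftrightarrow> x = v" "(v, x) \<in> E\<^sup>* \<longleftrightarrow> x = v" for x
    using assms by (auto elim: rtranclE converse_rtranclE simp: Field_def)
  then show ?thesis by (auto simp: trancl_insert)
qed

definition subdivide :: "'b \<Rightarrow> 'b \<times> 'b \<Rightarrow> ('b \<times> 'b) set \<Rightarrow> ('b \<times> 'b) set" where
  "subdivide v p E = insert (fst p, v) (insert (v, snd p) (E - {p}))"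

lemma trancl_subdivide:
  assumes v: "v \<notin> Field E" and ij: "(i, j) \<in> E" and xy: "x \<noteq> v" "y \<noteq> v"
  shows "(x, y) \<in> (subdivide v (i, j) E)\<^sup>+ \<longleftrightarrow> (x, y) \<in> E\<^sup>+"
proof
  let ?E' = "subdivide v (i, j) E"
  have nv: "i \<noteq> v" "j \<noteq> v" using v ij by (auto simp: Field_def)
  show "(x, y) \<in> E\<^sup>+" if "(x, y) \<in> ?E'\<^sup>+"
  proof -
    \<comment> \<open>The induction must also describe paths that stop at \<open>v\<close>: such a
      path has just left \<open>i\<close>, and its only continuation, to \<open>j\<close>, completes
      the removed edge.\<close>
    from that have "(y \<noteq> v \<longrightarrow> (x, y) \<in> E\<^sup>+) \<and> (y = v \<longrightarrow> (x, i) \<in> E\<^sup>*)"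
    proof (induction rule: trancl_induct)
      case (base y)
      then have "(x, y) \<in> E \<or> (x = i \<and> y = v)" using xy(1) by (auto simp: subdivide_def)
      moreover have "y \<noteq> v" if "(x, y) \<in> E" using that v by (auto simp: Field_def)
      ultimately show ?case using nv by blast
    next
      case (step y z)
      then have "(y, z) \<in> E \<or> (y = i \<and> z = v) \<or> (y = v \<and> z = j)"
        by (auto simp: subdivide_def)
      moreover have "y \<noteq> v \<and> z \<noteq> v" if "(y, z) \<in> E" using that v by (auto simp: Field_def)
      ultimately show ?case
        by (metis step.IH nv(2) ij trancl_into_trancl rtrancl_into_trancl1 trancl_into_rtrancl)
    qed
    with xy show ?thesis by simp
  qed
  have "E \<subseteq> ?E'\<^sup>+"
  proof
    fix e assume e: "e \<in> E"
    have "(i, v) \<in> ?E'" "(v, j) \<in> ?E'" by (auto simp: subdivide_def)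
    then have "(i, j) \<in> ?E'\<^sup>+" by (meson r_into_trancl' trancl_into_trancl)
    then show "e \<in> ?E'\<^sup>+"
      using e by (cases "e = (i, j)") (simp_all add: subdivide_def r_into_trancl')
  qed
  then show "(x, y) \<in> ?E'\<^sup>+" if "(x, y) \<in> E\<^sup>+"
    using that trancl_mono[of "(x, y)" E "?E'\<^sup>+"] by simp
qed

lemma card_cycles_insert_end:
  assumes "v \<notin> Field E" "i \<noteq> v"
  shows "card (cycles (insert (i, v) E)) = card (cycles E)"
proof (rule card_cycles_extend[of v])
  assume "(v, v) \<in> (insert (i, v) E)\<^sup>+"
  then have "(v, v) \<in> E\<^sup>+ \<or> (v, i) \<in> E\<^sup>+"
    using assms by (auto simp: trancl_insert_end rtrancl_iff_trancl)
  with assms(1) have False by (auto dest: tranclD simp: Field_def)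
  then show "\<exists>x. x \<noteq> v \<and> (x, v) \<in> (insert (i, v) E)\<^sup>+ \<and> (v, x) \<in> (insert (i, v) E)\<^sup>+" ..
qed (use assms in \<open>auto simp: trancl_insert_end\<close>)

lemma card_cycles_insert_start:
  assumes "v \<notin> Field E" "i \<noteq> v"
  shows "card (cycles (insert (v, i) E)) = card (cycles E)"
proof (rule card_cycles_extend[of v])
  assume "(v, v) \<in> (insert (v, i) E)\<^sup>+"
  then have "(v, v) \<in> E\<^sup>+ \<or> (i, v) \<in> E\<^sup>+"
    using assms by (auto simp: trancl_insert_start rtrancl_iff_trancl)
  with assms(1) have False by (auto dest: tranclD tranclD2 simp: Field_def)
  then show "\<exists>x. x \<noteq> v \<and> (x, v) \<in> (insert (v, i) E)\<^sup>+ \<and> (v, x) \<in> (insert (v, i) E)\<^sup>+" ..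
qed (use assms in \<open>auto simp: trancl_insert_start\<close>)

text \<open>A cycle through \<open>v\<close> also contains the first vertex of \<open>p\<close>,
  since this is the only predecessor of \<open>v\<close>.\<close>

lemma card_cycles_subdivide:
  assumes v: "v \<notin> Field E" and p: "p \<in> E"
  shows "card (cycles (subdivide v p E)) = card (cycles E)"
proof (rule card_cycles_extend[of v])
  let ?E' = "subdivide v p E"
  obtain i j where ij: "p = (i, j)" by (cases p)
  have nv: "i \<noteq> v" using v p ij by (auto simp: Field_def)
  assume "(v, v) \<in> ?E'\<^sup>+"
  then obtain x where "(v, x) \<in> ?E'\<^sup>*" "(x, v) \<in> ?E'" by (meson tranclD2)
  moreover from this v p have "x = i" by (auto simp: subdivide_def Field_def ij)
  ultimately have "(i, v) \<in> ?E'\<^sup>+" "(v, i) \<in> ?E'\<^sup>+" using nv by (auto simp: rtrancl_iff_trancl)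
  then show "\<exists>x. x \<noteq> v \<and> (x, v) \<in> ?E'\<^sup>+ \<and> (v, x) \<in> ?E'\<^sup>+" using nv by blast
next
  show "v \<notin> Field E" by (fact v)
  show "(x, y) \<in> (subdivide v p E)\<^sup>+ \<longleftrightarrow> (x, y) \<in> E\<^sup>+" if "x \<noteq> v" "y \<noteq> v" for x y
    using trancl_subdivide[OF v _ that, of "fst p" "snd p"] p by simp
qed

lemma card_cycles_insert_loop:
  assumes v: "v \<notin> Field E" and E: "finite E"
  shows "card (cycles (insert (v, v) E)) = Suc (card (cycles E))"
proof -
  have vE: "(x, v) \<notin> E\<^sup>+" "(v, x) \<notin> E\<^sup>+" for x
    using v by (auto dest: tranclD tranclD2 simp: Field_def)
  have im: "(insert (v, v) E)\<^sup>+ `` {x} = (if x = v then {v} else E\<^sup>+ `` {x})" for x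
    using vE by (auto simp: trancl_insert_loop[OF v])
  have "cycles (insert (v, v) E) = insert {v} (cycles E)"
  proof (intro equalityI subsetI)
    fix S assume "S \<in> cycles (insert (v, v) E)"
    then obtain x where "(x, x) \<in> E\<^sup>+ \<or> x = v" "S = (if x = v then {v} else E\<^sup>+ `` {x})"
      unfolding cycles_def im by (auto simp: trancl_insert_loop[OF v])
    then show "S \<in> insert {v} (cycles E)" by (cases "x = v") (auto simp: cycles_def)
  next
    fix S assume "S \<in> insert {v} (cycles E)"
    then consider "S = {v}" | x where "(x, x) \<in> E\<^sup>+" "S = E\<^sup>+ `` {x}"
      by (auto simp: cycles_def)
    then show "S \<in> cycles (insert (v, v) E)"
    proof cases
      case 1
      then have "S = (insert (v, v) E)\<^sup>+ `` {v}" "(v, v) \<in> (insert (v, v) E)\<^sup>+"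
        by (simp_all only: im) (simp_all add: trancl_insert_loop[OF v])
      then show ?thesis unfolding cycles_def by blast
    next
      case (2 x)
      then have "x \<noteq> v" using vE by auto
      with 2 have "S = (insert (v, v) E)\<^sup>+ `` {x}" "(x, x) \<in> (insert (v, v) E)\<^sup>+"
        by (simp_all only: im) (simp_all add: trancl_insert_loop[OF v])
      then show ?thesis unfolding cycles_def by blast
    qed
  qed
  moreover have "{v} \<notin> cycles E" using vE by (auto simp: cycles_def)
  ultimately show ?thesis by (simp add: finite_cycles[OF E])
qed

section \<open>Contraction of a vertex\<close>

text \<open>Joining the predecessor of \<open>v\<close> to its successor means that a cycle or chain
  through \<open>v\<close> is only shortened; it vanishes when it consists of \<open>v\<close>
  alone.\<close>

definition contract :: "'b \<Rightarrow> ('b \<times> 'b) set \<Rightarrow> ('b \<times> 'b) set" where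
  "contract v E = {(i, j). i \<noteq> v \<and> j \<noteq> v \<and> ((i, j) \<in> E \<or> (i, v) \<in> E \<and> (v, j) \<in> E)}"

lemma contract_virasoro_graphs:
  assumes "E \<in> virasoro_graphs (Suc n)"
  shows "contract (Suc n) E \<in> virasoro_graphs n"
proof -
  have E: "partial_injection (Suc n) E" using assms by (simp add: virasoro_graphs_iff)
  have sv: "y = z" if "(x, y) \<in> E" "(x, z) \<in> E" for x y z
    using E that by (auto simp: partial_injection_def single_valued_def)
  have sv': "y = z" if "(y, x) \<in> E" "(z, x) \<in> E" for x y z
    using E that by (auto simp: partial_injection_def single_valued_def)
  have "contract (Suc n) E \<subseteq> {1..n} \<times> {1..n}"
    using E by (fastforce simp: partial_injection_def contract_def)
  moreover have "single_valued (contract (Suc n) E)"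
    by (rule single_valuedI) (auto simp: contract_def dest: sv)
  moreover have "single_valued ((contract (Suc n) E)\<inverse>)"
    by (rule single_valuedI) (auto simp: contract_def dest: sv')
  ultimately show ?thesis by (simp add: virasoro_graphs_iff partial_injection_def)
qed

lemma finite_virasoro_graphs: "finite (virasoro_graphs n)"
  by (rule finite_subset[of _ "Pow ({1..n} \<times> {1..n})"]) (auto simp: virasoro_graphs_def)

section \<open>The ways to insert a new vertex into a given graph\<close>

locale graph_extension =
  fixes n :: nat and E :: "(nat \<times> nat) set" and v :: nat and S :: "(nat \<times> nat) set"
  assumes E: "partial_injection n E" and v: "v = Suc n" and S: "S = chains n E"
begin

lemma sub: "E \<subseteq> {1..n} \<times> {1..n}"
  using E by (simp add: partial_injection_def)

lemma sv: "(x, y) \<in> E \<Longrightarrow> (x, z) \<in> E \<Longrightarrow> y = z"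
  using E by (auto simp: partial_injection_def single_valued_def)

lemma sv': "(y, x) \<in> E \<Longrightarrow> (z, x) \<in> E \<Longrightarrow> y = z"
  using E by (auto simp: partial_injection_def single_valued_def)

lemma fresh: "(v, x) \<notin> E" "(x, v) \<notin> E" "v \<notin> Field E"
  using sub v by (auto simp: Field_def)

lemma fresh_rtrancl: "(v, x) \<in> E\<^sup>* \<longleftrightarrow> x = v" "(x, v) \<in> E\<^sup>* \<longleftrightarrow> x = v"
  using fresh by (auto elim: rtranclE converse_rtranclE)

lemma mem_S:
  "(k, l) \<in> S \<longleftrightarrow> k \<in> {1..n} \<and> l \<in> {1..n} \<and>
    (\<forall>j. (j, k) \<notin> E) \<and> (\<forall>j. (l, j) \<notin> E) \<and> (k, l) \<in> E\<^sup>*"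
  unfolding S by (rule mem_chains[OF E])

lemma fresh_S: "(v, x) \<notin> S" "(x, v) \<notin> S"
  using v by (auto simp: mem_S)

lemma chain_start_eq: "(k, l) \<in> S \<Longrightarrow> (k', l) \<in> S \<Longrightarrow> k = k'"
  using chain_start_unique[of E k l k'] E by (auto simp: mem_S partial_injection_def)

lemma chain_end_eq: "(k, l) \<in> S \<Longrightarrow> (k, l') \<in> S \<Longrightarrow> l = l'"
  using chain_end_unique[of E k l l'] E by (auto simp: mem_S partial_injection_def)

lemma chain_to_end:
  assumes "l \<in> {1..n}" "\<forall>j. (l, j) \<notin> E"
  shows "\<exists>k. (k, l) \<in> S"
proof -
  obtain k where k: "\<forall>j. (j, k) \<notin> E" "(k, l) \<in> E\<^sup>*"
    using chain_start_exists[of E l] assms E partial_injection_finite(1)[OF E]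
    by (auto simp: partial_injection_def)
  from k(2) assms sub have "k \<in> {1..n}" by (cases rule: converse_rtranclE) auto
  then show ?thesis using assms k by (auto simp: mem_S)
qed

lemma chain_from_start:
  assumes "k \<in> {1..n}" "\<forall>j. (j, k) \<notin> E"
  shows "\<exists>l. (k, l) \<in> S"
proof -
  obtain l where l: "\<forall>j. (l, j) \<notin> E" "(k, l) \<in> E\<^sup>*"
    using chain_end_exists[of E k] assms E partial_injection_finite(1)[OF E]
    by (auto simp: partial_injection_def)
  from l(2) assms sub have "l \<in> {1..n}" by (cases rule: rtranclE) auto
  then show ?thesis using assms l by (auto simp: mem_S)
qed

lemma range_Suc: "k \<in> {1..Suc n} \<longleftrightarrow> k = v \<or> k \<in> {1..n}"
  using v by auto

lemma graphI:
  assumes "E' \<subseteq> {1..Suc n} \<times> {1..Suc n}"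
    "\<And>x y z. (x, y) \<in> E' \<Longrightarrow> (x, z) \<in> E' \<Longrightarrow> y = z"
    "\<And>x y z. (y, x) \<in> E' \<Longrightarrow> (z, x) \<in> E' \<Longrightarrow> y = z"
  shows "partial_injection (Suc n) E'"
  using assms by (auto simp: partial_injection_def single_valued_def)

lemma graph_isolated: "partial_injection (Suc n) E"
  using sub by (intro graphI) (auto dest: sv sv')

lemma chains_isolated: "chains (Suc n) E = insert (v, v) S"
proof -
  have "(k, l) \<in> chains (Suc n) E \<longleftrightarrow> (k, l) \<in> insert (v, v) S" for k l
    unfolding mem_chains[OF graph_isolated] insert_iff mem_S range_Suc
    using fresh fresh_rtrancl by auto
  then show ?thesis by auto
qed

lemma graph_loop: "partial_injection (Suc n) (insert (v, v) E)"
  using sub fresh v by (intro graphI) (auto dest: sv sv')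

lemma chains_loop: "chains (Suc n) (insert (v, v) E) = S"
proof -
  have "(k, l) \<in> chains (Suc n) (insert (v, v) E) \<longleftrightarrow> (k, l) \<in> S" for k l
    unfolding mem_chains[OF graph_loop] mem_S range_Suc rtrancl_iff_trancl
      trancl_insert_loop[OF fresh(3)]
    using v fresh by auto
  then show ?thesis by auto
qed

lemma graph_end: "(k, l) \<in> S \<Longrightarrow> partial_injection (Suc n) (insert (l, v) E)"
  using sub fresh v by (intro graphI) (auto simp: mem_S dest: sv sv')

text \<open>Only chains that end at \<open>l\<close> are affected by the new edge, and by uniqueness
  of the start there is exactly one of these.\<close>

lemma chains_end:
  assumes kl: "(k, l) \<in> S"
  shows "chains (Suc n) (insert (l, v) E) = insert (k, v) (S - {(k, l)})"
proof -
  have lv: "l \<noteq> v" "k \<noteq> v" using kl fresh_S by auto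
  have nv: "v \<notin> {1..n}" using v by simp
  have "(x, y) \<in> chains (Suc n) (insert (l, v) E) \<longleftrightarrow>
      x \<in> {1..n} \<and> (\<forall>j. (j, x) \<notin> E) \<and>
      (y = v \<and> (x, l) \<in> E\<^sup>* \<or> y \<in> {1..n} \<and> y \<noteq> l \<and> (\<forall>j. (y, j) \<notin> E) \<and> (x, y) \<in> E\<^sup>*)" for x y
  proof -
    have "(\<forall>j. (j, x) \<notin> insert (l, v) E) \<longleftrightarrow> x \<noteq> v \<and> (\<forall>j. (j, x) \<notin> E)"
      "(\<forall>j. (y, j) \<notin> insert (l, v) E) \<longleftrightarrow> y \<noteq> l \<and> (\<forall>j. (y, j) \<notin> E)"
      "(x, y) \<in> (insert (l, v) E)\<^sup>* \<longleftrightarrow> (x, y) \<in> E\<^sup>* \<or> (y = v \<and> (x, l) \<in> E\<^sup>*)"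
      using fresh trancl_insert_end[OF fresh(3) lv(1), of x y]
      by (auto simp: rtrancl_eq_or_trancl)
    then show ?thesis
      unfolding mem_chains[OF graph_end[OF kl]] range_Suc using nv lv fresh fresh_rtrancl by metis
  qed
  moreover have "x \<in> {1..n} \<and> (\<forall>j. (j, x) \<notin> E) \<and> (x, l) \<in> E\<^sup>* \<longleftrightarrow> x = k" for x
    using kl chain_start_eq[of x l k] by (auto simp: mem_S)
  moreover have "(x, y) \<in> S \<and> (x, y) \<noteq> (k, l) \<longleftrightarrow> (x, y) \<in> S \<and> y \<noteq> l" for x y
    using kl chain_start_eq by blast
  ultimately have "(x, y) \<in> chains (Suc n) (insert (l, v) E) \<longleftrightarrow>
      (x, y) \<in> insert (k, v) (S - {(k, l)})" for x y
    by (auto simp: mem_S)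
  then show ?thesis by auto
qed

lemma graph_start: "(k, l) \<in> S \<Longrightarrow> partial_injection (Suc n) (insert (v, k) E)"
  using sub fresh v by (intro graphI) (auto simp: mem_S dest: sv sv')

lemma chains_start:
  assumes kl: "(k, l) \<in> S"
  shows "chains (Suc n) (insert (v, k) E) = insert (v, l) (S - {(k, l)})"
proof -
  have lv: "k \<noteq> v" "l \<noteq> v" using kl fresh_S by auto
  have nv: "v \<notin> {1..n}" using v by simp
  have "(x, y) \<in> chains (Suc n) (insert (v, k) E) \<longleftrightarrow>
      y \<in> {1..n} \<and> (\<forall>j. (y, j) \<notin> E) \<and>
      (x = v \<and> (k, y) \<in> E\<^sup>* \<or> x \<in> {1..n} \<and> x \<noteq> k \<and> (\<forall>j. (j, x) \<notin> E) \<and> (x, y) \<in> E\<^sup>*)" for x y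
  proof -
    have "(\<forall>j. (j, x) \<notin> insert (v, k) E) \<longleftrightarrow> x \<noteq> k \<and> (\<forall>j. (j, x) \<notin> E)"
      "(\<forall>j. (y, j) \<notin> insert (v, k) E) \<longleftrightarrow> y \<noteq> v \<and> (\<forall>j. (y, j) \<notin> E)"
      "(x, y) \<in> (insert (v, k) E)\<^sup>* \<longleftrightarrow> (x, y) \<in> E\<^sup>* \<or> (x = v \<and> (k, y) \<in> E\<^sup>*)"
      using fresh trancl_insert_start[OF fresh(3) lv(1), of x y]
      by (auto simp: rtrancl_eq_or_trancl)
    then show ?thesis
      unfolding mem_chains[OF graph_start[OF kl]] range_Suc using nv lv fresh fresh_rtrancl by metis
  qed
  moreover have "y \<in> {1..n} \<and> (\<forall>j. (y, j) \<notin> E) \<and> (k, y) \<in> E\<^sup>* \<longleftrightarrow> y = l" for y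
    using kl chain_end_eq[of k y l] by (auto simp: mem_S)
  moreover have "(x, y) \<in> S \<and> (x, y) \<noteq> (k, l) \<longleftrightarrow> (x, y) \<in> S \<and> x \<noteq> k" for x y
    using kl chain_end_eq by blast
  ultimately have "(x, y) \<in> chains (Suc n) (insert (v, k) E) \<longleftrightarrow>
      (x, y) \<in> insert (v, l) (S - {(k, l)})" for x y
    by (auto simp: mem_S)
  then show ?thesis by auto
qed

lemma graph_subdivide: "p \<in> E \<Longrightarrow> partial_injection (Suc n) (subdivide v p E)"
  using sub fresh v by (cases p, intro graphI) (auto simp: subdivide_def dest: sv sv')

text \<open>The new vertex has both a predecessor and a successor, so it neither starts nor ends a
  chain. For the other vertices the existence of neighbours and the reachability are
  unchanged.\<close>

lemma chains_subdivide:
  assumes p: "p \<in> E"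
  shows "chains (Suc n) (subdivide v p E) = S"
proof -
  obtain i j where ij: "p = (i, j)" "(i, j) \<in> E" using p by (cases p) auto
  let ?E' = "subdivide v (i, j) E"
  have pred: "(\<exists>a. (a, k) \<in> ?E') \<longleftrightarrow> k = v \<or> (\<exists>a. (a, k) \<in> E)" for k
    using ij(2) unfolding subdivide_def by auto
  have succ: "(\<exists>a. (k, a) \<in> ?E') \<longleftrightarrow> k = v \<or> (\<exists>a. (k, a) \<in> E)" for k
    using ij(2) unfolding subdivide_def by auto
  have "(k, l) \<in> chains (Suc n) ?E' \<longleftrightarrow> (k, l) \<in> S" for k l
  proof (cases "k = v \<or> l = v")
    case True
    then have "(k, l) \<notin> chains (Suc n) ?E'"
      using pred[of v] succ[of v] mem_chains[OF graph_subdivide[OF ij(2)]] by blast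
    then show ?thesis using True fresh_S by auto
  next
    case False
    then show ?thesis
      using pred[of k] succ[of l] trancl_subdivide[OF fresh(3) ij(2), of k l]
      unfolding mem_chains[OF graph_subdivide[OF ij(2)]] mem_S range_Suc rtrancl_iff_trancl
      by blast
  qed
  then show ?thesis unfolding ij(1) by auto
qed

text \<open>A graph is recovered from its contraction once the predecessor and the successor of
  \<open>v\<close> are known. If both exist and differ from \<open>v\<close>, they span an edge of
  the contraction. If only a predecessor exists, it has no successor left and is the end of a chain;
  a lone successor is the start of a chain. Hence the one-sided cases can be indexed by
  chains.\<close>

lemma fibre:
  "{E' \<in> virasoro_graphs (Suc n). contract v E' = E} =
     {E} \<union> {insert (v, v) E} \<union> (\<lambda>p. subdivide v p E) ` E \<union>
     (\<lambda>p. insert (snd p, v) E) ` S \<union> (\<lambda>p. insert (v, fst p) E) ` S"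
  (is "?L = ?R")
proof (intro equalityI subsetI)
  fix E' assume "E' \<in> ?R"
  then consider "E' = E" | "E' = insert (v, v) E" | p where "p \<in> E" "E' = subdivide v p E"
    | p where "p \<in> S" "E' = insert (snd p, v) E" | p where "p \<in> S" "E' = insert (v, fst p) E"
    by blast
  then show "E' \<in> ?L"
  proof cases
    case 1
    then show ?thesis using graph_isolated fresh by (auto simp: virasoro_graphs_iff contract_def)
  next
    case 2
    then show ?thesis using graph_loop fresh by (auto simp: virasoro_graphs_iff contract_def)
  next
    case (3 p)
    then show ?thesis using graph_subdivide[of p] fresh
      by (cases p) (auto simp: virasoro_graphs_iff contract_def subdivide_def)
  next
    case (4 p)
    then show ?thesis using graph_end[of "fst p" "snd p"] fresh fresh_S
      by (cases p) (auto simp: virasoro_graphs_iff contract_def)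
  next
    case (5 p)
    then show ?thesis using graph_start[of "fst p" "snd p"] fresh fresh_S
      by (cases p) (auto simp: virasoro_graphs_iff contract_def)
  qed
next
  fix E' assume "E' \<in> ?L"
  then have E': "partial_injection (Suc n) E'" and c: "E = contract v E'"
    by (auto simp: virasoro_graphs_iff)
  have sv1: "y = z" if "(x, y) \<in> E'" "(x, z) \<in> E'" for x y z
    using E' that by (auto simp: partial_injection_def single_valued_def)
  have sv2: "y = z" if "(y, x) \<in> E'" "(z, x) \<in> E'" for x y z
    using E' that by (auto simp: partial_injection_def single_valued_def)
  have memE: "(x, y) \<in> E \<longleftrightarrow> x \<noteq> v \<and> y \<noteq> v \<and> ((x, y) \<in> E' \<or> (x, v) \<in> E' \<and> (v, y) \<in> E')" for x y
    unfolding c by (simp add: contract_def)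
  have sub': "x \<in> {1..n}" if "(x, v) \<in> E' \<or> (v, x) \<in> E'" "x \<noteq> v" for x
    using E' that range_Suc[of x] by (auto simp: partial_injection_def)
  consider (loop) "(v, v) \<in> E'" | (both) i j where "(i, v) \<in> E'" "(v, j) \<in> E'" "i \<noteq> v" "j \<noteq> v"
    | (pred) i where "(i, v) \<in> E'" "i \<noteq> v" "\<forall>j. (v, j) \<notin> E'"
    | (succ) j where "(v, j) \<in> E'" "j \<noteq> v" "\<forall>i. (i, v) \<notin> E'"
    | (none) "\<forall>j. (v, j) \<notin> E'" "\<forall>i. (i, v) \<notin> E'"
    by metis
  then show "E' \<in> ?R"
  proof cases
    case loop
    then have "(x, y) \<in> E' \<longleftrightarrow> (x, y) \<in> insert (v, v) E" for x y
      using memE[of x y] sv1[of v] sv2[of _ v] by blast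
    then have "E' = insert (v, v) E" by auto
    then show ?thesis by blast
  next
    case (both i j)
    have eq: "(x, y) \<in> subdivide v (i, j) E \<longleftrightarrow>
        (x = i \<and> y = v) \<or> (x = v \<and> y = j) \<or> ((x, y) \<in> E \<and> \<not> (x = i \<and> y = j))" for x y
      by (simp add: subdivide_def)
    have "(x, y) \<in> E' \<longleftrightarrow> (x, y) \<in> subdivide v (i, j) E" for x y
    proof (cases "x = v \<or> y = v")
      case True
      then show ?thesis using both memE[of x y] sv1[of v j y] sv2[of i v x] unfolding eq by metis
    next
      case False
      then show ?thesis
        using both memE[of x y] sv1[of i v y] sv2[of i v x] sv1[of v j y] unfolding eq by metis
    qed
    then have "E' = subdivide v (i, j) E" by auto
    moreover have "(i, j) \<in> E" using both memE by blast
    ultimately show ?thesis by blast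
  next
    case (pred i)
    then have "(x, y) \<in> E' \<longleftrightarrow> (x, y) \<in> insert (i, v) E" for x y
      using memE[of x y] sv2[of i v x] by auto
    then have eq: "E' = insert (i, v) E" by auto
    have "\<forall>j. (i, j) \<notin> E" using pred memE sv1 by metis
    then obtain k where "(k, i) \<in> S" using chain_to_end[of i] sub'[of i] pred by auto
    then have "E' \<in> (\<lambda>p. insert (snd p, v) E) ` S"
      by (intro image_eqI[of _ _ "(k, i)"]) (simp_all only: eq snd_conv)
    then show ?thesis by (rule UnI1[OF UnI2])
  next
    case (succ j)
    then have "(x, y) \<in> E' \<longleftrightarrow> (x, y) \<in> insert (v, j) E" for x y
      using memE[of x y] sv1[of v j y] by auto
    then have eq: "E' = insert (v, j) E" by auto
    have "\<forall>i. (i, j) \<notin> E" using succ memE sv2 by metis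
    then obtain l where "(j, l) \<in> S" using chain_from_start[of j] sub'[of j] succ by auto
    then have "E' \<in> (\<lambda>p. insert (v, fst p) E) ` S"
      by (intro image_eqI[of _ _ "(j, l)"]) (simp_all only: eq fst_conv)
    then show ?thesis by (rule UnI2)
  next
    case none
    then have "(x, y) \<in> E' \<longleftrightarrow> (x, y) \<in> E" for x y
      using memE[of x y] by auto
    then have "E' = E" by auto
    then show ?thesis by blast
  qed
qed

text \<open>The summand sees a graph only through its number of cycles, its edges and its chains,
  the data from which the weight is formed. All three are known for each kind of insertion, so what
  remains is to show that the five families are disjoint and that no graph is listed twice.\<close>

lemma sum_fibre:
  fixes f :: "nat \<Rightarrow> (nat \<times> nat) set \<Rightarrow> (nat \<times> nat) set \<Rightarrow> 'b::comm_monoid_add"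
  shows "(\<Sum>E' \<in> {E' \<in> virasoro_graphs (Suc n). contract v E' = E}.
            f (card (cycles E')) E' (chains (Suc n) E')) =
         (let K = card (cycles E) in
           f K E (insert (v, v) S) + f (Suc K) (insert (v, v) E) S
           + (\<Sum>p\<in>E. f K (subdivide v p E) S)
           + (\<Sum>p\<in>S. f K (insert (snd p, v) E) (insert (fst p, v) (S - {p})))
           + (\<Sum>p\<in>S. f K (insert (v, fst p) E) (insert (v, snd p) (S - {p}))))"
proof -
  let ?g = "\<lambda>E'. f (card (cycles E')) E' (chains (Suc n) E')"
  note fin = partial_injection_finite(1)[OF E] finite_chains[of n E, folded S]
  have Sv: "k \<noteq> v \<and> l \<noteq> v" if "(k, l) \<in> S" for k l using fresh_S that by auto
  have Ev: "k \<noteq> v \<and> l \<noteq> v" if "(k, l) \<in> E" for k l using fresh that by auto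
  let ?A = "(\<lambda>p. subdivide v p E) ` E" and ?B = "(\<lambda>p. insert (snd p, v) E) ` S"
    and ?C = "(\<lambda>p. insert (v, fst p) E) ` S"
  \<comment> \<open>The families are told apart by the edges at \<open>v\<close>: both an incoming
    and an outgoing one but no loop, only an incoming one, or only an outgoing one.\<close>
  have chA: "(\<exists>x. (x, v) \<in> G) \<and> (\<exists>x. (v, x) \<in> G) \<and> (v, v) \<notin> G" if "G \<in> ?A" for G
    using that Ev fresh by (auto simp: subdivide_def)
  have chB: "(\<exists>x. (x, v) \<in> G) \<and> (\<forall>x. (v, x) \<notin> G)" if "G \<in> ?B" for G
    using that fresh_S fresh by auto
  have chC: "(\<exists>x. (v, x) \<in> G) \<and> (\<forall>x. (x, v) \<notin> G)" if "G \<in> ?C" for G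
    using that fresh_S fresh by auto
  have "E \<notin> ?A" "E \<notin> ?B" "E \<notin> ?C" using chA[of E] chB[of E] chC[of E] fresh by metis+
  moreover have "insert (v, v) E \<notin> ?A" "insert (v, v) E \<notin> ?B" "insert (v, v) E \<notin> ?C"
    using chA[of "insert (v, v) E"] chB[of "insert (v, v) E"] chC[of "insert (v, v) E"]
    by (metis insertI1)+
  moreover have "?A \<inter> ?B = {}" "?A \<inter> ?C = {}" "?B \<inter> ?C = {}"
    using chA chB chC by (meson disjoint_iff)+
  moreover have "E \<noteq> insert (v, v) E" using fresh by blast
  ultimately have disj: "{E} \<inter> {insert (v, v) E} = {}" "({E} \<union> {insert (v, v) E}) \<inter> ?A = {}"
    "({E} \<union> {insert (v, v) E} \<union> ?A) \<inter> ?B = {}"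
    "({E} \<union> {insert (v, v) E} \<union> ?A \<union> ?B) \<inter> ?C = {}"
    by (simp_all only: Int_Un_distrib2 Int_insert_left Int_empty_left Un_empty singleton_iff if_False
        simp_thms)
  have injA: "inj_on (\<lambda>p. subdivide v p E) E"
  proof (rule inj_onI)
    fix p q assume pq: "p \<in> E" "q \<in> E" "subdivide v p E = subdivide v q E"
    have "(fst p, v) \<in> subdivide v q E" "(v, snd p) \<in> subdivide v q E"
      unfolding pq(3)[symmetric] by (auto simp: subdivide_def)
    then show "p = q" using pq Ev fresh by (cases p; cases q) (auto simp: subdivide_def)
  qed
  have injB: "inj_on (\<lambda>p. insert (snd p, v) E) S"
  proof (rule inj_onI)
    fix p q assume pq: "p \<in> S" "q \<in> S" "insert (snd p, v) E = insert (snd q, v) E"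
    then have "snd p = snd q" using fresh by blast
    then show "p = q" using pq chain_start_eq by (cases p; cases q) auto
  qed
  have injC: "inj_on (\<lambda>p. insert (v, fst p) E) S"
  proof (rule inj_onI)
    fix p q assume pq: "p \<in> S" "q \<in> S" "insert (v, fst p) E = insert (v, fst q) E"
    then have "fst p = fst q" using fresh by blast
    then show "p = q" using pq chain_end_eq by (cases p; cases q) auto
  qed
  have "sum ?g ({E} \<union> {insert (v, v) E} \<union> ?A \<union> ?B \<union> ?C) =
      sum ?g {E} + sum ?g {insert (v, v) E} + sum ?g ?A + sum ?g ?B + sum ?g ?C"
    using fin disj by (simp add: sum.union_disjoint del: Un_insert_left Un_insert_right)
  moreover have "sum ?g ?A = (\<Sum>p\<in>E. f (card (cycles E)) (subdivide v p E) S)"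
    unfolding sum.reindex[OF injA]
    by (rule sum.cong) (simp_all add: card_cycles_subdivide[OF fresh(3)] chains_subdivide)
  moreover have "sum ?g ?B = (\<Sum>p\<in>S. f (card (cycles E)) (insert (snd p, v) E)
      (insert (fst p, v) (S - {p})))"
    unfolding sum.reindex[OF injB]
  proof (rule sum.cong)
    fix p assume "p \<in> S"
    then show "(?g \<circ> (\<lambda>p. insert (snd p, v) E)) p =
        f (card (cycles E)) (insert (snd p, v) E) (insert (fst p, v) (S - {p}))"
      using chains_end[of "fst p" "snd p"] card_cycles_insert_end[OF fresh(3), of "snd p"]
        Sv[of "fst p" "snd p"] by simp
  qed simp
  moreover have "sum ?g ?C = (\<Sum>p\<in>S. f (card (cycles E)) (insert (v, fst p) E)
      (insert (v, snd p) (S - {p})))"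
    unfolding sum.reindex[OF injC]
  proof (rule sum.cong)
    fix p assume "p \<in> S"
    then show "(?g \<circ> (\<lambda>p. insert (v, fst p) E)) p =
        f (card (cycles E)) (insert (v, fst p) E) (insert (v, snd p) (S - {p}))"
      using chains_start[of "fst p" "snd p"] card_cycles_insert_start[OF fresh(3), of "fst p"]
        Sv[of "fst p" "snd p"] by simp
  qed simp
  ultimately show ?thesis
    unfolding fibre Let_def using chains_isolated chains_loop card_cycles_insert_loop[OF fresh(3) fin(1)]
    by simp
qed

end

text \<open>In the order of the summands, the last vertex is isolated, has a loop, lies inside an edge, at
  the end of a chain, or at the start of a chain of the contracted graph.\<close>

lemma sum_virasoro_graphs_Suc:
  fixes f :: "nat \<Rightarrow> (nat \<times> nat) set \<Rightarrow> (nat \<times> nat) set \<Rightarrow> 'b::comm_monoid_add"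
  assumes "v = Suc n"
  shows "(\<Sum>E\<in>virasoro_graphs (Suc n). f (card (cycles E)) E (chains (Suc n) E)) =
    (\<Sum>E\<in>virasoro_graphs n. let K = card (cycles E); S = chains n E in
           f K E (insert (v, v) S) + f (Suc K) (insert (v, v) E) S
           + (\<Sum>p\<in>E. f K (subdivide v p E) S)
           + (\<Sum>p\<in>S. f K (insert (snd p, v) E) (insert (fst p, v) (S - {p})))
           + (\<Sum>p\<in>S. f K (insert (v, fst p) E) (insert (v, snd p) (S - {p}))))"
  (is "_ = (\<Sum>E\<in>virasoro_graphs n. ?R E)")
proof -
  have "contract v ` virasoro_graphs (Suc n) \<subseteq> virasoro_graphs n"
    using contract_virasoro_graphs assms by blast
  note sum.group[OF finite_virasoro_graphs finite_virasoro_graphs this,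
      of "\<lambda>E. f (card (cycles E)) E (chains (Suc n) E)", symmetric]
  also have "(\<Sum>E\<in>virasoro_graphs n. \<Sum>E'\<in>{E' \<in> virasoro_graphs (Suc n). contract v E' = E}.
      f (card (cycles E')) E' (chains (Suc n) E')) = 
    (\<Sum>E\<in>virasoro_graphs n. ?R E)"
  proof (rule sum.cong)
    fix E assume "E \<in> virasoro_graphs n"
    then interpret graph_extension n E v "chains n E"
      using assms by unfold_locales (auto simp: virasoro_graphs_iff)
    show "(\<Sum>E'\<in>{E' \<in> virasoro_graphs (Suc n). contract v E' = E}.
      f (card (cycles E')) E' (chains (Suc n) E')) = 
     ?R E"
      using sum_fibre[of f] by (simp add: Let_def)
  qed simp
  finally show ?thesis .
qed

section \<open>The recursion for graph sums\<close>

text \<open>The linear functional that sends the monomial with exponent \<open>m\<close> to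
  \<open>J m\<close>. If \<open>J\<close> lists the derivatives of \<open>F\<close> at a point, this
  is the map \<L> of the parameters applied to \<open>F\<close>; with \<open>J\<close> arbitrary,
  the derivatives become free variables.\<close>

definition param_eval :: "(((2 \<times> 2) \<Rightarrow>\<^sub>0 nat) \<Rightarrow> complex) \<Rightarrow> param_poly \<Rightarrow> complex" where
  "param_eval J W = (\<Sum>m\<in>Poly_Mapping.keys W. Poly_Mapping.lookup W m * J m)"

lemma param_eval_superset:
  assumes "finite M" "Poly_Mapping.keys W \<subseteq> M"
  shows "param_eval J W = (\<Sum>m\<in>M. Poly_Mapping.lookup W m * J m)"
  unfolding param_eval_def using assms
  by (intro sum.mono_neutral_left) (auto simp: in_keys_iff)

lemma param_eval_add: "param_eval J (V + W) = param_eval J V + param_eval J W"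
proof -
  have "finite (Poly_Mapping.keys V \<union> Poly_Mapping.keys W)" by simp
  note * = param_eval_superset[OF this, of _ J]
  show ?thesis
    using keys_add[of V W] by (simp add: * lookup_add algebra_simps sum.distrib)
qed

lemma param_eval_zero [simp]: "param_eval J 0 = 0"
  by (simp add: param_eval_def)

lemma param_eval_sum: "param_eval J (\<Sum>i\<in>I. W i) = (\<Sum>i\<in>I. param_eval J (W i))"
  by (induction I rule: infinite_finite_induct) (simp_all add: param_eval_add)

lemma param_eval_single [simp]: "param_eval J (Poly_Mapping.single m k) = k * J m"
  by (simp add: param_eval_def)

lemma param_poly_eq_sum_single:
  "(W :: param_poly) = (\<Sum>m\<in>Poly_Mapping.keys W. Poly_Mapping.single m (Poly_Mapping.lookup W m))"
  by (rule poly_mapping_eqI)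
    (simp add: lookup_sum lookup_single when_def sum.delta in_keys_iff)

lemma param_eval_const_mult: "param_eval J (const k * W) = k * param_eval J W"
  by (subst (1 2) param_poly_eq_sum_single[of W])
    (simp add: sum_distrib_left param_eval_sum const_def mult_single algebra_simps)

text \<open>Multiplication by a variable is moved from the polynomial to the functional, where it is
  a shift of exponents. For the derivatives of a function this shift is one further
  differentiation.\<close>

lemma param_eval_param_mult:
  "param_eval J (param a b * W) = param_eval (\<lambda>m. J (m + Poly_Mapping.single (a, b) 1)) W"
  by (subst (1 2) param_poly_eq_sum_single[of W])
    (simp add: sum_distrib_left param_eval_sum param_def mult_single algebra_simps)

lemma param_eval_linear:
  "param_eval (\<lambda>m. \<Sum>i\<in>I. k i * J i m) W = (\<Sum>i\<in>I. k i * param_eval (J i) W)"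
  unfolding param_eval_def sum_distrib_left
  by (subst sum.swap) (simp add: mult.left_commute)

section \<open>Functionals on products of linear forms, one form for each chain\<close>

definition linear_weight :: "(2 \<times> 2 \<Rightarrow> complex) \<Rightarrow> param_poly" where
  "linear_weight y = (\<Sum>(a, b)\<in>idx. const (y (a, b)) * param a b)"

lemma finite_idx [simp]: "finite idx" by (simp add: idx_def)

lemma param_eval_linear_weight_mult:
  "param_eval J (linear_weight y * W) =
     (\<Sum>a\<in>idx. y a * param_eval (\<lambda>m. J (m + Poly_Mapping.single a 1)) W)"
  unfolding linear_weight_def sum_distrib_right param_eval_sum
  by (rule sum.cong) (auto simp: mult.assoc param_eval_const_mult param_eval_param_mult)

text \<open>The linear form of each chain is an argument of its own, not computed from its end
  points. This allows a single form to be varied, as the product rule and the lengthening of one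
  chain require.\<close>

definition chain_eval ::
  "'p set \<Rightarrow> ('p \<Rightarrow> 2 \<times> 2 \<Rightarrow> complex) \<Rightarrow> (((2 \<times> 2) \<Rightarrow>\<^sub>0 nat) \<Rightarrow> complex) \<Rightarrow> complex" where
  "chain_eval S x J = param_eval J (\<Prod>p\<in>S. linear_weight (x p))"

lemma chain_eval_empty [simp]: "chain_eval {} x J = J 0"
  by (simp add: chain_eval_def flip: single_one)

lemma chain_eval_insert:
  assumes "finite S" "p \<notin> S"
  shows "chain_eval (insert p S) x J =
    (\<Sum>a\<in>idx. x p a * chain_eval S x (\<lambda>m. J (m + Poly_Mapping.single a 1)))"
  using assms by (simp add: chain_eval_def param_eval_linear_weight_mult)

text \<open>Here the additional factor is absorbed by the functional instead of being expanded.
  Applied to the degenerate chain of a new isolated vertex, it yields the derivative of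
  \<open>J\<close> along the vector field.\<close>

lemma chain_eval_insert':
  assumes "finite S" "p \<notin> S"
  shows "chain_eval (insert p S) x J =
    chain_eval S x (\<lambda>m. \<Sum>a\<in>idx. x p a * J (m + Poly_Mapping.single a 1))"
  unfolding chain_eval_insert[OF assms] unfolding chain_eval_def by (simp add: param_eval_linear)

lemma chain_eval_cong: "(\<And>p. p \<in> S \<Longrightarrow> x p = y p) \<Longrightarrow> chain_eval S x J = chain_eval S y J"
  by (simp add: chain_eval_def)

text \<open>A chain enters only through its linear form. Hence a lengthened chain may keep its old
  index and receive the new form, which brings the sum over the larger graph back to the chains of
  the contracted one.\<close>

lemma chain_eval_replace:
  assumes "finite S" "p \<in> S" "q \<notin> S"
  shows "chain_eval (insert q (S - {p})) x J = chain_eval S (x(p := x q)) J"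
proof -
  have "(\<Prod>r\<in>S. linear_weight ((x(p := x q)) r)) =
      linear_weight (x q) * (\<Prod>r\<in>S - {p}. linear_weight (x r))"
    using assms by (simp add: prod.remove[of S p])
  then show ?thesis using assms by (simp add: chain_eval_def)
qed

lemma chain_eval_scale:
  assumes "finite S" "p \<in> S"
  shows "chain_eval S (x(p := \<lambda>a. k * y a)) J = k * chain_eval S (x(p := y)) J"
proof -
  have "chain_eval S (x(p := w)) J =
      (\<Sum>a\<in>idx. w a * chain_eval (S - {p}) x (\<lambda>m. J (m + Poly_Mapping.single a 1)))" for w
  proof -
    have "chain_eval (insert p (S - {p})) (x(p := w)) J = (\<Sum>a\<in>idx. w a *
        chain_eval (S - {p}) (x(p := w)) (\<lambda>m. J (m + Poly_Mapping.single a 1)))"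
      using assms by (subst chain_eval_insert) auto
    moreover have "chain_eval (S - {p}) (x(p := w)) J = chain_eval (S - {p}) x J" for J
      by (rule chain_eval_cong) auto
    ultimately show ?thesis using assms by (simp add: insert_absorb)
  qed
  then show ?thesis by (simp add: sum_distrib_left mult.assoc)
qed

definition param_degree :: "((2 \<times> 2) \<Rightarrow>\<^sub>0 nat) \<Rightarrow> nat" where
  "param_degree m = (\<Sum>a\<in>idx. Poly_Mapping.lookup m a)"

lemma param_degree_zero [simp]: "param_degree 0 = 0" by (simp add: param_degree_def)

lemma param_degree_add_single: "a \<in> idx \<Longrightarrow> param_degree (m + Poly_Mapping.single a 1) = Suc (param_degree m)"
  by (simp add: param_degree_def lookup_add sum.distrib lookup_single when_def sum.delta)

text \<open>This is the product rule for a multilinear expression. Each chain contributes one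
  variable, so only exponents of degree at most \<open>card S\<close> occur, and differentiability
  of \<open>J\<close> is assumed only there. In the induction, splitting off a chain shifts
  \<open>J\<close> by one degree, which the larger cardinality permits.\<close>

lemma chain_eval_has_field_derivative:
  assumes "finite S"
    and "\<And>p a. p \<in> S \<Longrightarrow> a \<in> idx \<Longrightarrow> ((\<lambda>t. x t p a) has_field_derivative x' p a) (at (0::complex))"
    and "\<And>m. param_degree m \<le> card S \<Longrightarrow> ((\<lambda>t. J t m) has_field_derivative J' m) (at 0)"
  shows "((\<lambda>t. chain_eval S (x t) (J t)) has_field_derivative
    (\<Sum>p\<in>S. chain_eval S ((x 0)(p := x' p)) (J 0)) + chain_eval S (x 0) J') (at 0)"
  using assms
proof (induction S arbitrary: J J' rule: finite_induct)
  case empty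
  then show ?case by simp
next
  case (insert p S)
  let ?sh = "\<lambda>a J (m :: (2 \<times> 2) \<Rightarrow>\<^sub>0 nat). (J (m + Poly_Mapping.single a 1) :: complex)"
  have IH: "((\<lambda>t. chain_eval S (x t) (?sh a (J t))) has_field_derivative
      (\<Sum>q\<in>S. chain_eval S ((x 0)(q := x' q)) (?sh a (J 0))) + chain_eval S (x 0) (?sh a J')) (at 0)"
    if "a \<in> idx" for a
  proof (rule insert.IH)
    show "((\<lambda>t. ?sh a (J t) m) has_field_derivative ?sh a J' m) (at 0)"
      if "param_degree m \<le> card S" for m
      using insert.prems(2)[of "m + Poly_Mapping.single a 1"] insert.hyps that \<open>a \<in> idx\<close>
      by (simp only: param_degree_add_single card_insert_disjoint Suc_le_mono simp_thms)
  qed (use insert.prems(1) in auto)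
  have deriv: "((\<lambda>t. \<Sum>a\<in>idx. x t p a * chain_eval S (x t) (?sh a (J t))) has_field_derivative
      (\<Sum>a\<in>idx. x' p a * chain_eval S (x 0) (?sh a (J 0)) +
        ((\<Sum>q\<in>S. chain_eval S ((x 0)(q := x' q)) (?sh a (J 0))) + chain_eval S (x 0) (?sh a J'))
          * x 0 p a)) (at 0)"
    by (intro derivative_intros DERIV_mult insert.prems IH) auto
  have p: "chain_eval (insert p S) ((x 0)(p := x' p)) (J 0) =
      (\<Sum>a\<in>idx. x' p a * chain_eval S (x 0) (?sh a (J 0)))"
    unfolding chain_eval_insert[OF insert.hyps]
    using insert.hyps by (intro sum.cong) (auto intro!: chain_eval_cong)
  have q: "chain_eval (insert p S) ((x 0)(q := x' q)) (J 0) =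
      (\<Sum>a\<in>idx. x 0 p a * chain_eval S ((x 0)(q := x' q)) (?sh a (J 0)))" if "q \<in> S" for q
    unfolding chain_eval_insert[OF insert.hyps] using insert.hyps that by (intro sum.cong) auto
  have "(\<Sum>q\<in>S. chain_eval (insert p S) ((x 0)(q := x' q)) (J 0)) =
      (\<Sum>q\<in>S. \<Sum>a\<in>idx. x 0 p a * chain_eval S ((x 0)(q := x' q)) (?sh a (J 0)))"
    by (rule sum.cong[OF refl q])
  also have "\<dots> = (\<Sum>a\<in>idx. \<Sum>q\<in>S. x 0 p a * chain_eval S ((x 0)(q := x' q)) (?sh a (J 0)))"
    by (rule sum.swap)
  finally have qs: "(\<Sum>q\<in>S. chain_eval (insert p S) ((x 0)(q := x' q)) (J 0)) = \<dots>" .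
  have "(\<Sum>a\<in>idx. x' p a * chain_eval S (x 0) (?sh a (J 0)) +
        ((\<Sum>q\<in>S. chain_eval S ((x 0)(q := x' q)) (?sh a (J 0))) + chain_eval S (x 0) (?sh a J'))
          * x 0 p a) =
      (\<Sum>q\<in>insert p S. chain_eval (insert p S) ((x 0)(q := x' q)) (J 0))
      + chain_eval (insert p S) (x 0) J'"
    unfolding sum.insert[OF insert.hyps] p qs
      chain_eval_insert[OF insert.hyps, of "x 0"]
    by (simp add: sum.distrib distrib_left sum_distrib_left mult.commute del: fun_upd_apply)
  moreover have "(\<lambda>t. chain_eval (insert p S) (x t) (J t)) =
      (\<lambda>t. \<Sum>a\<in>idx. x t p a * chain_eval S (x t) (?sh a (J t)))"
    by (intro ext) (rule chain_eval_insert[OF insert.hyps])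
  ultimately show ?case using deriv by (simp only:)
qed

section \<open>Graph sums as functions of free variables, and their derivatives\<close>

definition tensor :: "complex^2 \<Rightarrow> complex^2 \<Rightarrow> 2 \<times> 2 \<Rightarrow> complex" where
  "tensor u w = (\<lambda>(a, b). u $ a * w $ b)"

definition chain_coeff :: "(nat \<Rightarrow> complex^2) \<Rightarrow> nat \<times> nat \<Rightarrow> 2 \<times> 2 \<Rightarrow> complex" where
  "chain_coeff \<nu> = (\<lambda>(k, l). tensor (\<nu> k) (\<nu> l))"

text \<open>Cycle number, edges and chains are separate arguments because the insertion of a vertex
  changes them separately, in the shape in which \<open>sum_virasoro_graphs_Suc\<close> expects its
  summand.\<close>

definition graph_value where
  "graph_value c e \<nu> J K E S =
     (c / 2) ^ K * (\<Prod>(i, j)\<in>E. e i j) * chain_eval S (chain_coeff \<nu>) J"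

definition graph_sum ::
  "nat \<Rightarrow> complex \<Rightarrow> (nat \<Rightarrow> nat \<Rightarrow> complex) \<Rightarrow> (nat \<Rightarrow> complex^2) \<Rightarrow>
   (((2 \<times> 2) \<Rightarrow>\<^sub>0 nat) \<Rightarrow> complex) \<Rightarrow> complex" where
  "graph_sum n c e \<nu> J =
     (\<Sum>E\<in>virasoro_graphs n. graph_value c e \<nu> J (card (cycles E)) E (chains n E))"

text \<open>The derivative of \<open>graph_sum\<close> in the direction \<open>e'\<close>,
  \<open>\<nu>'\<close>, \<open>J'\<close>. The two ends of a chain have separate sums because these
  correspond to lengthening the chain at its start and at its end.\<close>

definition graph_sum_deriv where
  "graph_sum_deriv n c e \<nu> J e' \<nu>' J' =
     (\<Sum>E\<in>virasoro_graphs n. let S = chains n E; P = (\<Prod>(i, j)\<in>E. e i j) in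
        (c / 2) ^ card (cycles E) *
        ((\<Sum>p\<in>E. e' (fst p) (snd p) * (\<Prod>(i, j)\<in>E - {p}. e i j)) * chain_eval S (chain_coeff \<nu>) J
         + P * (\<Sum>p\<in>S. chain_eval S ((chain_coeff \<nu>)(p := tensor (\<nu>' (fst p)) (\<nu> (snd p)))) J)
         + P * (\<Sum>p\<in>S. chain_eval S ((chain_coeff \<nu>)(p := tensor (\<nu> (fst p)) (\<nu>' (snd p)))) J)
         + P * chain_eval S (chain_coeff \<nu>) J'))"

definition jet :: "(2 \<Rightarrow> 2 \<Rightarrow> diff_op) \<Rightarrow> (complex^2^2 \<Rightarrow> complex) \<Rightarrow> complex^2^2 \<Rightarrow>
    ((2 \<times> 2) \<Rightarrow>\<^sub>0 nat) \<Rightarrow> complex" where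
  "jet D F \<Omega> m = (D 1 1 ^^ Poly_Mapping.lookup m (1, 1))
          ((D 1 2 ^^ Poly_Mapping.lookup m (1, 2))
            ((D 2 2 ^^ Poly_Mapping.lookup m (2, 2)) F)) \<Omega>"

lemma virasoro_op_eq_graph_sum:
  "virasoro_op n c s \<omega> \<nu> D F \<Omega> = graph_sum n c (edge_weight s \<omega>) \<nu> (jet D F \<Omega>)"
proof -
  have "chain_weight \<nu> k l = linear_weight (chain_coeff \<nu> (k, l))" for k l
    by (simp add: chain_weight_def linear_weight_def chain_coeff_def tensor_def case_prod_unfold)
  then have "(\<Prod>(k, l)\<in>S. chain_weight \<nu> k l) = (\<Prod>p\<in>S. linear_weight (chain_coeff \<nu> p))" for S
    by (intro prod.cong) auto
  moreover have "quantise D W F \<Omega> = param_eval (jet D F \<Omega>) W" for W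
    by (simp add: quantise_def param_eval_def jet_def)
  ultimately show ?thesis
    by (simp add: virasoro_op_def graph_sum_def graph_value_def graph_weight_def
        param_eval_const_mult chain_eval_def)
qed

text \<open>Distinct chains start at distinct vertices. The bound limits the order of the operator,
  and with it the number of derivatives of \<open>F\<close> that are used.\<close>

lemma card_chains_le:
  assumes "E \<in> virasoro_graphs n"
  shows "card (chains n E) \<le> n"
proof -
  interpret graph_extension n E "Suc n" "chains n E"
    using assms by unfold_locales (auto simp: virasoro_graphs_iff)
  have "inj_on fst (chains n E)"
    by (rule inj_onI) (use chain_end_eq in fastforce)
  moreover have "fst ` chains n E \<subseteq> {1..n}" by (auto simp: chains_def)
  ultimately show ?thesis using card_inj_on_le[of fst "chains n E" "{1..n}"] by simp
qed

lemma graph_sum_has_field_derivative: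
  fixes \<nu> :: "complex \<Rightarrow> nat \<Rightarrow> complex^2" and \<nu>' :: "nat \<Rightarrow> complex^2"
  assumes e: "\<And>i j. i \<in> {1..n} \<Longrightarrow> j \<in> {1..n} \<Longrightarrow>
      ((\<lambda>t. e t i j) has_field_derivative e' i j) (at 0)"
    and \<nu>: "\<And>i a. i \<in> {1..n} \<Longrightarrow> ((\<lambda>t. \<nu> t i $ a) has_field_derivative \<nu>' i $ a) (at 0)"
    and J: "\<And>m. param_degree m \<le> n \<Longrightarrow> ((\<lambda>t. J t m) has_field_derivative J' m) (at 0)"
  shows "((\<lambda>t. graph_sum n c (e t) (\<nu> t) (J t)) has_field_derivative
    graph_sum_deriv n c (e 0) (\<nu> 0) (J 0) e' \<nu>' J') (at 0)"
  unfolding graph_sum_def graph_sum_deriv_def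
proof (rule DERIV_sum)
  fix E assume E: "E \<in> virasoro_graphs n"
  define S where "S = chains n E"
  define P where "P = (\<Prod>(i, j)\<in>E. e 0 i j)"
  define y where "y = (\<lambda>p. tensor (\<nu>' (fst p)) (\<nu> 0 (snd p)))"
  define w where "w = (\<lambda>p. tensor (\<nu> 0 (fst p)) (\<nu>' (snd p)))"
  have Esub: "E \<subseteq> {1..n} \<times> {1..n}" using E by (simp add: virasoro_graphs_def)
  then have fE: "finite E" by (rule finite_subset) simp
  have fS: "finite S" unfolding S_def by (rule finite_chains)
  have dE: "((\<lambda>t. \<Prod>p\<in>E. e t (fst p) (snd p)) has_field_derivative
      (\<Sum>p\<in>E. e' (fst p) (snd p) * (\<Prod>q\<in>E - {p}. e 0 (fst q) (snd q)))) (at 0)"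
    using Esub by (intro has_field_derivative_prod e) auto
  have x: "((\<lambda>t. chain_coeff (\<nu> t) p a) has_field_derivative (y p a + w p a)) (at 0)"
    if "p \<in> S" for p a
  proof -
    from that have p: "fst p \<in> {1..n}" "snd p \<in> {1..n}" by (auto simp: S_def chains_def)
    have "((\<lambda>t. \<nu> t (fst p) $ fst a * \<nu> t (snd p) $ snd a) has_field_derivative
        \<nu>' (fst p) $ fst a * \<nu> 0 (snd p) $ snd a + \<nu>' (snd p) $ snd a * \<nu> 0 (fst p) $ fst a) (at 0)"
      by (intro DERIV_mult \<nu> p)
    then show ?thesis
      by (simp add: y_def w_def chain_coeff_def tensor_def case_prod_unfold mult.commute)
  qed
  have dS: "((\<lambda>t. chain_eval S (chain_coeff (\<nu> t)) (J t)) has_field_derivative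
      (\<Sum>p\<in>S. chain_eval S ((chain_coeff (\<nu> 0))(p := \<lambda>a. y p a + w p a)) (J 0))
      + chain_eval S (chain_coeff (\<nu> 0)) J') (at 0)"
    using x J card_chains_le[OF E] fS
    by (intro chain_eval_has_field_derivative) (auto simp: S_def)
  \<comment> \<open>The form of a chain is a product of values at its two ends; by linearity the two
    halves of its derivative can be summed separately.\<close>
  have split: "chain_eval S (x(p := \<lambda>a. y p a + w p a)) J =
      chain_eval S (x(p := y p)) J + chain_eval S (x(p := w p)) J" if "p \<in> S" for p x J
  proof -
    have "linear_weight (\<lambda>a. y p a + w p a) = linear_weight (y p) + linear_weight (w p)"
      by (simp add: linear_weight_def const_def single_add distrib_right sum.distrib case_prod_unfold)
    then show ?thesis using fS that
      by (simp add: chain_eval_def prod.remove[of S p] distrib_right param_eval_add)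
  qed
  have "((\<lambda>t. (c / 2) ^ card (cycles E) * ((\<Prod>p\<in>E. e t (fst p) (snd p)) *
        chain_eval S (chain_coeff (\<nu> t)) (J t))) has_field_derivative
      (c / 2) ^ card (cycles E) *
      ((\<Sum>p\<in>E. e' (fst p) (snd p) * (\<Prod>q\<in>E - {p}. e 0 (fst q) (snd q))) *
        chain_eval S (chain_coeff (\<nu> 0)) (J 0) +
       ((\<Sum>p\<in>S. chain_eval S ((chain_coeff (\<nu> 0))(p := \<lambda>a. y p a + w p a)) (J 0))
      + chain_eval S (chain_coeff (\<nu> 0)) J') * (\<Prod>p\<in>E. e 0 (fst p) (snd p)))) (at 0)"
    by (intro DERIV_cmult DERIV_mult dE dS)
  moreover have "(\<Sum>p\<in>S. chain_eval S ((chain_coeff (\<nu> 0))(p := \<lambda>a. y p a + w p a)) (J 0)) =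
      (\<Sum>p\<in>S. chain_eval S ((chain_coeff (\<nu> 0))(p := y p)) (J 0)) +
      (\<Sum>p\<in>S. chain_eval S ((chain_coeff (\<nu> 0))(p := w p)) (J 0))"
    by (simp add: split sum.distrib)
  ultimately show "((\<lambda>t. graph_value c (e t) (\<nu> t) (J t) (card (cycles E)) E (chains n E)) has_field_derivative
     (let S = chains n E; P = (\<Prod>(i, j)\<in>E. e 0 i j) in
        (c / 2) ^ card (cycles E) *
        ((\<Sum>p\<in>E. e' (fst p) (snd p) * (\<Prod>(i, j)\<in>E - {p}. e 0 i j)) * chain_eval S (chain_coeff (\<nu> 0)) (J 0)
         + P * (\<Sum>p\<in>S. chain_eval S ((chain_coeff (\<nu> 0))(p := tensor (\<nu>' (fst p)) (\<nu> 0 (snd p)))) (J 0))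
         + P * (\<Sum>p\<in>S. chain_eval S ((chain_coeff (\<nu> 0))(p := tensor (\<nu> 0 (fst p)) (\<nu>' (snd p)))) (J 0))
         + P * chain_eval S (chain_coeff (\<nu> 0)) J'))) (at 0)"
    unfolding Let_def S_def[symmetric] graph_value_def case_prod_unfold
      mult.assoc[of "(c / 2) ^ card (cycles E)"]
    by (elim DERIV_cong) (simp add: distrib_left distrib_right y_def w_def mult_ac)
qed

text \<open>The five kinds of insertion match the terms on the right. A loop adds a cycle and the
  weight \<open>e v v\<close>; subdivision replaces \<open>e i j\<close> by
  \<open>e i v * e v j\<close>; lengthening replaces the differential at an end of a chain by a
  multiple of \<open>\<nu> v\<close>; an isolated vertex differentiates \<open>J\<close>. When a
  chain is lengthened at its start, the new edge points away from \<open>v\<close>, and symmetry of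
  \<open>e\<close> is what gives its weight the form \<open>e i v\<close>.\<close>

lemma graph_sum_Suc:
  assumes v: "v = Suc n" and sym: "\<And>i. i \<in> {1..n} \<Longrightarrow> e i v = e v i"
  shows "graph_sum (Suc n) c e \<nu> J = c / 2 * e v v * graph_sum n c e \<nu> J +
    graph_sum_deriv n c e \<nu> J (\<lambda>i j. e i v * e v j) (\<lambda>i. e i v *s \<nu> v)
      (\<lambda>m. \<Sum>a\<in>idx. tensor (\<nu> v) (\<nu> v) a * J (m + Poly_Mapping.single a 1))"
proof -
  let ?x = "chain_coeff \<nu>"
  let ?J' = "\<lambda>m. \<Sum>a\<in>idx. tensor (\<nu> v) (\<nu> v) a * J (m + Poly_Mapping.single a 1)"
  have "graph_sum (Suc n) c e \<nu> J =
    (\<Sum>E\<in>virasoro_graphs n. c / 2 * e v v * graph_value c e \<nu> J (card (cycles E)) E (chains n E) +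
      (let S = chains n E; P = (\<Prod>(i, j)\<in>E. e i j) in
        (c / 2) ^ card (cycles E) *
        ((\<Sum>p\<in>E. e (fst p) v * e v (snd p) * (\<Prod>(i, j)\<in>E - {p}. e i j)) * chain_eval S ?x J
         + P * (\<Sum>p\<in>S. chain_eval S (?x(p := tensor (e (fst p) v *s \<nu> v) (\<nu> (snd p)))) J)
         + P * (\<Sum>p\<in>S. chain_eval S (?x(p := tensor (\<nu> (fst p)) (e (snd p) v *s \<nu> v))) J)
         + P * chain_eval S ?x ?J')))"
    unfolding graph_sum_def[of "Suc n"] sum_virasoro_graphs_Suc[OF v, of "graph_value c e \<nu> J"]
  proof (rule sum.cong)
  fix E assume "E \<in> virasoro_graphs n"
  then interpret graph_extension n E v "chains n E"
    using v by unfold_locales (auto simp: virasoro_graphs_iff)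
  define S where "S = chains n E"
  define K where "K = card (cycles E)"
  let ?P = "\<Prod>(i, j)\<in>E. e i j"
  have fE: "finite E" using partial_injection_finite(1)[OF E] .
  have fS: "finite S" unfolding S_def by (rule finite_chains)
  have frS: "(v, x) \<notin> S" "(x, v) \<notin> S" for x using fresh_S unfolding S_def by auto
  \<comment> \<open>The new degenerate chain has the form \<open>tensor (\<nu> v) (\<nu> v)\<close>,
    which the functional absorbs.\<close>
  have isolated: "graph_value c e \<nu> J K E (insert (v, v) S) = (c / 2) ^ K * ?P * chain_eval S ?x ?J'"
    using chain_eval_insert'[OF fS frS(1), of v ?x J]
    by (simp add: graph_value_def chain_coeff_def)
  have loop: "graph_value c e \<nu> J (Suc K) (insert (v, v) E) S =
      c / 2 * e v v * graph_value c e \<nu> J K E S"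
    using fE fresh by (simp add: graph_value_def)
  have subdiv: "graph_value c e \<nu> J K (subdivide v p E) S =
      (c / 2) ^ K * (e (fst p) v * e v (snd p) * (\<Prod>(i, j)\<in>E - {p}. e i j)) * chain_eval S ?x J"
    if "p \<in> E" for p
  proof -
    have "fst p \<noteq> v" using that fresh by (cases p) auto
    then show ?thesis using fE fresh by (simp add: graph_value_def subdivide_def mult.assoc)
  qed
  have scale: "tensor u (k *s w) = (\<lambda>a. k * tensor u w a)" "tensor (k *s u) w = (\<lambda>a. k * tensor u w a)"
    for u w k by (auto simp: tensor_def fun_eq_iff)
  have lend: "graph_value c e \<nu> J K (insert (snd p, v) E) (insert (fst p, v) (S - {p})) =
      (c / 2) ^ K * ?P * chain_eval S (?x(p := tensor (\<nu> (fst p)) (e (snd p) v *s \<nu> v))) J"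
    if "p \<in> S" for p
    using fE fresh chain_eval_replace[OF fS that frS(2), of "fst p" ?x J] chain_eval_scale[OF fS that]
    by (simp add: graph_value_def chain_coeff_def scale mult_ac)
  have lstart: "graph_value c e \<nu> J K (insert (v, fst p) E) (insert (v, snd p) (S - {p})) =
      (c / 2) ^ K * ?P * chain_eval S (?x(p := tensor (e (fst p) v *s \<nu> v) (\<nu> (snd p)))) J"
    if "p \<in> S" for p
  proof -
    have "fst p \<in> {1..n}" using that by (auto simp: S_def chains_def)
    then show ?thesis
      using fE fresh chain_eval_replace[OF fS that frS(1), of "snd p" ?x J] chain_eval_scale[OF fS that]
        sym by (simp add: graph_value_def chain_coeff_def scale mult_ac)
  qed
  show "(let K = card (cycles E); S = chains n E in
      graph_value c e \<nu> J K E (insert (v, v) S) + graph_value c e \<nu> J (Suc K) (insert (v, v) E) S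
      + (\<Sum>p\<in>E. graph_value c e \<nu> J K (subdivide v p E) S)
      + (\<Sum>p\<in>S. graph_value c e \<nu> J K (insert (snd p, v) E) (insert (fst p, v) (S - {p})))
      + (\<Sum>p\<in>S. graph_value c e \<nu> J K (insert (v, fst p) E) (insert (v, snd p) (S - {p})))) =
    c / 2 * e v v * graph_value c e \<nu> J (card (cycles E)) E (chains n E) +
    (let S = chains n E; P = ?P in
        (c / 2) ^ card (cycles E) *
        ((\<Sum>p\<in>E. e (fst p) v * e v (snd p) * (\<Prod>(i, j)\<in>E - {p}. e i j)) * chain_eval S ?x J
         + P * (\<Sum>p\<in>S. chain_eval S (?x(p := tensor (e (fst p) v *s \<nu> v) (\<nu> (snd p)))) J)
         + P * (\<Sum>p\<in>S. chain_eval S (?x(p := tensor (\<nu> (fst p)) (e (snd p) v *s \<nu> v))) J)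
         + P * chain_eval S ?x ?J'))"
    unfolding Let_def S_def[symmetric] K_def[symmetric] isolated loop
    by (simp add: subdiv lend lstart distrib_left sum_distrib_left sum_distrib_right mult_ac)
  qed simp
  then show ?thesis
    unfolding graph_sum_def[of n] graph_sum_deriv_def sum.distrib
      sum_distrib_left[of "c / 2 * e v v"] .
qed

section \<open>Derivatives on symmetric matrices\<close>

definition sym_direction :: "2 \<times> 2 \<Rightarrow> complex \<Rightarrow> complex^2^2" where
  "sym_direction p t = (\<chi> i j. if (i, j) = p \<or> (i, j) = prod.swap p then t else 0)"

lemma pd_eq: "pd a b F \<Omega> = deriv (\<lambda>t. F (\<Omega> + sym_direction (a, b) t)) 0"
  by (simp add: pd_def sym_direction_def)

lemma symmetric_matrices_iff: "\<Omega> \<in> symmetric_matrices \<longleftrightarrow> (\<forall>i j. \<Omega> $ i $ j = \<Omega> $ j $ i)"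
  by (auto simp: symmetric_matrices_def transpose_def vec_eq_iff)

lemma sym_direction_symmetric [simp]: "sym_direction p t \<in> symmetric_matrices"
  by (cases p) (auto simp: symmetric_matrices_iff sym_direction_def)

lemma symmetric_matrices_add:
  "A \<in> symmetric_matrices \<Longrightarrow> B \<in> symmetric_matrices \<Longrightarrow> A + B \<in> symmetric_matrices"
  by (auto simp: symmetric_matrices_iff)

lemma sym_direction_nth:
  "sym_direction p t $ i $ j = (if (i, j) = p \<or> (i, j) = prod.swap p then t else 0)"
  by (simp add: sym_direction_def)

lemma sym_direction_zero [simp]: "sym_direction p 0 = 0"
  by (simp add: sym_direction_def vec_eq_iff)

lemma sym_direction_add: "sym_direction p (s + t) = sym_direction p s + sym_direction p t"
  by (simp add: sym_direction_def vec_eq_iff)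

lemma sum_idx: "(\<Sum>p\<in>idx. f p) = f (1, 1) + f (1, 2) + (f (2, 2) :: 'b::comm_monoid_add)"
proof -
  have "(1, 1) \<notin> {(1, 2), (2 :: 2, 2 :: 2)}" "(1, 2) \<notin> {(2 :: 2, 2 :: 2)}" by auto
  then show ?thesis unfolding idx_def by (simp add: add.assoc)
qed

lemma one_neq_two: "(1::2) \<noteq> 2" "(2::2) \<noteq> 1"
proof -
  have "1 \<notin> {2::2}" by auto
  then show "(1::2) \<noteq> 2" "(2::2) \<noteq> 1" by (metis singletonI)+
qed

lemma idx_cases: "q \<in> idx \<Longrightarrow> q = (1, 1) \<or> q = (1, 2) \<or> q = (2, 2)"
  unfolding idx_def by blast

text \<open>The direction for (1, 2) also moves the entry (2, 1), but \<open>idx\<close> does not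
  list that entry. So the directions are dual to the coordinates, without factors of 2.\<close>

lemma sum_sym_direction:
  assumes "q \<in> idx"
  shows "(\<Sum>p\<in>idx. k p * sym_direction q t $ fst p $ snd p) = k q * t"
  using idx_cases[OF assms]
  by (elim disjE) (simp_all only: sum_idx sym_direction_nth fst_conv snd_conv prod.swap_def
      prod.inject one_neq_two simp_thms if_True if_False mult_zero_right add_0_left add_0_right)

section \<open>Differentials on symmetric matrices and the chain rule\<close>

lemma has_derivative_vecI:
  fixes f :: "'a::real_normed_vector \<Rightarrow> 'b::euclidean_space^'n"
  assumes "\<And>i. ((\<lambda>x. f x $ i) has_derivative (\<lambda>h. f' h $ i)) (at a within S)"
  shows "(f has_derivative f') (at a within S)"
proof -
  have "((\<lambda>x. f x \<bullet> b) has_derivative (\<lambda>h. f' h \<bullet> b)) (at a within S)" if "b \<in> Basis" for b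
  proof -
    from that obtain i u where "b = axis i u" by (auto simp: Basis_vec_def)
    then show ?thesis using assms by (auto simp: inner_axis intro!: has_derivative_inner_left)
  qed
  then show ?thesis by (subst has_derivative_componentwise_within) blast
qed

text \<open>Only the entries listed in \<open>idx\<close> are read, so this is the differential in
  direction \<open>H\<close> for symmetric \<open>H\<close>.\<close>

definition total_derivative :: "(complex^2^2 \<Rightarrow> complex) \<Rightarrow> complex^2^2 \<Rightarrow> complex^2^2 \<Rightarrow> complex" where
  "total_derivative F \<Omega> H = (\<Sum>p\<in>idx. pd (fst p) (snd p) F \<Omega> * H $ fst p $ snd p)"

text \<open>The derivative of \<open>F\<close> is given only within symmetric matrices. It composes
  with the curve because the curve stays among them on an open neighbourhood of \<open>z\<close>,
  and on an open set the restricted derivative is the full one.\<close>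

lemma has_derivative_curve:
  fixes \<gamma> :: "complex \<Rightarrow> complex^2^2"
  assumes F: "(F has_derivative (\<lambda>H. \<Sum>p\<in>idx. k p * H $ fst p $ snd p))
      (at (\<gamma> z) within symmetric_matrices)"
    and sym: "eventually (\<lambda>t. \<gamma> t \<in> symmetric_matrices) (nhds z)"
    and d: "\<And>i j. ((\<lambda>t. \<gamma> t $ i $ j) has_field_derivative H $ i $ j) (at z)"
  shows "((\<lambda>t. F (\<gamma> t)) has_field_derivative (\<Sum>p\<in>idx. k p * H $ fst p $ snd p)) (at z)"
proof -
  obtain T where T: "open T" "z \<in> T" "\<And>t. t \<in> T \<Longrightarrow> \<gamma> t \<in> symmetric_matrices"
    using sym by (auto simp: eventually_nhds)
  have "(\<gamma> has_derivative (\<lambda>h. \<chi> i j. H $ i $ j * h)) (at z within T)"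
    using d by (intro has_derivative_vecI)
      (auto simp: has_field_derivative_def intro: has_derivative_at_withinI)
  moreover have "(F has_derivative (\<lambda>H. \<Sum>p\<in>idx. k p * H $ fst p $ snd p)) (at (\<gamma> z) within \<gamma> ` T)"
    using F T by (blast intro: has_derivative_subset)
  ultimately have "((\<lambda>t. F (\<gamma> t)) has_derivative
      (\<lambda>h. \<Sum>p\<in>idx. k p * (\<chi> i j. H $ i $ j * h) $ fst p $ snd p)) (at z within T)"
    by (rule has_derivative_in_compose)
  then have "((\<lambda>t. F (\<gamma> t)) has_derivative
      (\<lambda>h. (\<Sum>p\<in>idx. k p * H $ fst p $ snd p) * h)) (at z within T)"
    by (simp add: sum_distrib_right mult.assoc)
  then show ?thesis
    using T by (simp add: has_field_derivative_def at_within_open_NO_MATCH)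
qed

lemma complex_differentiable_at_iff:
  "complex_differentiable_at F \<Omega> \<longleftrightarrow>
    (\<exists>k. (F has_derivative (\<lambda>H. \<Sum>p\<in>idx. k p * H $ fst p $ snd p)) (at \<Omega> within symmetric_matrices))"
  (is "?L = ?R")
proof
  assume ?L
  then obtain p where "(F has_derivative (\<lambda>H. \<Sum>(a, b)\<in>idx. p a b * H $ a $ b))
      (at \<Omega> within symmetric_matrices)" by (auto simp: complex_differentiable_at_def)
  then show ?R by (intro exI[of _ "case_prod p"]) (simp add: case_prod_unfold)
next
  assume ?R
  then obtain k where "(F has_derivative (\<lambda>H. \<Sum>p\<in>idx. k p * H $ fst p $ snd p))
      (at \<Omega> within symmetric_matrices)" by blast
  then show ?L unfolding complex_differentiable_at_def
    by (intro exI[of _ "curry k"]) (simp add: case_prod_unfold)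
qed

text \<open>The coordinate direction is itself a curve of symmetric matrices, and the differential
  applied to it singles out one coefficient. Thus the coefficients, left existential in the
  definition of differentiability, are the partial derivatives.\<close>

lemma has_derivative_pd:
  assumes F: "(F has_derivative (\<lambda>H. \<Sum>p\<in>idx. k p * H $ fst p $ snd p))
      (at \<Omega> within symmetric_matrices)"
    and \<Omega>: "\<Omega> \<in> symmetric_matrices" and p: "p \<in> idx"
  shows "((\<lambda>t. F (\<Omega> + sym_direction p t)) has_field_derivative k p) (at 0)"
    and "pd (fst p) (snd p) F \<Omega> = k p"
proof -
  have "((\<lambda>t. F (\<Omega> + sym_direction p t)) has_field_derivative
      (\<Sum>q\<in>idx. k q * sym_direction p 1 $ fst q $ snd q)) (at 0)"
  proof (rule has_derivative_curve)
    show "(F has_derivative (\<lambda>H. \<Sum>p\<in>idx. k p * H $ fst p $ snd p))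
        (at (\<Omega> + sym_direction p 0) within symmetric_matrices)" using F by simp
    have "\<Omega> + sym_direction p t \<in> symmetric_matrices" for t
      by (rule symmetric_matrices_add[OF \<Omega>]) simp
    then show "eventually (\<lambda>t. \<Omega> + sym_direction p t \<in> symmetric_matrices) (nhds 0)"
      by (rule always_eventually[OF allI])
    show "((\<lambda>t. (\<Omega> + sym_direction p t) $ i $ j) has_field_derivative sym_direction p 1 $ i $ j) (at 0)"
      for i j
      unfolding sym_direction_nth vector_add_component
      by (cases "(i, j) = p \<or> (i, j) = prod.swap p")
        (simp_all only: if_True if_False, auto intro!: derivative_eq_intros)
  qed
  then show *: "((\<lambda>t. F (\<Omega> + sym_direction p t)) has_field_derivative k p) (at 0)"
    by (simp only: sum_sym_direction[OF p] mult_1_right)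
  then show "pd (fst p) (snd p) F \<Omega> = k p"
    by (simp add: pd_eq DERIV_imp_deriv)
qed

lemma complex_differentiable_at_total:
  assumes "complex_differentiable_at F \<Omega>" "\<Omega> \<in> symmetric_matrices"
  shows "(F has_derivative total_derivative F \<Omega>) (at \<Omega> within symmetric_matrices)"
proof -
  obtain k where k: "(F has_derivative (\<lambda>H. \<Sum>p\<in>idx. k p * H $ fst p $ snd p))
      (at \<Omega> within symmetric_matrices)"
    using assms by (auto simp: complex_differentiable_at_iff)
  have "total_derivative F \<Omega> = (\<lambda>H. \<Sum>p\<in>idx. k p * H $ fst p $ snd p)"
    unfolding total_derivative_def using has_derivative_pd(2)[OF k assms(2)]
    by (intro ext sum.cong) auto
  then show ?thesis using k by simp
qed

lemma complex_differentiable_at_curve: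
  fixes \<gamma> :: "complex \<Rightarrow> complex^2^2"
  assumes "complex_differentiable_at F (\<gamma> z)"
    and sym: "eventually (\<lambda>t. \<gamma> t \<in> symmetric_matrices) (nhds z)"
    and "\<And>i j. ((\<lambda>t. \<gamma> t $ i $ j) has_field_derivative H $ i $ j) (at z)"
  shows "((\<lambda>t. F (\<gamma> t)) has_field_derivative total_derivative F (\<gamma> z) H) (at z)"
proof -
  have "\<gamma> z \<in> symmetric_matrices" using sym by (rule eventually_nhds_x_imp_x)
  then show ?thesis
    using has_derivative_curve[of F "\<lambda>p. pd (fst p) (snd p) F (\<gamma> z)" \<gamma> z H]
      complex_differentiable_at_total[OF assms(1)] assms(2,3)
    by (simp add: total_derivative_def[abs_def])
qed

lemma total_derivative_direction:
  "p \<in> idx \<Longrightarrow> total_derivative F \<Omega> (sym_direction p t) = pd (fst p) (snd p) F \<Omega> * t"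
  unfolding total_derivative_def by (rule sum_sym_direction)

text \<open>The Siegel half plane has empty interior among all matrices, so openness is taken
  relative to the symmetric ones.\<close>

definition sym_open :: "(complex^2^2) set \<Rightarrow> bool" where
  "sym_open V \<longleftrightarrow> openin (top_of_set symmetric_matrices) V"

lemma sym_open_subset: "sym_open V \<Longrightarrow> V \<subseteq> symmetric_matrices"
  by (auto simp: sym_open_def dest: openin_imp_subset)

lemma sym_open_eventually:
  assumes "sym_open V" "\<gamma> z \<in> V" "isCont \<gamma> z"
    and "eventually (\<lambda>t. \<gamma> t \<in> symmetric_matrices) (nhds z)"
  shows "eventually (\<lambda>t. \<gamma> t \<in> V) (nhds z)"
proof -
  obtain T where T: "open T" "V = symmetric_matrices \<inter> T"
    using assms(1) unfolding sym_open_def openin_open by blast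
  have "eventually (\<lambda>t. \<gamma> t \<in> T) (at z)"
    using assms T by (auto intro: topological_tendstoD simp: isCont_def)
  then have "eventually (\<lambda>t. \<gamma> t \<in> T) (nhds z)"
    using assms T by (auto simp: eventually_at_filter elim: eventually_mono)
  with assms(4) show ?thesis by eventually_elim (simp add: T)
qed

lemma isCont_matrix:
  fixes \<gamma> :: "'c::t2_space \<Rightarrow> complex^2^2"
  assumes "\<And>i j. isCont (\<lambda>t. \<gamma> t $ i $ j) z"
  shows "isCont \<gamma> z"
  using assms by (auto simp: isCont_def intro!: vec_tendstoI)

lemma isCont_direction: "isCont (\<lambda>t. \<Omega> + sym_direction p t) z"
proof (rule isCont_matrix)
  fix i j
  show "isCont (\<lambda>t. (\<Omega> + sym_direction p t) $ i $ j) z"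
    unfolding sym_direction_nth vector_add_component
    by (cases "(i, j) = p \<or> (i, j) = prod.swap p") (simp_all only: if_True if_False, auto)
qed

lemma eventually_direction:
  assumes V: "sym_open V" "\<Omega> \<in> V"
  shows "eventually (\<lambda>t. \<Omega> + sym_direction p t \<in> V) (nhds 0)"
proof (rule sym_open_eventually[OF V(1) _ isCont_direction])
  show "\<Omega> + sym_direction p 0 \<in> V" using V(2) by simp
  have "\<Omega> + sym_direction p t \<in> symmetric_matrices" for t
    by (rule symmetric_matrices_add) (use sym_open_subset[OF V(1)] V(2) in auto)
  then show "eventually (\<lambda>t. \<Omega> + sym_direction p t \<in> symmetric_matrices) (nhds 0)"
    by (rule always_eventually[OF allI])
qed

lemma pd_cong:
  assumes "sym_open V" "\<Omega> \<in> V" "\<And>\<Omega>. \<Omega> \<in> V \<Longrightarrow> F \<Omega> = G \<Omega>"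
  shows "pd a b F \<Omega> = pd a b G \<Omega>"
  unfolding pd_eq
proof (rule deriv_cong_ev[OF _ refl])
  show "eventually (\<lambda>t. F (\<Omega> + sym_direction (a, b) t) = G (\<Omega> + sym_direction (a, b) t)) (nhds 0)"
    using eventually_direction[OF assms(1,2)] by eventually_elim (rule assms(3))
qed

lemma complex_differentiable_at_cong:
  assumes V: "sym_open V" "\<Omega> \<in> V" "\<And>\<Omega>. \<Omega> \<in> V \<Longrightarrow> F \<Omega> = G \<Omega>"
    and F: "complex_differentiable_at F \<Omega>"
  shows "complex_differentiable_at G \<Omega>"
proof -
  obtain T where T: "open T" "V = symmetric_matrices \<inter> T"
    using V(1) unfolding sym_open_def openin_open by blast
  obtain d where d: "0 < d" "ball \<Omega> d \<subseteq> T"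
    using T V(2) by (auto elim: openE)
  have "(G has_derivative f') (at \<Omega> within symmetric_matrices)"
    if "(F has_derivative f') (at \<Omega> within symmetric_matrices)" for f'
    by (rule has_derivative_transform_within[OF that d(1)])
      (use V T d in \<open>auto simp: dist_commute subset_iff\<close>)
  then show ?thesis using F unfolding complex_differentiable_at_def by blast
qed

section \<open>Functions differentiable several times on a relatively open set\<close>

lemma times_differentiable_on_SucI:
  assumes "\<And>\<Omega>. \<Omega> \<in> V \<Longrightarrow> complex_differentiable_at F \<Omega>"
    and "\<And>p. p \<in> idx \<Longrightarrow> times_differentiable_on k (pd (fst p) (snd p) F) V"
  shows "times_differentiable_on (Suc k) F V"
  using assms by (auto simp: idx_def)

lemma times_differentiable_on_SucD:
  assumes "times_differentiable_on (Suc k) F V"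
  shows "\<Omega> \<in> V \<Longrightarrow> complex_differentiable_at F \<Omega>"
    and "p \<in> idx \<Longrightarrow> times_differentiable_on k (pd (fst p) (snd p) F) V"
  using assms by auto

declare times_differentiable_on.simps(2) [simp del]

text \<open>Formulas for partial derivatives hold only on \<open>V\<close>. Relative openness lets
  such a formula replace the derivative at every further order.\<close>

lemma times_differentiable_on_cong:
  assumes "sym_open V" "times_differentiable_on k F V" "\<And>\<Omega>. \<Omega> \<in> V \<Longrightarrow> F \<Omega> = G \<Omega>"
  shows "times_differentiable_on k G V"
  using assms(2,3)
proof (induction k arbitrary: F G)
  case (Suc k)
  show ?case
  proof (rule times_differentiable_on_SucI)
    show "complex_differentiable_at G \<Omega>" if "\<Omega> \<in> V" for \<Omega>
      using complex_differentiable_at_cong[OF assms(1) that, of F G] Suc.prems(2)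
        times_differentiable_on_SucD(1)[OF Suc.prems(1) that] by blast
    show "times_differentiable_on k (pd (fst p) (snd p) G) V" if "p \<in> idx" for p
      by (rule Suc.IH[OF times_differentiable_on_SucD(2)[OF Suc.prems(1) that]])
        (rule pd_cong[OF assms(1)], use Suc.prems(2) in auto)
  qed
qed simp

lemma times_differentiable_on_Suc_imp:
  "times_differentiable_on (Suc k) F V \<Longrightarrow> times_differentiable_on k F V"
proof (induction k arbitrary: F)
  case (Suc k)
  show ?case
  proof (rule times_differentiable_on_SucI)
    show "complex_differentiable_at F \<Omega>" if "\<Omega> \<in> V" for \<Omega>
      by (rule times_differentiable_on_SucD(1)[OF Suc.prems that])
    show "times_differentiable_on k (pd (fst p) (snd p) F) V" if "p \<in> idx" for p
      by (rule Suc.IH[OF times_differentiable_on_SucD(2)[OF Suc.prems that]])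
  qed
qed simp

lemma times_differentiable_on_le:
  "times_differentiable_on k F V \<Longrightarrow> j \<le> k \<Longrightarrow> times_differentiable_on j F V"
  by (induction k) (auto simp: le_Suc_eq dest: times_differentiable_on_Suc_imp)

section \<open>Mixed derivatives\<close>

text \<open>The second difference of \<open>f\<close> is estimated by the mean value inequality in the first
  variable. As it is symmetric in the two variables, its limit yields both mixed derivatives.\<close>

lemma second_difference_tendsto:
  fixes f g :: "complex \<Rightarrow> complex \<Rightarrow> complex"
  assumes r: "r > 0"
    and f: "\<And>s t. norm s < r \<Longrightarrow> norm t < r \<Longrightarrow> ((\<lambda>s. f s t) has_field_derivative g s t) (at s)"
    and g: "((\<lambda>(s, t). g s t) has_derivative (\<lambda>(h, k). a * h + b * k)) (at (0, 0))"
  shows "((\<lambda>h. (f h h - f h 0 - f 0 h + f 0 0) / h\<^sup>2) \<longlongrightarrow> b) (at 0)"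
proof (rule LIM_I)
  fix e :: real assume e: "0 < e"
  \<comment> \<open>The mean value estimate below costs \<open>3 * e'\<close>: twice
    \<open>e'\<close> from \<open>g s h\<close> and once from \<open>g s 0\<close>.\<close>
  define e' where "e' = e / 4"
  have e': "0 < e'" using e by (simp add: e'_def)
  from g[unfolded has_derivative_at_alt] e' obtain d where d: "0 < d"
    "\<And>y. norm (y - (0, 0)) < d \<Longrightarrow> norm ((case y of (s, t) \<Rightarrow> g s t) - (case (0, 0) of (s, t) \<Rightarrow> g s t)
        - (case y - (0, 0) of (h, k) \<Rightarrow> a * h + b * k)) \<le> e' * norm (y - (0, 0))"
    by blast
  have lin: "norm (g s t - g 0 0 - (a * s + b * t)) \<le> e' * (norm s + norm t)"
    if "norm s + norm t < d" for s t
  proof -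
    have le: "norm (s, t) \<le> norm s + norm t" by (rule norm_Pair_le)
    with that have "norm (g s t - g 0 0 - (a * s + b * t)) \<le> e' * norm (s, t)"
      using d(2)[of "(s, t)"] by simp
    also have "\<dots> \<le> e' * (norm s + norm t)" using le e' by simp
    finally show ?thesis .
  qed
  \<comment> \<open>The bound \<open>r\<close> keeps the arguments where \<open>f\<close> is
    differentiable. Half of \<open>d\<close> suffices for the linear estimate, as the norms of
    \<open>s\<close> and \<open>h\<close> together are at most twice that of
    \<open>h\<close>.\<close>
  define \<delta> where "\<delta> = min r (d / 2)"
  have \<delta>: "0 < \<delta>" "\<delta> \<le> r" "2 * \<delta> \<le> d" using r d(1) by (auto simp: \<delta>_def)
  have "norm ((f h h - f h 0 - f 0 h + f 0 0) / h\<^sup>2 - b) < e" if h: "h \<noteq> 0" "norm (h - 0) < \<delta>" for h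
  proof -
    \<comment> \<open>The increment of this function from 0 to \<open>h\<close> is the second
      difference minus \<open>b * h\<^sup>2\<close>.\<close>
    define \<phi> where "\<phi> = (\<lambda>s. f s h - f s 0 - b * h * s)"
    have d\<phi>: "(\<phi> has_field_derivative (g s h - g s 0 - b * h)) (at s within cball 0 (norm h))"
      if "s \<in> cball 0 (norm h)" for s
    proof -
      have "norm s < r" "norm h < r" using that h \<delta> by auto
      moreover have "norm (0::complex) < r" using r by simp
      ultimately have "(\<phi> has_field_derivative (g s h - g s 0 - b * h * 1)) (at s)"
        unfolding \<phi>_def by (intro DERIV_diff f DERIV_cmult DERIV_ident)
      then show ?thesis by (simp add: has_field_derivative_at_within)
    qed
    have b\<phi>: "norm (g s h - g s 0 - b * h) \<le> 3 * e' * norm h" if "s \<in> cball 0 (norm h)" for s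
    proof -
      have s: "norm s \<le> norm h" using that by simp
      have "norm (g s h - g s 0 - b * h) =
          norm ((g s h - g 0 0 - (a * s + b * h)) - (g s 0 - g 0 0 - (a * s + b * 0)))"
        by (simp add: algebra_simps)
      also have "\<dots> \<le> e' * (norm s + norm h) + e' * (norm s + norm (0::complex))"
        using s h \<delta> by (intro norm_triangle_le_diff add_mono lin) auto
      also have "\<dots> \<le> e' * (norm h + norm h) + e' * norm h"
        using s e' by (intro add_mono mult_left_mono) auto
      finally show ?thesis by (simp add: algebra_simps)
    qed
    have "norm (\<phi> h - \<phi> 0) \<le> 3 * e' * norm h * norm (h - 0)"
      by (rule field_differentiable_bound[OF convex_cball d\<phi> b\<phi>]) auto
    then have "norm ((f h h - f h 0 - f 0 h + f 0 0) - b * h\<^sup>2) \<le> 3 * e' * norm h ^ 2"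
      by (simp add: \<phi>_def power2_eq_square algebra_simps)
    moreover have "(f h h - f h 0 - f 0 h + f 0 0) / h\<^sup>2 - b =
        ((f h h - f h 0 - f 0 h + f 0 0) - b * h\<^sup>2) / h\<^sup>2"
      using h by (simp add: field_simps)
    ultimately have "norm ((f h h - f h 0 - f 0 h + f 0 0) / h\<^sup>2 - b) \<le> 3 * e'"
      using h by (simp add: norm_divide norm_power divide_le_eq)
    then show ?thesis using e by (simp add: e'_def)
  qed
  then show "\<exists>s>0. \<forall>h. h \<noteq> 0 \<and> norm (h - 0) < s \<longrightarrow>
      norm ((f h h - f h 0 - f 0 h + f 0 0) / h\<^sup>2 - b) < e"
    using \<delta>(1) by blast
qed

lemma linear_sym_direction: "linear (sym_direction p)"
proof
  show "sym_direction p (s + t) = sym_direction p s + sym_direction p t" for s t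
    by (rule sym_direction_add)
  show "sym_direction p (r *\<^sub>R t) = r *\<^sub>R sym_direction p t" for r t
    by (simp add: vec_eq_iff sym_direction_nth)
qed

text \<open>The plane through \<Omega> spanned by the two directions reduces this to two complex
  variables. The first derivative along \<open>p\<close> is the function \<open>?G\<close> on this
  plane, and the coefficient of the second variable in its differential is the mixed
  derivative.\<close>

lemma pd_second_difference:
  assumes V: "sym_open V" "\<Omega> \<in> V" and F: "times_differentiable_on 2 F V"
    and p: "p \<in> idx" and q: "q \<in> idx"
  shows "((\<lambda>h. (F (\<Omega> + sym_direction p h + sym_direction q h) - F (\<Omega> + sym_direction p h)
      - F (\<Omega> + sym_direction q h) + F \<Omega>) / h\<^sup>2) \<longlongrightarrow>
      pd (fst q) (snd q) (pd (fst p) (snd p) F) \<Omega>) (at 0)"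
proof -
  let ?G = "pd (fst p) (snd p) F"
  let ?w = "\<lambda>s t. \<Omega> + sym_direction p s + sym_direction q t"
  have sV: "V \<subseteq> symmetric_matrices" by (rule sym_open_subset[OF V(1)])
  have wsym: "?w s t \<in> symmetric_matrices" for s t
    using V sV by (intro symmetric_matrices_add) auto
  have F2: "times_differentiable_on (Suc (Suc 0)) F V" using F by (simp add: numeral_2_eq_2)
  note dF = times_differentiable_on_SucD(1)[OF F2]
  note dG = times_differentiable_on_SucD(1)[OF times_differentiable_on_SucD(2)[OF F2 p]]
  obtain T where T: "open T" "V = symmetric_matrices \<inter> T"
    using V(1) unfolding sym_open_def openin_open by blast
  have blin: "bounded_linear (\<lambda>x. sym_direction p (fst x) + sym_direction q (snd x))"
    by (intro linear_conv_bounded_linear[THEN iffD1] linear_compose_add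
        linear_compose[OF _ linear_sym_direction, unfolded o_def] linear_fst linear_snd)
  have dw: "((\<lambda>x. ?w (fst x) (snd x)) has_derivative
      (\<lambda>x. sym_direction p (fst x) + sym_direction q (snd x))) (at x)" for x
    using has_derivative_add[OF has_derivative_const bounded_linear_imp_has_derivative[OF blin],
        of \<Omega> "at x"]
    by (simp add: add.assoc)
  have "isCont (\<lambda>x. ?w (fst x) (snd x)) (0, 0)" by (rule has_derivative_continuous[OF dw])
  then have "eventually (\<lambda>x. ?w (fst x) (snd x) \<in> T) (at (0, 0))"
    using T V(2) by (auto simp: isCont_def dest: topological_tendstoD)
  then have "eventually (\<lambda>x. ?w (fst x) (snd x) \<in> T) (nhds (0, 0))"
    using T V(2) by (simp add: eventually_nhds_conv_at)
  then obtain r where r: "0 < r" "\<And>x. dist x (0, 0) < r \<Longrightarrow> ?w (fst x) (snd x) \<in> T"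
    by (auto simp: eventually_nhds_metric)
  \<comment> \<open>The radius is halved because the norm of a pair is bounded by the sum of the
    norms.\<close>
  have inV: "?w s t \<in> V" if "norm s < r / 2" "norm t < r / 2" for s t
  proof -
    have "norm (s, t) < r" using norm_Pair_le[of s t] that by linarith
    then show ?thesis using r(2)[of "(s, t)"] T wsym by (simp add: dist_norm)
  qed
  show ?thesis
  proof (rule second_difference_tendsto[of "r / 2" "\<lambda>s t. F (?w s t)" "\<lambda>s t. ?G (?w s t)"
        "pd (fst p) (snd p) ?G \<Omega>", simplified sym_direction_zero add_0_right])
    show "0 < r / 2" using r by simp
    show "((\<lambda>s. F (?w s t)) has_field_derivative ?G (?w s t)) (at s)"
      if "norm s < r / 2" "norm t < r / 2" for s t
    proof -
      have "((\<lambda>u. F (?w s t + sym_direction p u)) has_field_derivative ?G (?w s t)) (at 0)"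
        using has_derivative_pd(1)[OF _ wsym p, of F "\<lambda>p. pd (fst p) (snd p) F (?w s t)"]
          complex_differentiable_at_total[OF dF[OF inV[OF that]] wsym]
        by (simp add: total_derivative_def[abs_def])
      moreover have "(\<lambda>u. F (?w s t + sym_direction p u)) = (\<lambda>u. F (?w (u + s) t))"
        by (simp add: sym_direction_add algebra_simps)
      ultimately show ?thesis
        using DERIV_shift[of "\<lambda>s. F (?w s t)" "?G (?w s t)" 0 s] by simp
    qed
    have "(?G has_derivative total_derivative ?G (?w (fst (0, 0)) (snd (0, 0))))
        (at (?w (fst (0, 0)) (snd (0, 0))) within range (\<lambda>x. ?w (fst x) (snd x)))"
      using complex_differentiable_at_total[OF dG[OF V(2)]] V(2) sV wsym
      by (auto intro: has_derivative_subset)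
    from has_derivative_in_compose[OF dw this]
    have "((\<lambda>x. ?G (?w (fst x) (snd x))) has_derivative (\<lambda>x. total_derivative ?G \<Omega>
        (sym_direction p (fst x) + sym_direction q (snd x)))) (at (0, 0))"
      by simp
    moreover have "total_derivative ?G \<Omega> (sym_direction p s + sym_direction q t) =
        pd (fst p) (snd p) ?G \<Omega> * s + pd (fst q) (snd q) ?G \<Omega> * t" for s t
      using total_derivative_direction[OF p, of ?G \<Omega> s] total_derivative_direction[OF q, of ?G \<Omega> t]
      by (simp add: total_derivative_def distrib_left sum.distrib)
    ultimately show "((\<lambda>(s, t). ?G (?w s t)) has_derivative
        (\<lambda>(h, k). pd (fst p) (snd p) ?G \<Omega> * h + pd (fst q) (snd q) ?G \<Omega> * k)) (at (0, 0))"
      by (simp add: case_prod_unfold)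
  qed
qed

lemma pd_commute:
  assumes "sym_open V" "\<Omega> \<in> V" "times_differentiable_on 2 F V" "p \<in> idx" "q \<in> idx"
  shows "pd (fst p) (snd p) (pd (fst q) (snd q) F) \<Omega> = pd (fst q) (snd q) (pd (fst p) (snd p) F) \<Omega>"
proof -
  have "(\<lambda>h. (F (\<Omega> + sym_direction p h + sym_direction q h) - F (\<Omega> + sym_direction p h)
      - F (\<Omega> + sym_direction q h) + F \<Omega>) / h\<^sup>2) =
    (\<lambda>h. (F (\<Omega> + sym_direction q h + sym_direction p h) - F (\<Omega> + sym_direction q h)
      - F (\<Omega> + sym_direction p h) + F \<Omega>) / h\<^sup>2)"
    by (simp add: algebra_simps)
  then show ?thesis
    using pd_second_difference[OF assms] pd_second_difference[OF assms(1-3) assms(5,4)]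
    by (metis (no_types, lifting) tendsto_unique trivial_limit_at)
qed

lemma times_differentiable_on_funpow:
  assumes "p \<in> idx"
  shows "times_differentiable_on (i + k) F V \<Longrightarrow>
    times_differentiable_on k ((pd (fst p) (snd p) ^^ i) F) V"
proof (induction i arbitrary: F)
  case (Suc i)
  have "times_differentiable_on (i + k) (pd (fst p) (snd p) F) V"
    using Suc.prems by (intro times_differentiable_on_SucD(2)[OF _ assms]) simp
  then show ?case by (simp add: Suc.IH funpow_swap1 del: funpow.simps(2) add: funpow_Suc_right)
qed simp

lemma pd_funpow_cong:
  assumes V: "sym_open V" and "\<And>\<Omega>. \<Omega> \<in> V \<Longrightarrow> F \<Omega> = G \<Omega>" "\<Omega> \<in> V"
  shows "(pd a b ^^ i) F \<Omega> = (pd a b ^^ i) G \<Omega>"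
  using assms(2,3)
proof (induction i arbitrary: \<Omega>)
  case (Suc i)
  then show ?case by (auto intro!: pd_cong[OF V])
qed simp

lemma pd_funpow_commute:
  assumes V: "sym_open V" and p: "p \<in> idx" and q: "q \<in> idx"
  shows "times_differentiable_on (Suc i) F V \<Longrightarrow> \<Omega> \<in> V \<Longrightarrow>
    pd (fst p) (snd p) ((pd (fst q) (snd q) ^^ i) F) \<Omega> =
    (pd (fst q) (snd q) ^^ i) (pd (fst p) (snd p) F) \<Omega>"
proof (induction i arbitrary: F \<Omega>)
  case (Suc i)
  let ?P = "pd (fst p) (snd p)" and ?Q = "pd (fst q) (snd q)"
  have F2: "times_differentiable_on 2 F V"
    by (rule times_differentiable_on_le[OF Suc.prems(1)]) simp
  have "?P ((?Q ^^ Suc i) F) \<Omega> = ?P ((?Q ^^ i) (?Q F)) \<Omega>"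
    by (simp add: funpow_Suc_right del: funpow.simps(2))
  also have "\<dots> = (?Q ^^ i) (?P (?Q F)) \<Omega>"
    by (rule Suc.IH[OF times_differentiable_on_SucD(2)[OF Suc.prems(1) q] Suc.prems(2)])
  also have "\<dots> = (?Q ^^ i) (?Q (?P F)) \<Omega>"
    by (rule pd_funpow_cong[OF V pd_commute[OF V _ F2 p q] Suc.prems(2)])
  also have "\<dots> = (?Q ^^ Suc i) (?P F) \<Omega>"
    by (simp add: funpow_Suc_right del: funpow.simps(2))
  finally show ?case .
qed simp

section \<open>Jets, that is, the families of all partial derivatives\<close>

lemma idx_mem: "(1, 1) \<in> idx" "(1, 2) \<in> idx" "(2, 2) \<in> idx"
  by (simp_all add: idx_def)

lemma param_degree_eq:
  "param_degree m = Poly_Mapping.lookup m (1, 1) + Poly_Mapping.lookup m (1, 2)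
    + Poly_Mapping.lookup m (2, 2)"
  unfolding param_degree_def by (rule sum_idx)

lemma lookup_add_single:
  "Poly_Mapping.lookup (m + Poly_Mapping.single p 1) q =
    (if q = p then Suc (Poly_Mapping.lookup m q) else Poly_Mapping.lookup m q)"
  by (auto simp: lookup_add lookup_single when_def)

lemma times_differentiable_on_jet:
  assumes F: "times_differentiable_on n F V" and m: "param_degree m + k \<le> n"
  shows "times_differentiable_on k (\<lambda>\<Omega>. jet pd F \<Omega> m) V"
proof -
  let ?i = "Poly_Mapping.lookup m (1, 1)" and ?j = "Poly_Mapping.lookup m (1, 2)"
    and ?k = "Poly_Mapping.lookup m (2, 2)"
  have "times_differentiable_on (?k + (?j + (?i + k))) F V"
    by (rule times_differentiable_on_le[OF F]) (use m in \<open>simp add: param_degree_eq\<close>)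
  from times_differentiable_on_funpow[OF idx_mem(3) this]
  have "times_differentiable_on (?j + (?i + k)) ((pd 2 2 ^^ ?k) F) V" by simp
  from times_differentiable_on_funpow[OF idx_mem(2) this]
  have "times_differentiable_on (?i + k) ((pd 1 2 ^^ ?j) ((pd 2 2 ^^ ?k) F)) V" by simp
  from times_differentiable_on_funpow[OF idx_mem(1) this]
  show ?thesis unfolding jet_def by simp
qed

text \<open>A jet takes its derivatives in a fixed order, while the new derivative is applied last.
  It is moved past the blocks to its left; the total order stays at most \<open>n\<close>, so each
  exchange is justified by the remaining differentiability.\<close>

lemma pd_jet:
  assumes V: "sym_open V" "\<Omega> \<in> V" and F: "times_differentiable_on n F V"
    and m: "param_degree m < n" and p: "p \<in> idx"
  shows "pd (fst p) (snd p) (\<lambda>\<Omega>. jet pd F \<Omega> m) \<Omega> = jet pd F \<Omega> (m + Poly_Mapping.single p 1)"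
proof -
  let ?i = "Poly_Mapping.lookup m (1, 1)" and ?j = "Poly_Mapping.lookup m (1, 2)"
    and ?k = "Poly_Mapping.lookup m (2, 2)"
  let ?Y = "(pd 2 2 ^^ ?k) F"
  let ?X = "(pd 1 2 ^^ ?j) ?Y"
  have "times_differentiable_on (?k + (?j + Suc ?i)) F V"
    by (rule times_differentiable_on_le[OF F]) (use m in \<open>simp add: param_degree_eq\<close>)
  from times_differentiable_on_funpow[OF idx_mem(3) this]
  have Y: "times_differentiable_on (?j + Suc ?i) ?Y V" by simp
  from times_differentiable_on_funpow[OF idx_mem(2) this]
  have X: "times_differentiable_on (Suc ?i) ?X V" by simp
  have Y': "times_differentiable_on (Suc ?j) ?Y V"
    by (rule times_differentiable_on_le[OF Y]) simp
  have F': "times_differentiable_on (Suc ?k) F V"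
    by (rule times_differentiable_on_le[OF F]) (use m in \<open>simp add: param_degree_eq\<close>)
  have jet: "(\<lambda>\<Omega>. jet pd F \<Omega> m) = (pd 1 1 ^^ ?i) ?X" by (simp add: jet_def fun_eq_iff)
  consider "p = (1, 1)" | "p = (1, 2)" | "p = (2, 2)" using idx_cases[OF p] by blast
  then show ?thesis
  proof cases
    case 1
    have "jet pd F \<Omega> (m + Poly_Mapping.single p 1) = (pd 1 1 ^^ Suc ?i) ?X \<Omega>"
      unfolding jet_def lookup_add_single 1 prod.inject
      by (simp only: one_neq_two simp_thms if_True if_False)
    then show ?thesis unfolding jet by (simp add: 1)
  next
    case 2
    have "jet pd F \<Omega> (m + Poly_Mapping.single p 1) = (pd 1 1 ^^ ?i) (pd 1 2 ?X) \<Omega>"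
      unfolding jet_def lookup_add_single 2 prod.inject
      by (simp only: one_neq_two simp_thms if_True if_False funpow.simps o_apply)
    then show ?thesis unfolding jet
      using pd_funpow_commute[OF V(1) idx_mem(2,1) X V(2)] by (simp add: 2)
  next
    case 3
    have "jet pd F \<Omega> (m + Poly_Mapping.single p 1) =
        (pd 1 1 ^^ ?i) ((pd 1 2 ^^ ?j) (pd 2 2 ?Y)) \<Omega>"
      unfolding jet_def lookup_add_single 3 prod.inject
      by (simp only: one_neq_two simp_thms if_True if_False funpow.simps o_apply)
    also have "\<dots> = (pd 1 1 ^^ ?i) (pd 2 2 ?X) \<Omega>"
      using pd_funpow_commute[OF V(1) idx_mem(3,2) Y']
      by (intro pd_funpow_cong[OF V(1) _ V(2)]) simp
    also have "\<dots> = pd 2 2 ((pd 1 1 ^^ ?i) ?X) \<Omega>"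
      using pd_funpow_commute[OF V(1) idx_mem(3,1) X V(2)] by simp
    finally show ?thesis unfolding jet by (simp add: 3)
  qed
qed

text \<open>Along a curve with tangent \<open>tensor u w\<close> the jet of \<open>F\<close> moves
  by a combination of its own shifts. With both vectors equal to \<open>\<nu> v\<close> this is the
  direction of \<open>J\<close> in \<open>graph_sum_Suc\<close>.\<close>

lemma jet_has_field_derivative:
  assumes V: "sym_open V" "\<gamma> 0 \<in> V" and F: "times_differentiable_on n F V"
    and m: "param_degree m < n"
    and sym: "eventually (\<lambda>t. \<gamma> t \<in> symmetric_matrices) (nhds 0)"
    and d: "\<And>i j. ((\<lambda>t. \<gamma> t $ i $ j) has_field_derivative tensor u w (i, j)) (at 0)"
  shows "((\<lambda>t. jet pd F (\<gamma> t) m) has_field_derivative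
    (\<Sum>a\<in>idx. tensor u w a * jet pd F (\<gamma> 0) (m + Poly_Mapping.single a 1))) (at 0)"
proof -
  have "times_differentiable_on (Suc 0) (\<lambda>\<Omega>. jet pd F \<Omega> m) V"
    using m by (intro times_differentiable_on_jet[OF F]) simp
  from times_differentiable_on_SucD(1)[OF this V(2)]
  have "((\<lambda>t. jet pd F (\<gamma> t) m) has_field_derivative
      total_derivative (\<lambda>\<Omega>. jet pd F \<Omega> m) (\<gamma> 0) (\<chi> i j. tensor u w (i, j))) (at 0)"
    by (rule complex_differentiable_at_curve[where \<gamma> = \<gamma>]) (use sym d in simp_all)
  moreover have "total_derivative (\<lambda>\<Omega>. jet pd F \<Omega> m) (\<gamma> 0) (\<chi> i j. tensor u w (i, j)) =
      (\<Sum>a\<in>idx. tensor u w a * jet pd F (\<gamma> 0) (m + Poly_Mapping.single a 1))"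
    unfolding total_derivative_def using pd_jet[OF V F m]
    by (intro sum.cong) (simp_all add: mult.commute)
  ultimately show ?thesis by simp
qed

lemma pd_direction:
  assumes "complex_differentiable_at F \<Omega>" "\<Omega> \<in> symmetric_matrices" "p \<in> idx"
  shows "((\<lambda>t. F (\<Omega> + sym_direction p t)) has_field_derivative pd (fst p) (snd p) F \<Omega>) (at 0)"
  using has_derivative_pd(1)[OF _ assms(2,3), of F "\<lambda>p. pd (fst p) (snd p) F \<Omega>"]
    complex_differentiable_at_total[OF assms(1,2)] by (simp add: total_derivative_def[abs_def])

lemma pd_eqI:
  "((\<lambda>t. F (\<Omega> + sym_direction p t)) has_field_derivative d) (at 0) \<Longrightarrow> pd (fst p) (snd p) F \<Omega> = d"
  by (simp add: pd_eq DERIV_imp_deriv)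

section \<open>Rules of differentiation\<close>

lemma complex_differentiable_at_const [simp]: "complex_differentiable_at (\<lambda>_. c) \<Omega>"
  unfolding complex_differentiable_at_iff by (intro exI[of _ "\<lambda>_. 0"]) simp

lemma complex_differentiable_at_add:
  assumes "complex_differentiable_at F \<Omega>" "complex_differentiable_at G \<Omega>"
  shows "complex_differentiable_at (\<lambda>\<Omega>. F \<Omega> + G \<Omega>) \<Omega>"
proof -
  obtain k l where "(F has_derivative (\<lambda>H. \<Sum>p\<in>idx. k p * H $ fst p $ snd p))
      (at \<Omega> within symmetric_matrices)" "(G has_derivative (\<lambda>H. \<Sum>p\<in>idx. l p * H $ fst p $ snd p))
      (at \<Omega> within symmetric_matrices)"
    using assms unfolding complex_differentiable_at_iff by blast
  from has_derivative_add[OF this] show ?thesis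
    unfolding complex_differentiable_at_iff
    by (intro exI[of _ "\<lambda>p. k p + l p"]) (simp add: distrib_right sum.distrib)
qed

lemma complex_differentiable_at_mult:
  assumes "complex_differentiable_at F \<Omega>" "complex_differentiable_at G \<Omega>"
  shows "complex_differentiable_at (\<lambda>\<Omega>. F \<Omega> * G \<Omega>) \<Omega>"
proof -
  obtain k l where "(F has_derivative (\<lambda>H. \<Sum>p\<in>idx. k p * H $ fst p $ snd p))
      (at \<Omega> within symmetric_matrices)" "(G has_derivative (\<lambda>H. \<Sum>p\<in>idx. l p * H $ fst p $ snd p))
      (at \<Omega> within symmetric_matrices)"
    using assms unfolding complex_differentiable_at_iff by blast
  from has_derivative_mult[OF this] show ?thesis
    unfolding complex_differentiable_at_iff
    by (intro exI[of _ "\<lambda>p. F \<Omega> * l p + k p * G \<Omega>"])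
      (simp add: distrib_right distrib_left sum.distrib sum_distrib_left sum_distrib_right mult_ac)
qed

lemma complex_differentiable_at_comp:
  assumes "(f has_field_derivative d) (at (F \<Omega>))" "complex_differentiable_at F \<Omega>"
  shows "complex_differentiable_at (\<lambda>\<Omega>. f (F \<Omega>)) \<Omega>"
proof -
  obtain k where "(F has_derivative (\<lambda>H. \<Sum>p\<in>idx. k p * H $ fst p $ snd p))
      (at \<Omega> within symmetric_matrices)"
    using assms unfolding complex_differentiable_at_iff by blast
  from has_derivative_compose[OF this assms(1)[unfolded has_field_derivative_def]]
  show ?thesis
    unfolding complex_differentiable_at_iff
    by (intro exI[of _ "\<lambda>p. d * k p"]) (simp add: sum_distrib_left mult_ac)
qed

lemma complex_differentiable_at_sum:
  "(\<And>i. i \<in> I \<Longrightarrow> complex_differentiable_at (F i) \<Omega>) \<Longrightarrow>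
    complex_differentiable_at (\<lambda>\<Omega>. \<Sum>i\<in>I. F i \<Omega>) \<Omega>"
  by (induction I rule: infinite_finite_induct) (simp_all add: complex_differentiable_at_add)

lemma complex_differentiable_at_entry_idx:
  assumes "p \<in> idx"
  shows "complex_differentiable_at (\<lambda>\<Omega>. \<Omega> $ fst p $ snd p) \<Omega>"
proof -
  have "bounded_linear (\<lambda>H :: complex^2^2. H $ fst p $ snd p)"
    by (rule bounded_linear_compose[OF bounded_linear_vec_nth bounded_linear_vec_nth])
  then have "((\<lambda>\<Omega> :: complex^2^2. \<Omega> $ fst p $ snd p) has_derivative (\<lambda>H. H $ fst p $ snd p))
      (at \<Omega> within symmetric_matrices)"
    by (rule bounded_linear_imp_has_derivative)
  moreover have "(\<Sum>q\<in>idx. (if q = p then 1 else 0) * H $ fst q $ snd q) = H $ fst p $ snd p"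
    for H :: "complex^2^2"
    using assms by (simp add: if_distribR if_distrib sum.delta cong: if_cong)
  ultimately show ?thesis
    unfolding complex_differentiable_at_iff by (intro exI[of _ "\<lambda>q. if q = p then 1 else 0"]) simp
qed

lemma sym_open_symmetric_matrices: "sym_open symmetric_matrices"
  by (simp add: sym_open_def)

text \<open>The entry (2, 1) is not one of the coordinates, but on symmetric matrices it coincides
  with the entry (1, 2).\<close>

lemma complex_differentiable_at_entry:
  assumes "\<Omega> \<in> symmetric_matrices"
  shows "complex_differentiable_at (\<lambda>\<Omega>. \<Omega> $ i $ j) \<Omega>"
proof -
  have "complex_differentiable_at (\<lambda>\<Omega>. \<Omega> $ 2 $ 1) \<Omega>"
    by (rule complex_differentiable_at_cong[OF sym_open_symmetric_matrices assms _
          complex_differentiable_at_entry_idx[OF idx_mem(2)]])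
      (simp add: symmetric_matrices_iff)
  moreover have "i = 1 \<or> i = 2" "j = 1 \<or> j = 2" using exhaust_2 by blast+
  ultimately show ?thesis
    using complex_differentiable_at_entry_idx[OF idx_mem(1)]
      complex_differentiable_at_entry_idx[OF idx_mem(2)]
      complex_differentiable_at_entry_idx[OF idx_mem(3)] by (elim disjE) simp_all
qed

lemma pd_add:
  assumes "complex_differentiable_at F \<Omega>" "complex_differentiable_at G \<Omega>"
    "\<Omega> \<in> symmetric_matrices" "p \<in> idx"
  shows "pd (fst p) (snd p) (\<lambda>\<Omega>. F \<Omega> + G \<Omega>) \<Omega> = pd (fst p) (snd p) F \<Omega> + pd (fst p) (snd p) G \<Omega>"
  by (rule pd_eqI) (intro DERIV_add pd_direction assms)

lemma pd_mult:
  assumes "complex_differentiable_at F \<Omega>" "complex_differentiable_at G \<Omega>"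
    "\<Omega> \<in> symmetric_matrices" "p \<in> idx"
  shows "pd (fst p) (snd p) (\<lambda>\<Omega>. F \<Omega> * G \<Omega>) \<Omega> =
    pd (fst p) (snd p) F \<Omega> * G \<Omega> + pd (fst p) (snd p) G \<Omega> * F \<Omega>"
proof (rule pd_eqI)
  show "((\<lambda>t. F (\<Omega> + sym_direction p t) * G (\<Omega> + sym_direction p t)) has_field_derivative
      pd (fst p) (snd p) F \<Omega> * G \<Omega> + pd (fst p) (snd p) G \<Omega> * F \<Omega>) (at 0)"
    using DERIV_mult[OF pd_direction[OF assms(1,3,4)] pd_direction[OF assms(2,3,4)]] by simp
qed

lemma pd_const [simp]: "pd a b (\<lambda>_. c) = (\<lambda>_. 0)"
  by (simp add: pd_eq fun_eq_iff)

lemma times_differentiable_on_const: "times_differentiable_on k (\<lambda>_. c) V"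
  by (induction k arbitrary: c) (auto intro!: times_differentiable_on_SucI)

lemma times_differentiable_on_add:
  assumes V: "sym_open V"
  shows "times_differentiable_on k F V \<Longrightarrow> times_differentiable_on k G V \<Longrightarrow>
    times_differentiable_on k (\<lambda>\<Omega>. F \<Omega> + G \<Omega>) V"
proof (induction k arbitrary: F G)
  case (Suc k)
  note dF = times_differentiable_on_SucD[OF Suc.prems(1)]
    and dG = times_differentiable_on_SucD[OF Suc.prems(2)]
  show ?case
  proof (rule times_differentiable_on_SucI)
    show "complex_differentiable_at (\<lambda>\<Omega>. F \<Omega> + G \<Omega>) \<Omega>" if "\<Omega> \<in> V" for \<Omega>
      using dF(1) dG(1) that by (intro complex_differentiable_at_add)
    show "times_differentiable_on k (pd (fst p) (snd p) (\<lambda>\<Omega>. F \<Omega> + G \<Omega>)) V" if p: "p \<in> idx" for p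
    proof (rule times_differentiable_on_cong[OF V Suc.IH[OF dF(2)[OF p] dG(2)[OF p]]])
      show "pd (fst p) (snd p) F \<Omega> + pd (fst p) (snd p) G \<Omega> = pd (fst p) (snd p) (\<lambda>\<Omega>. F \<Omega> + G \<Omega>) \<Omega>"
        if "\<Omega> \<in> V" for \<Omega>
        using pd_add[OF dF(1)[OF that] dG(1)[OF that] _ p] sym_open_subset[OF V] that by auto
    qed
  qed
qed simp

lemma times_differentiable_on_mult:
  assumes V: "sym_open V"
  shows "times_differentiable_on k F V \<Longrightarrow> times_differentiable_on k G V \<Longrightarrow>
    times_differentiable_on k (\<lambda>\<Omega>. F \<Omega> * G \<Omega>) V"
proof (induction k arbitrary: F G)
  case (Suc k)
  note dF = times_differentiable_on_SucD[OF Suc.prems(1)]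
    and dG = times_differentiable_on_SucD[OF Suc.prems(2)]
  note F = times_differentiable_on_Suc_imp[OF Suc.prems(1)]
    and G = times_differentiable_on_Suc_imp[OF Suc.prems(2)]
  show ?case
  proof (rule times_differentiable_on_SucI)
    show "complex_differentiable_at (\<lambda>\<Omega>. F \<Omega> * G \<Omega>) \<Omega>" if "\<Omega> \<in> V" for \<Omega>
      using dF(1) dG(1) that by (intro complex_differentiable_at_mult)
    show "times_differentiable_on k (pd (fst p) (snd p) (\<lambda>\<Omega>. F \<Omega> * G \<Omega>)) V" if p: "p \<in> idx" for p
    proof (rule times_differentiable_on_cong[OF V
          times_differentiable_on_add[OF V Suc.IH[OF dF(2)[OF p] G] Suc.IH[OF dG(2)[OF p] F]]])
      show "pd (fst p) (snd p) F \<Omega> * G \<Omega> + pd (fst p) (snd p) G \<Omega> * F \<Omega> =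
          pd (fst p) (snd p) (\<lambda>\<Omega>. F \<Omega> * G \<Omega>) \<Omega>" if "\<Omega> \<in> V" for \<Omega>
        using pd_mult[OF dF(1)[OF that] dG(1)[OF that] _ p] sym_open_subset[OF V] that by auto
    qed
  qed
qed simp

lemma times_differentiable_on_sum:
  assumes "sym_open V"
  shows "(\<And>i. i \<in> I \<Longrightarrow> times_differentiable_on k (F i) V) \<Longrightarrow>
    times_differentiable_on k (\<lambda>\<Omega>. \<Sum>i\<in>I. F i \<Omega>) V"
  by (induction I rule: infinite_finite_induct)
    (simp_all add: times_differentiable_on_const times_differentiable_on_add[OF assms])

text \<open>A class of differentiable functions closed under partial derivatives needs no count of
  orders. It is enough that the derivative agrees on \<open>V\<close> with a member of the
  class.\<close>

lemma times_differentiable_on_coinduct: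
  assumes V: "sym_open V"
    and P: "\<And>F \<Omega>. P F \<Longrightarrow> \<Omega> \<in> V \<Longrightarrow> complex_differentiable_at F \<Omega>"
    "\<And>F p. P F \<Longrightarrow> p \<in> idx \<Longrightarrow> \<exists>G. P G \<and> (\<forall>\<Omega>\<in>V. pd (fst p) (snd p) F \<Omega> = G \<Omega>)"
  shows "P F \<Longrightarrow> times_differentiable_on k F V"
proof (induction k arbitrary: F)
  case (Suc k)
  show ?case
  proof (rule times_differentiable_on_SucI)
    show "complex_differentiable_at F \<Omega>" if "\<Omega> \<in> V" for \<Omega> by (rule P(1)[OF Suc.prems that])
    show "times_differentiable_on k (pd (fst p) (snd p) F) V" if p: "p \<in> idx" for p
    proof -
      obtain G where G: "P G" "\<And>\<Omega>. \<Omega> \<in> V \<Longrightarrow> pd (fst p) (snd p) F \<Omega> = G \<Omega>"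
        using P(2)[OF Suc.prems p] by blast
      show ?thesis
        by (rule times_differentiable_on_cong[OF V Suc.IH[OF G(1)]]) (simp add: G(2))
    qed
  qed
qed simp

section \<open>The symplectic action\<close>

lemma matrix_distribs:
  fixes X Y Z :: "complex^2^2"
  shows "(X + Y) ** Z = X ** Z + Y ** Z" "X ** (Y + Z) = X ** Y + X ** Z"
    "(X - Y) ** Z = X ** Z - Y ** Z" "X ** (Y - Z) = X ** Y - X ** Z"
    "(- X) ** Z = - (X ** Z)" "X ** (- Z) = - (X ** Z)"
    "transpose (X + Y) = transpose X + transpose Y" "transpose (X - Y) = transpose X - transpose Y"
    "transpose (- X) = - transpose X"
  by (simp_all add: matrix_matrix_mult_def transpose_def vec_eq_iff sum.distrib sum_subtractf
      sum_negf algebra_simps)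

lemma matrix_inv_inverse:
  fixes X :: "complex^2^2"
  assumes "det X \<noteq> 0"
  shows "X ** matrix_inv X = mat 1" "matrix_inv X ** X = mat 1"
proof -
  have "\<exists>Y. X ** Y = mat 1 \<and> Y ** X = mat 1"
    using assms by (simp add: invertible_det_nz[symmetric] invertible_def)
  then have "X ** matrix_inv X = mat 1 \<and> matrix_inv X ** X = mat 1"
    unfolding matrix_inv_def by (rule someI_ex)
  then show "X ** matrix_inv X = mat 1" "matrix_inv X ** X = mat 1" by auto
qed

lemma matrix_inv_eqI:
  fixes X :: "complex^2^2"
  assumes "Y ** X = mat 1"
  shows "matrix_inv X = Y" "det X \<noteq> 0"
proof -
  have "det Y * det X = 1" using assms by (metis det_I det_mul)
  then show X: "det X \<noteq> 0" by auto
  have "matrix_inv X = (Y ** X) ** matrix_inv X" by (simp add: assms)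
  also have "\<dots> = Y" by (simp add: matrix_mul_assoc[symmetric] matrix_inv_inverse[OF X])
  finally show "matrix_inv X = Y" .
qed

section \<open>Automorphy factors and Moebius maps of symmetric matrices\<close>

definition automorphy :: "complex^2^2 \<Rightarrow> complex^2^2 \<Rightarrow> complex^2^2 \<Rightarrow> complex^2^2" where
  "automorphy C D \<Omega> = C ** \<Omega> + D"

definition automorphy_inv :: "complex^2^2 \<Rightarrow> complex^2^2 \<Rightarrow> complex^2^2 \<Rightarrow> complex^2^2" where
  "automorphy_inv C D \<Omega> = matrix_inv (automorphy C D \<Omega>)"

definition moebius ::
  "complex^2^2 \<Rightarrow> complex^2^2 \<Rightarrow> complex^2^2 \<Rightarrow> complex^2^2 \<Rightarrow> complex^2^2 \<Rightarrow> complex^2^2" where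
  "moebius A B C D \<Omega> = (A ** \<Omega> + B) ** automorphy_inv C D \<Omega>"

text \<open>The natural domain of the Moebius map: it is relatively open, and the map sends it
  bijectively onto the corresponding domain of the inverse map. All arguments about the image of the
  Siegel half plane take place inside that second domain.\<close>

definition regular :: "complex^2^2 \<Rightarrow> complex^2^2 \<Rightarrow> (complex^2^2) set" where
  "regular C D = {\<Omega> \<in> symmetric_matrices. det (automorphy C D \<Omega>) \<noteq> 0}"

lemma regularD:
  assumes "\<Omega> \<in> regular C D"
  shows "transpose \<Omega> = \<Omega>" "automorphy C D \<Omega> ** automorphy_inv C D \<Omega> = mat 1"
    "automorphy_inv C D \<Omega> ** automorphy C D \<Omega> = mat 1" "\<Omega> \<in> symmetric_matrices"
  using assms by (auto simp: regular_def symmetric_matrices_def automorphy_inv_def matrix_inv_inverse)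

locale symplectic =
  fixes A B C D :: "complex^2^2"
  assumes rel1: "transpose A ** D - transpose C ** B = mat 1"
    and rel2: "A ** transpose B = B ** transpose A"
    and rel3: "C ** transpose D = D ** transpose C"
    and rel4: "transpose A ** C = transpose C ** A"
    and rel5: "transpose B ** D = transpose D ** B"
    and regular_nonempty: "regular C D \<noteq> {}"
begin

lemma rel1': "transpose A ** D = mat 1 + transpose C ** B"
  using rel1 by (simp add: algebra_simps)

lemma rel1t: "transpose D ** A = mat 1 + transpose B ** C"
  using arg_cong[OF rel1', of transpose] by (simp add: matrix_transpose_mul matrix_distribs)

text \<open>The defining relations with a trailing factor, so that they also rewrite inside products
  associated to the right.\<close>

lemma rels_mult_right:
  fixes X :: "complex^2^2"
  shows "transpose A ** (D ** X) = X + transpose C ** (B ** X)"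
  "transpose D ** (A ** X) = X + transpose B ** (C ** X)"
  "transpose C ** (A ** X) = transpose A ** (C ** X)"
  "transpose D ** (B ** X) = transpose B ** (D ** X)"
  "C ** (transpose D ** X) = D ** (transpose C ** X)"
  "A ** (transpose B ** X) = B ** (transpose A ** X)"
  using rel1' rel1t rel2 rel3 rel4 rel5 by (simp_all add: matrix_mul_assoc matrix_distribs)

lemmas normalise = matrix_distribs matrix_transpose_mul matrix_mul_assoc[symmetric]
  rel1' rel1t rel2 rel3 rel4[symmetric] rel5[symmetric] rels_mult_right

text \<open>By the other relations, left multiplication by \<open>?X\<close> fixes \<open>C\<close>
  and \<open>D\<close>, hence also the factor \<open>automorphy C D \<Omega>\<close>. At a regular
  point this factor is invertible and can be cancelled.\<close>

lemma second_block: "D ** transpose A - C ** transpose B = mat 1"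
proof -
  let ?X = "D ** transpose A - C ** transpose B"
  obtain \<Omega> where \<Omega>: "\<Omega> \<in> regular C D" using regular_nonempty by blast
  have "D ** (transpose A ** C) = C ** (transpose D ** A)" by (simp only: rel4 rels_mult_right(5))
  then have "?X ** C = C"
    by (simp add: matrix_distribs matrix_mul_assoc[symmetric] rel1t)
  moreover have "C ** (transpose B ** D) = D ** (transpose C ** B)" by (simp only: rel5 rels_mult_right(5))
  then have "?X ** D = D"
    by (simp add: matrix_distribs matrix_mul_assoc[symmetric] rel1')
  ultimately have "?X ** automorphy C D \<Omega> = automorphy C D \<Omega>"
    by (simp add: automorphy_def matrix_distribs(2) matrix_mul_assoc)
  then have "?X ** (automorphy C D \<Omega> ** automorphy_inv C D \<Omega>) =
      automorphy C D \<Omega> ** automorphy_inv C D \<Omega>"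
    by (simp add: matrix_mul_assoc)
  then show ?thesis by (simp add: regularD[OF \<Omega>])
qed

context
  fixes \<Omega> assumes \<Omega>: "\<Omega> \<in> regular C D"
begin

lemma transpose_automorphy: "transpose (automorphy C D \<Omega>) = \<Omega> ** transpose C + transpose D"
  by (simp add: automorphy_def normalise regularD[OF \<Omega>])

lemma transpose_inverse:
  "transpose (automorphy_inv C D \<Omega>) ** transpose (automorphy C D \<Omega>) = mat 1"
  "transpose (automorphy C D \<Omega>) ** transpose (automorphy_inv C D \<Omega>) = mat 1"
  by (simp_all add: matrix_transpose_mul[symmetric] regularD[OF \<Omega>])

lemma transpose_automorphy_numerator:
  "transpose (automorphy C D \<Omega>) ** (A ** \<Omega> + B) = transpose (A ** \<Omega> + B) ** automorphy C D \<Omega>"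
  unfolding transpose_automorphy automorphy_def
  by (simp add: normalise regularD[OF \<Omega>] ac_simps)

text \<open>With M the factor, N its inverse and P the numerator, P N is the congruence transform by
  N of the matrix \<open>transpose M ** P\<close>, which is symmetric by the preceding
  lemma.\<close>

lemma transpose_moebius: "transpose (moebius A B C D \<Omega>) = moebius A B C D \<Omega>"
proof -
  let ?M = "automorphy C D \<Omega>" and ?N = "automorphy_inv C D \<Omega>" and ?P = "A ** \<Omega> + B"
  have "moebius A B C D \<Omega> = (transpose ?N ** transpose ?M) ** (?P ** ?N)"
    by (simp add: moebius_def transpose_inverse)
  also have "\<dots> = transpose ?N ** (transpose ?M ** ?P) ** ?N" by (simp add: matrix_mul_assoc)
  also have "\<dots> = transpose ?N ** transpose ?P ** (?M ** ?N)"
    unfolding transpose_automorphy_numerator by (simp add: matrix_mul_assoc)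
  also have "\<dots> = transpose (?P ** ?N)" by (simp add: regularD[OF \<Omega>] matrix_transpose_mul)
  finally show ?thesis by (simp add: moebius_def)
qed

lemma moebius_symmetric: "moebius A B C D \<Omega> \<in> symmetric_matrices"
  using transpose_moebius by (simp add: symmetric_matrices_def)

text \<open>Multiplied by the transposed factor, the left-hand side becomes an expression without
  inverses that the symplectic relations reduce to 1. The formula gives the derivative of the
  Moebius map its symmetric shape and, transposed, the automorphy factor of the inverse map.\<close>

lemma moebius_cofactor: "A - moebius A B C D \<Omega> ** C = transpose (automorphy_inv C D \<Omega>)"
proof -
  let ?M = "automorphy C D \<Omega>" and ?N = "automorphy_inv C D \<Omega>" and ?P = "A ** \<Omega> + B"
  have "transpose ?M ** moebius A B C D \<Omega> = transpose ?P"
    using transpose_automorphy_numerator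
    by (simp add: moebius_def matrix_mul_assoc) (simp add: matrix_mul_assoc[symmetric] regularD[OF \<Omega>])
  then have "transpose ?M ** (A - moebius A B C D \<Omega> ** C) = transpose ?M ** A - transpose ?P ** C"
    by (simp add: matrix_distribs(4) matrix_mul_assoc)
  also have "\<dots> = mat 1"
    unfolding transpose_automorphy by (simp add: normalise regularD[OF \<Omega>])
  finally have "transpose ?N ** (transpose ?M ** (A - moebius A B C D \<Omega> ** C)) = transpose ?N"
    by simp
  then show ?thesis by (simp add: matrix_mul_assoc transpose_inverse)
qed

text \<open>This is the cocycle rule for a transformation followed by its inverse, whose blocks are
  \<open>transpose D\<close>, \<open>- transpose B\<close>, \<open>- transpose C\<close> and
  \<open>transpose A\<close>.\<close>

lemma automorphy_inverse_moebius:
  "automorphy (- transpose C) (transpose A) (moebius A B C D \<Omega>) = automorphy_inv C D \<Omega>"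
  using arg_cong[OF moebius_cofactor, of transpose]
  by (simp add: automorphy_def matrix_distribs matrix_transpose_mul transpose_moebius)

lemma moebius_regular: "moebius A B C D \<Omega> \<in> regular (- transpose C) (transpose A)"
proof -
  have "det (automorphy_inv C D \<Omega>) \<noteq> 0"
    using regularD(2)[OF \<Omega>] by (rule matrix_inv_eqI(2))
  then show ?thesis using moebius_symmetric by (simp add: regular_def automorphy_inverse_moebius)
qed

lemma moebius_inverse:
  "moebius (transpose D) (- transpose B) (- transpose C) (transpose A) (moebius A B C D \<Omega>) = \<Omega>"
proof -
  let ?M = "automorphy C D \<Omega>"
  have "automorphy_inv (- transpose C) (transpose A) (moebius A B C D \<Omega>) = ?M"
    unfolding automorphy_inv_def[of "- transpose C"] automorphy_inverse_moebius
    by (rule matrix_inv_eqI) (rule regularD[OF \<Omega>])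
  then have "moebius (transpose D) (- transpose B) (- transpose C) (transpose A) (moebius A B C D \<Omega>)
      = transpose D ** (moebius A B C D \<Omega> ** ?M) - transpose B ** ?M"
    by (simp add: moebius_def[of "transpose D"] matrix_distribs matrix_mul_assoc)
  also have "moebius A B C D \<Omega> ** ?M = A ** \<Omega> + B"
    by (simp add: moebius_def matrix_mul_assoc[symmetric] regularD[OF \<Omega>])
  also have "transpose D ** (A ** \<Omega> + B) - transpose B ** ?M = \<Omega>"
    by (simp add: automorphy_def normalise)
  finally show ?thesis .
qed

text \<open>The relation \<open>rel3\<close> makes \<open>C ** transpose M\<close> symmetric for the
  factor M; the claim follows by cancelling M on one side and its transpose on the other.\<close>

lemma transpose_inv_times: "transpose (automorphy_inv C D \<Omega> ** C) = automorphy_inv C D \<Omega> ** C"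
proof -
  let ?M = "automorphy C D \<Omega>" and ?N = "automorphy_inv C D \<Omega>"
  have MC: "C ** transpose ?M = ?M ** transpose C"
    unfolding transpose_automorphy by (simp add: automorphy_def matrix_distribs matrix_mul_assoc rel3)
  have "?N ** C = ?N ** C ** (transpose ?M ** transpose ?N)" by (simp add: transpose_inverse)
  also have "\<dots> = ?N ** (C ** transpose ?M) ** transpose ?N" by (simp add: matrix_mul_assoc)
  also have "\<dots> = (?N ** ?M) ** transpose C ** transpose ?N" unfolding MC by (simp add: matrix_mul_assoc)
  also have "\<dots> = transpose C ** transpose ?N" by (simp add: regularD[OF \<Omega>])
  finally show ?thesis by (simp add: matrix_transpose_mul)
qed

end

text \<open>Passing to the inverse exchanges the relations between rows of blocks with those between
  columns; \<open>second_block\<close> supplies the one that replaces \<open>rel1\<close>.\<close>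

lemma inverse_symplectic:
  "symplectic (transpose D) (- transpose B) (- transpose C) (transpose A)"
proof
  show "transpose (transpose D) ** transpose A - transpose (- transpose C) ** (- transpose B) = mat 1"
    using second_block by (simp add: matrix_distribs)
  show "transpose D ** transpose (- transpose B) = - transpose B ** transpose (transpose D)"
    using rel5 by (simp add: matrix_distribs)
  show "- transpose C ** transpose (transpose A) = transpose A ** transpose (- transpose C)"
    using rel4 by (simp add: matrix_distribs)
  show "transpose (transpose D) ** (- transpose C) = transpose (- transpose C) ** transpose D"
    using rel3 by (simp add: matrix_distribs)
  show "transpose (- transpose B) ** transpose A = transpose (transpose A) ** (- transpose B)"
    using rel2 by (simp add: matrix_distribs)
  obtain \<Omega> where "\<Omega> \<in> regular C D" using regular_nonempty by blast
  then show "regular (- transpose C) (transpose A) \<noteq> {}" using moebius_regular by blast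
qed

lemma moebius_inverse':
  assumes "\<Omega> \<in> regular (- transpose C) (transpose A)"
  defines "\<Omega>' \<equiv> moebius (transpose D) (- transpose B) (- transpose C) (transpose A) \<Omega>"
  shows "moebius A B C D \<Omega>' = \<Omega>" "\<Omega>' \<in> regular C D"
  using symplectic.moebius_inverse[OF inverse_symplectic assms(1)]
    symplectic.moebius_regular[OF inverse_symplectic assms(1)]
  by (simp_all add: \<Omega>'_def matrix_distribs)

end

section \<open>Derivatives at 0 of matrix-valued curves\<close>

definition curve_deriv :: "(complex \<Rightarrow> complex^2^2) \<Rightarrow> complex^2^2 \<Rightarrow> bool" where
  "curve_deriv \<gamma> H \<longleftrightarrow> (\<forall>i j. ((\<lambda>t. \<gamma> t $ i $ j) has_field_derivative H $ i $ j) (at 0))"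

lemma curve_deriv_const: "curve_deriv (\<lambda>_. X) 0"
  by (simp add: curve_deriv_def)

lemma curve_deriv_add: "curve_deriv \<gamma> H \<Longrightarrow> curve_deriv \<delta> K \<Longrightarrow> curve_deriv (\<lambda>t. \<gamma> t + \<delta> t) (H + K)"
  by (simp add: curve_deriv_def DERIV_add)

lemma curve_deriv_mult:
  assumes "curve_deriv \<gamma> H" "curve_deriv \<delta> K"
  shows "curve_deriv (\<lambda>t. \<gamma> t ** \<delta> t) (H ** \<delta> 0 + \<gamma> 0 ** K)"
  unfolding curve_deriv_def
proof (intro allI)
  fix i j
  have "((\<lambda>t. \<Sum>k\<in>UNIV. \<gamma> t $ i $ k * \<delta> t $ k $ j) has_field_derivative
      (\<Sum>k\<in>UNIV. H $ i $ k * \<delta> 0 $ k $ j + K $ k $ j * \<gamma> 0 $ i $ k)) (at 0)"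
    using assms by (intro DERIV_sum DERIV_mult) (simp_all add: curve_deriv_def)
  then show "((\<lambda>t. (\<gamma> t ** \<delta> t) $ i $ j) has_field_derivative (H ** \<delta> 0 + \<gamma> 0 ** K) $ i $ j) (at 0)"
    by (simp add: matrix_matrix_mult_def sum.distrib mult.commute)
qed

lemma curve_deriv_unique: "curve_deriv \<gamma> H \<Longrightarrow> curve_deriv \<gamma> K \<Longrightarrow> H = K"
  unfolding curve_deriv_def vec_eq_iff by (blast intro: DERIV_unique)

lemma curve_deriv_cong:
  assumes "curve_deriv \<gamma> H" "eventually (\<lambda>t. \<gamma> t = \<delta> t) (nhds 0)"
  shows "curve_deriv \<delta> H"
  unfolding curve_deriv_def
proof (intro allI)
  fix i j
  have ev: "eventually (\<lambda>t. \<gamma> t $ i $ j = \<delta> t $ i $ j) (nhds 0)"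
    using assms(2) by eventually_elim simp
  have "((\<lambda>t. \<gamma> t $ i $ j) has_field_derivative H $ i $ j) (at 0)"
    using assms(1) by (simp add: curve_deriv_def)
  then show "((\<lambda>t. \<delta> t $ i $ j) has_field_derivative H $ i $ j) (at 0)"
    by (simp only: DERIV_cong_ev[OF refl ev refl])
qed

lemma curve_deriv_isCont: "curve_deriv \<gamma> H \<Longrightarrow> isCont \<gamma> 0"
  by (rule isCont_matrix) (auto simp: curve_deriv_def intro: DERIV_isCont)

lemma curve_deriv_direction: "curve_deriv (\<lambda>t. \<Omega> + sym_direction p t) (sym_direction p 1)"
  unfolding curve_deriv_def sym_direction_nth vector_add_component
proof (intro allI)
  fix i j
  show "((\<lambda>t. \<Omega> $ i $ j + (if (i, j) = p \<or> (i, j) = prod.swap p then t else 0)) has_field_derivative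
      (if (i, j) = p \<or> (i, j) = prod.swap p then 1 else 0)) (at 0)"
    by (cases "(i, j) = p \<or> (i, j) = prod.swap p")
      (simp_all only: if_True if_False, auto intro!: derivative_eq_intros)
qed

lemma curve_deriv_comp:
  fixes \<Phi> :: "complex^2^2 \<Rightarrow> complex^2^2"
  assumes "\<And>i j. complex_differentiable_at (\<lambda>\<Omega>. \<Phi> \<Omega> $ i $ j) (\<gamma> 0)"
    and "eventually (\<lambda>t. \<gamma> t \<in> symmetric_matrices) (nhds 0)" "curve_deriv \<gamma> H"
  obtains K where "curve_deriv (\<lambda>t. \<Phi> (\<gamma> t)) K"
proof
  show "curve_deriv (\<lambda>t. \<Phi> (\<gamma> t)) (\<chi> i j. total_derivative (\<lambda>\<Omega>. \<Phi> \<Omega> $ i $ j) (\<gamma> 0) H)"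
    using complex_differentiable_at_curve[OF assms(1) assms(2)] assms(3)
    by (simp add: curve_deriv_def)
qed

section \<open>Derivatives of the symplectic action\<close>

lemma matrix_entry_cases:
  assumes "P 1 1" "P 1 2" "P 2 1" "P 2 2"
  shows "P (i :: 2) (j :: 2)"
  using assms exhaust_2[of i] exhaust_2[of j] by metis

lemma matrix_inv_2:
  fixes X :: "complex^2^2"
  assumes "det X \<noteq> 0"
  shows "matrix_inv X $ 1 $ 1 = X $ 2 $ 2 / det X" "matrix_inv X $ 1 $ 2 = - X $ 1 $ 2 / det X"
    "matrix_inv X $ 2 $ 1 = - X $ 2 $ 1 / det X" "matrix_inv X $ 2 $ 2 = X $ 1 $ 1 / det X"
proof -
  define d where "d = det X"
  define Y :: "complex^2^2" where
    "Y = vector [vector [X $ 2 $ 2 / d, - X $ 1 $ 2 / d], vector [- X $ 2 $ 1 / d, X $ 1 $ 1 / d]]"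
  have d: "d \<noteq> 0" "X $ 1 $ 1 * X $ 2 $ 2 - X $ 1 $ 2 * X $ 2 $ 1 = d"
    using assms by (simp_all add: d_def det_2)
  have "Y ** X = mat 1"
    using d by (simp add: vec_eq_iff forall_2 sum_2 matrix_matrix_mult_def mat_def Y_def vector_2
        divide_simps) (simp add: algebra_simps)
  then have "matrix_inv X = Y" by (rule matrix_inv_eqI)
  then show "matrix_inv X $ 1 $ 1 = X $ 2 $ 2 / det X" "matrix_inv X $ 1 $ 2 = - X $ 1 $ 2 / det X"
    "matrix_inv X $ 2 $ 1 = - X $ 2 $ 1 / det X" "matrix_inv X $ 2 $ 2 = X $ 1 $ 1 / det X"
    by (simp_all add: Y_def vector_2 d_def)
qed

section \<open>Matrix-valued functions of a symmetric matrix\<close>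

definition matrix_differentiable_at :: "(complex^2^2 \<Rightarrow> complex^2^2) \<Rightarrow> complex^2^2 \<Rightarrow> bool" where
  "matrix_differentiable_at \<Phi> \<Omega> \<longleftrightarrow> (\<forall>i j. complex_differentiable_at (\<lambda>\<Omega>. \<Phi> \<Omega> $ i $ j) \<Omega>)"

lemma matrix_differentiable_at_const: "matrix_differentiable_at (\<lambda>_. X) \<Omega>"
  by (simp add: matrix_differentiable_at_def)

lemma matrix_differentiable_at_ident:
  "\<Omega> \<in> symmetric_matrices \<Longrightarrow> matrix_differentiable_at (\<lambda>\<Omega>. \<Omega>) \<Omega>"
  by (simp add: matrix_differentiable_at_def complex_differentiable_at_entry)

lemma matrix_differentiable_at_add:
  "matrix_differentiable_at \<Phi> \<Omega> \<Longrightarrow> matrix_differentiable_at \<Psi> \<Omega> \<Longrightarrow>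
    matrix_differentiable_at (\<lambda>\<Omega>. \<Phi> \<Omega> + \<Psi> \<Omega>) \<Omega>"
  by (simp add: matrix_differentiable_at_def complex_differentiable_at_add)

lemma matrix_differentiable_at_mult:
  assumes "matrix_differentiable_at \<Phi> \<Omega>" "matrix_differentiable_at \<Psi> \<Omega>"
  shows "matrix_differentiable_at (\<lambda>\<Omega>. \<Phi> \<Omega> ** \<Psi> \<Omega>) \<Omega>"
proof -
  have "complex_differentiable_at (\<lambda>\<Omega>. \<Sum>k\<in>UNIV. \<Phi> \<Omega> $ i $ k * \<Psi> \<Omega> $ k $ j) \<Omega>" for i j
    using assms unfolding matrix_differentiable_at_def
    by (intro complex_differentiable_at_sum complex_differentiable_at_mult) auto
  then show ?thesis by (simp add: matrix_differentiable_at_def matrix_matrix_mult_def)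
qed

lemma matrix_differentiable_at_automorphy:
  "\<Omega> \<in> symmetric_matrices \<Longrightarrow> matrix_differentiable_at (automorphy C D) \<Omega>"
  unfolding automorphy_def[abs_def]
  by (intro matrix_differentiable_at_add matrix_differentiable_at_mult matrix_differentiable_at_const
      matrix_differentiable_at_ident)

lemma sym_open_regular: "sym_open (regular C D)"
proof -
  have "continuous_on UNIV (\<lambda>\<Omega>. det (automorphy C D \<Omega>))"
    unfolding automorphy_def det_2 matrix_matrix_mult_def
    by (simp add: sum_2) (intro continuous_intros)
  then have "open {\<Omega>. det (automorphy C D \<Omega>) \<noteq> 0}"
    by (intro open_Collect_neq) (auto intro: continuous_intros)
  moreover have "regular C D = symmetric_matrices \<inter> {\<Omega>. det (automorphy C D \<Omega>) \<noteq> 0}"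
    by (auto simp: regular_def)
  ultimately show ?thesis unfolding sym_open_def openin_open by blast
qed

lemma complex_differentiable_at_det:
  assumes "matrix_differentiable_at \<Phi> \<Omega>"
  shows "complex_differentiable_at (\<lambda>\<Omega>. det (\<Phi> \<Omega>)) \<Omega>"
proof -
  have \<Phi>: "complex_differentiable_at (\<lambda>\<Omega>. \<Phi> \<Omega> $ i $ j) \<Omega>" for i j
    using assms by (simp add: matrix_differentiable_at_def)
  have "complex_differentiable_at (\<lambda>\<Omega>. \<Phi> \<Omega> $ 1 $ 1 * \<Phi> \<Omega> $ 2 $ 2
      + (- 1) * (\<Phi> \<Omega> $ 1 $ 2 * \<Phi> \<Omega> $ 2 $ 1)) \<Omega>"
    by (intro complex_differentiable_at_add complex_differentiable_at_mult \<Phi>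
        complex_differentiable_at_const)
  then show ?thesis by (simp add: det_2)
qed

text \<open>Each entry of the inverse is an entry of the factor, up to sign, divided by the
  determinant. This formula holds on the regular set only, which suffices because that set is
  relatively open.\<close>

lemma matrix_differentiable_at_automorphy_inv:
  assumes \<Omega>: "\<Omega> \<in> regular C D"
  shows "matrix_differentiable_at (automorphy_inv C D) \<Omega>"
proof -
  let ?M = "automorphy C D"
  have M: "complex_differentiable_at (\<lambda>\<Omega>. ?M \<Omega> $ i $ j) \<Omega>" for i j
    using matrix_differentiable_at_automorphy[OF regularD(4)[OF \<Omega>]]
    by (simp add: matrix_differentiable_at_def)
  have neg: "complex_differentiable_at (\<lambda>\<Omega>. - f \<Omega>) \<Omega>" if "complex_differentiable_at f \<Omega>" for f
    using complex_differentiable_at_mult[OF complex_differentiable_at_const[of "-1"] that] by simp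
  have "complex_differentiable_at (\<lambda>\<Omega>. det (?M \<Omega>)) \<Omega>"
    by (intro complex_differentiable_at_det matrix_differentiable_at_automorphy regularD(4)[OF \<Omega>])
  then have inv: "complex_differentiable_at (\<lambda>\<Omega>. inverse (det (?M \<Omega>))) \<Omega>"
    using \<Omega> by (intro complex_differentiable_at_comp[OF DERIV_inverse]) (simp_all add: regular_def)
  have dinv: "complex_differentiable_at (\<lambda>\<Omega>. automorphy_inv C D \<Omega> $ i $ j) \<Omega>"
    if "complex_differentiable_at f \<Omega>"
      "\<And>\<Omega>. det (?M \<Omega>) \<noteq> 0 \<Longrightarrow> automorphy_inv C D \<Omega> $ i $ j = f \<Omega> / det (?M \<Omega>)" for f i j
    by (rule complex_differentiable_at_cong[OF sym_open_regular \<Omega> _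
          complex_differentiable_at_mult[OF that(1) inv]])
      (simp add: that(2) regular_def divide_inverse)
  show ?thesis
    unfolding matrix_differentiable_at_def
  proof (intro allI, rule matrix_entry_cases)
    show "complex_differentiable_at (\<lambda>\<Omega>. automorphy_inv C D \<Omega> $ 1 $ 1) \<Omega>"
      by (rule dinv[OF M[of 2 2]]) (simp add: automorphy_inv_def matrix_inv_2)
    show "complex_differentiable_at (\<lambda>\<Omega>. automorphy_inv C D \<Omega> $ 1 $ 2) \<Omega>"
      by (rule dinv[OF neg[OF M[of 1 2]]]) (simp add: automorphy_inv_def matrix_inv_2)
    show "complex_differentiable_at (\<lambda>\<Omega>. automorphy_inv C D \<Omega> $ 2 $ 1) \<Omega>"
      by (rule dinv[OF neg[OF M[of 2 1]]]) (simp add: automorphy_inv_def matrix_inv_2)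
    show "complex_differentiable_at (\<lambda>\<Omega>. automorphy_inv C D \<Omega> $ 2 $ 2) \<Omega>"
      by (rule dinv[OF M[of 1 1]]) (simp add: automorphy_inv_def matrix_inv_2)
  qed
qed

lemma matrix_differentiable_at_moebius:
  assumes "\<Omega> \<in> regular C D"
  shows "matrix_differentiable_at (moebius A B C D) \<Omega>"
  unfolding moebius_def[abs_def]
  by (intro matrix_differentiable_at_mult matrix_differentiable_at_add matrix_differentiable_at_const
      matrix_differentiable_at_ident matrix_differentiable_at_automorphy_inv assms regularD(4)[OF assms])

lemma eventually_curve:
  assumes "sym_open V" "\<gamma> 0 \<in> V" "curve_deriv \<gamma> H"
    "eventually (\<lambda>t. \<gamma> t \<in> symmetric_matrices) (nhds 0)"
  shows "eventually (\<lambda>t. \<gamma> t \<in> V) (nhds 0)"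
  by (rule sym_open_eventually[OF assms(1,2) curve_deriv_isCont[OF assms(3)] assms(4)])

lemma curve_deriv_automorphy:
  "curve_deriv \<gamma> H \<Longrightarrow> curve_deriv (\<lambda>t. automorphy C D (\<gamma> t)) (C ** H)"
  using curve_deriv_add[OF curve_deriv_mult[OF curve_deriv_const] curve_deriv_const, of \<gamma> H C D]
  by (simp add: automorphy_def)

text \<open>Only the existence of the derivative comes from the entries. Its value is found by
  differentiating the identity that the factor times its inverse is 1.\<close>

lemma curve_deriv_automorphy_inv:
  assumes \<gamma>: "curve_deriv \<gamma> H" "\<gamma> 0 \<in> regular C D"
    and sym: "eventually (\<lambda>t. \<gamma> t \<in> symmetric_matrices) (nhds 0)"
  shows "curve_deriv (\<lambda>t. automorphy_inv C D (\<gamma> t))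
    (- (automorphy_inv C D (\<gamma> 0) ** C ** H ** automorphy_inv C D (\<gamma> 0)))"
proof -
  let ?M = "automorphy C D" and ?N = "automorphy_inv C D"
  obtain K where K: "curve_deriv (\<lambda>t. ?N (\<gamma> t)) K"
    using curve_deriv_comp[OF _ sym \<gamma>(1), of ?N] matrix_differentiable_at_automorphy_inv[OF \<gamma>(2)]
    unfolding matrix_differentiable_at_def by blast
  have "curve_deriv (\<lambda>t. ?M (\<gamma> t) ** ?N (\<gamma> t)) (C ** H ** ?N (\<gamma> 0) + ?M (\<gamma> 0) ** K)"
    by (rule curve_deriv_mult[OF curve_deriv_automorphy[OF \<gamma>(1)] K])
  moreover have "eventually (\<lambda>t. ?M (\<gamma> t) ** ?N (\<gamma> t) = mat 1) (nhds 0)"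
    using eventually_curve[OF sym_open_regular \<gamma>(2,1) sym] by eventually_elim (rule regularD)
  ultimately have "curve_deriv (\<lambda>_. mat 1) (C ** H ** ?N (\<gamma> 0) + ?M (\<gamma> 0) ** K)"
    by (rule curve_deriv_cong)
  from curve_deriv_unique[OF this curve_deriv_const]
  have "?M (\<gamma> 0) ** K = - (C ** H ** ?N (\<gamma> 0))"
    by (simp add: add_eq_0_iff)
  then have "?N (\<gamma> 0) ** (?M (\<gamma> 0) ** K) = ?N (\<gamma> 0) ** (- (C ** H ** ?N (\<gamma> 0)))" by simp
  then have "K = - (?N (\<gamma> 0) ** C ** H ** ?N (\<gamma> 0))"
    by (simp add: matrix_mul_assoc regularD[OF \<gamma>(2)] matrix_distribs)
  then show ?thesis using K by simp
qed

lemma (in symplectic) curve_deriv_moebius: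
  assumes \<gamma>: "curve_deriv \<gamma> H" "\<gamma> 0 \<in> regular C D"
    and sym: "eventually (\<lambda>t. \<gamma> t \<in> symmetric_matrices) (nhds 0)"
  shows "curve_deriv (\<lambda>t. moebius A B C D (\<gamma> t))
    (transpose (automorphy_inv C D (\<gamma> 0)) ** H ** automorphy_inv C D (\<gamma> 0))"
proof -
  let ?N = "automorphy_inv C D (\<gamma> 0)"
  have "curve_deriv (\<lambda>t. A ** \<gamma> t + B) (A ** H)"
    using curve_deriv_add[OF curve_deriv_mult[OF curve_deriv_const \<gamma>(1)] curve_deriv_const, of A B]
    by simp
  from curve_deriv_mult[OF this curve_deriv_automorphy_inv[OF assms]]
  have "curve_deriv (\<lambda>t. moebius A B C D (\<gamma> t))
      (A ** H ** ?N - moebius A B C D (\<gamma> 0) ** C ** H ** ?N)"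
    by (simp add: moebius_def matrix_distribs matrix_mul_assoc) (simp add: algebra_simps)
  also have "A ** H ** ?N - moebius A B C D (\<gamma> 0) ** C ** H ** ?N =
      (A - moebius A B C D (\<gamma> 0) ** C) ** H ** ?N"
    by (simp add: matrix_distribs)
  finally show ?thesis by (simp add: moebius_cofactor[OF \<gamma>(2)])
qed

section \<open>Change of variables by the Moebius map\<close>

lemma matrix_differentiable_at_has_derivative:
  assumes "matrix_differentiable_at \<Phi> \<Omega>"
  obtains k where "(\<Phi> has_derivative (\<lambda>H. \<chi> i j. \<Sum>p\<in>idx. k i j p * H $ fst p $ snd p))
    (at \<Omega> within symmetric_matrices)"
proof -
  from assms have "\<forall>i j. \<exists>k. ((\<lambda>\<Omega>. \<Phi> \<Omega> $ i $ j) has_derivative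
      (\<lambda>H. \<Sum>p\<in>idx. k p * H $ fst p $ snd p)) (at \<Omega> within symmetric_matrices)"
    unfolding matrix_differentiable_at_def complex_differentiable_at_iff .
  then obtain k where "\<forall>i j. ((\<lambda>\<Omega>. \<Phi> \<Omega> $ i $ j) has_derivative
      (\<lambda>H. \<Sum>p\<in>idx. k i j p * H $ fst p $ snd p)) (at \<Omega> within symmetric_matrices)"
    unfolding choice_iff by blast
  then have "(\<Phi> has_derivative (\<lambda>H. \<chi> i j. \<Sum>p\<in>idx. k i j p * H $ fst p $ snd p))
      (at \<Omega> within symmetric_matrices)"
    by (intro has_derivative_vecI) simp
  then show ?thesis by (rule that)
qed

lemma at_within_sym_open:
  assumes "sym_open V" "y \<in> V"
  shows "at y within V = at y within symmetric_matrices"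
proof -
  obtain T where T: "open T" "V = symmetric_matrices \<inter> T"
    using assms(1) unfolding sym_open_def openin_open by blast
  show ?thesis by (rule at_within_nhd[of y T]) (use T assms(2) in auto)
qed

lemma complex_differentiable_at_matrix_comp:
  assumes V: "sym_open V" "y \<in> V" "\<And>y. y \<in> V \<Longrightarrow> \<Psi> y \<in> symmetric_matrices"
    and \<Psi>: "matrix_differentiable_at \<Psi> y" and F: "complex_differentiable_at F (\<Psi> y)"
  shows "complex_differentiable_at (\<lambda>y. F (\<Psi> y)) y"
proof -
  obtain k where "(\<Psi> has_derivative (\<lambda>H. \<chi> i j. \<Sum>p\<in>idx. k i j p * H $ fst p $ snd p))
      (at y within symmetric_matrices)"
    using matrix_differentiable_at_has_derivative[OF \<Psi>] by blast
  then have k: "(\<Psi> has_derivative (\<lambda>H. \<chi> i j. \<Sum>p\<in>idx. k i j p * H $ fst p $ snd p))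
      (at y within V)"
    by (simp add: at_within_sym_open[OF V(1,2)])
  obtain l where "(F has_derivative (\<lambda>H. \<Sum>p\<in>idx. l p * H $ fst p $ snd p))
      (at (\<Psi> y) within symmetric_matrices)"
    using F unfolding complex_differentiable_at_iff by blast
  then have "(F has_derivative (\<lambda>H. \<Sum>p\<in>idx. l p * H $ fst p $ snd p)) (at (\<Psi> y) within \<Psi> ` V)"
    by (rule has_derivative_subset) (use V(3) in blast)
  from has_derivative_in_compose[OF k this]
  have "((\<lambda>y. F (\<Psi> y)) has_derivative
      (\<lambda>H. \<Sum>q\<in>idx. l q * (\<Sum>p\<in>idx. k (fst q) (snd q) p * H $ fst p $ snd p)))
      (at y within symmetric_matrices)"
    by (simp add: at_within_sym_open[OF V(1,2)])
  moreover have "(\<Sum>q\<in>idx. l q * (\<Sum>p\<in>idx. k (fst q) (snd q) p * H $ fst p $ snd p)) =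
      (\<Sum>p\<in>idx. (\<Sum>q\<in>idx. l q * k (fst q) (snd q) p) * H $ fst p $ snd p)" for H :: "complex^2^2"
    unfolding sum_distrib_left sum_distrib_right by (subst sum.swap) (simp add: mult.assoc)
  ultimately show ?thesis
    unfolding complex_differentiable_at_iff
    by (intro exI[of _ "\<lambda>p. \<Sum>q\<in>idx. l q * k (fst q) (snd q) p"]) simp
qed

lemma sym_open_vimage:
  assumes W: "sym_open W" and \<Psi>: "\<And>y. y \<in> W \<Longrightarrow> matrix_differentiable_at \<Psi> y"
    "\<And>y. y \<in> W \<Longrightarrow> \<Psi> y \<in> symmetric_matrices" and U: "sym_open U"
  shows "sym_open {y \<in> W. \<Psi> y \<in> U}"
proof -
  have "continuous_on W \<Psi>"
    unfolding continuous_on_eq_continuous_within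
  proof
    fix y assume y: "y \<in> W"
    obtain k where "(\<Psi> has_derivative (\<lambda>H. \<chi> i j. \<Sum>p\<in>idx. k i j p * H $ fst p $ snd p))
        (at y within symmetric_matrices)"
      using matrix_differentiable_at_has_derivative[OF \<Psi>(1)[OF y]] by blast
    then show "continuous (at y within W) \<Psi>"
      unfolding at_within_sym_open[OF W y] by (rule has_derivative_continuous)
  qed
  then have "openin (top_of_set W) (W \<inter> \<Psi> -` U)"
    using \<Psi>(2) U unfolding sym_open_def by (intro continuous_openin_preimage) auto
  from openin_trans[OF this W[unfolded sym_open_def]]
  have "sym_open (W \<inter> \<Psi> -` U)" unfolding sym_open_def .
  moreover have "W \<inter> \<Psi> -` U = {y \<in> W. \<Psi> y \<in> U}" by blast
  ultimately show ?thesis by simp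
qed

lemma times_differentiable_on_entry:
  assumes V: "sym_open V"
  shows "times_differentiable_on k (\<lambda>\<Omega>. \<Omega> $ i $ j) V"
proof (cases k)
  case (Suc k')
  have "times_differentiable_on (Suc k') (\<lambda>\<Omega>. \<Omega> $ i $ j) V"
  proof (rule times_differentiable_on_SucI)
    show "complex_differentiable_at (\<lambda>\<Omega>. \<Omega> $ i $ j) \<Omega>" if "\<Omega> \<in> V" for \<Omega>
      using sym_open_subset[OF V] that by (intro complex_differentiable_at_entry) auto
    show "times_differentiable_on k' (pd (fst p) (snd p) (\<lambda>\<Omega>. \<Omega> $ i $ j)) V" for p
    proof -
      have "pd (fst p) (snd p) (\<lambda>\<Omega>. \<Omega> $ i $ j) = (\<lambda>_. sym_direction p 1 $ i $ j)"
        by (intro ext pd_eqI) (use curve_deriv_direction in \<open>auto simp: curve_deriv_def\<close>)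
      then show ?thesis by (simp add: times_differentiable_on_const)
    qed
  qed
  then show ?thesis using Suc by simp
qed simp

lemma times_differentiable_on_matrix_mult:
  fixes \<Phi> \<Psi> :: "complex^2^2 \<Rightarrow> complex^2^2"
  assumes "sym_open V" "\<And>i j. times_differentiable_on k (\<lambda>\<Omega>. \<Phi> \<Omega> $ i $ j) V"
    "\<And>i j. times_differentiable_on k (\<lambda>\<Omega>. \<Psi> \<Omega> $ i $ j) V"
  shows "times_differentiable_on k (\<lambda>\<Omega>. (\<Phi> \<Omega> ** \<Psi> \<Omega>) $ i $ j) V"
proof -
  have "times_differentiable_on k (\<lambda>\<Omega>. \<Sum>l\<in>UNIV. \<Phi> \<Omega> $ i $ l * \<Psi> \<Omega> $ l $ j) V"
    by (intro times_differentiable_on_sum times_differentiable_on_mult assms)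
  then show ?thesis by (simp add: matrix_matrix_mult_def)
qed

lemma times_differentiable_on_automorphy:
  assumes V: "sym_open V"
  shows "times_differentiable_on k (\<lambda>\<Omega>. automorphy C D \<Omega> $ i $ j) V"
  unfolding automorphy_def vector_add_component
  by (intro times_differentiable_on_add[OF V] times_differentiable_on_matrix_mult[OF V]
      times_differentiable_on_const times_differentiable_on_entry[OF V])

context symplectic
begin

abbreviation "inverse_moebius \<equiv> moebius (transpose D) (- transpose B) (- transpose C) (transpose A)"

text \<open>Written as a preimage under the inverse map, the image is seen to be relatively open by
  continuity.\<close>

lemma moebius_image_eq:
  assumes "U \<subseteq> regular C D"
  shows "moebius A B C D ` U = {y \<in> regular (- transpose C) (transpose A). inverse_moebius y \<in> U}"
  (is "?L = ?R")
proof (intro equalityI subsetI)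
  fix y assume "y \<in> ?L"
  then show "y \<in> ?R" using assms moebius_regular moebius_inverse by auto
next
  fix y assume "y \<in> ?R"
  then show "y \<in> ?L" using moebius_inverse'(1)[of y] by force
qed

lemma sym_open_moebius_image:
  assumes "sym_open U" "U \<subseteq> regular C D"
  shows "sym_open (moebius A B C D ` U)"
  unfolding moebius_image_eq[OF assms(2)]
  by (intro sym_open_vimage sym_open_regular matrix_differentiable_at_moebius assms(1))
    (use moebius_inverse'(2) in \<open>auto simp: regular_def\<close>)

text \<open>The differential of the inverse map at the image of \<Omega> is polynomial when
  expressed in \<Omega>. So a partial derivative of the composition is again some function
  \<open>G p\<close> composed with the inverse map, where \<open>G p\<close> has one order of
  differentiability less than \<open>F\<close>, and the induction applies to it.\<close>

lemma times_differentiable_on_inverse_moebius: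
  assumes U: "sym_open U" "U \<subseteq> regular C D"
  shows "times_differentiable_on k F U \<Longrightarrow>
    times_differentiable_on k (\<lambda>y. F (inverse_moebius y)) (moebius A B C D ` U)"
proof (induction k arbitrary: F)
  case (Suc k)
  let ?\<psi> = inverse_moebius and ?V = "moebius A B C D ` U"
  note V = sym_open_moebius_image[OF U]
  have y: "y \<in> regular (- transpose C) (transpose A)" "?\<psi> y \<in> U" "?\<psi> y \<in> symmetric_matrices"
    if "y \<in> ?V" for y
  proof -
    from that show "y \<in> regular (- transpose C) (transpose A)" "?\<psi> y \<in> U"
      unfolding moebius_image_eq[OF U(2)] by auto
    then show "?\<psi> y \<in> symmetric_matrices" using sym_open_subset[OF U(1)] by auto
  qed
  note dF = times_differentiable_on_SucD[OF Suc.prems]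
  \<comment> \<open>The derivative of the inverse map in a coordinate direction:
    \<open>curve_deriv_moebius\<close> for the inverse transformation, whose inverse factor is
    \<open>automorphy C D \<Omega>\<close>.\<close>
  define Q where "Q = (\<lambda>p \<Omega>. transpose (automorphy C D \<Omega>) ** sym_direction p 1 ** automorphy C D \<Omega>)"
  define G where "G = (\<lambda>p \<Omega>. \<Sum>q\<in>idx. pd (fst q) (snd q) F \<Omega> * Q p \<Omega> $ fst q $ snd q)"
  have pd: "pd (fst p) (snd p) (\<lambda>y. F (?\<psi> y)) z = G p (?\<psi> z)" if z: "z \<in> ?V" and p: "p \<in> idx" for z p
  proof (rule pd_eqI)
    let ?\<gamma> = "\<lambda>t. z + sym_direction p t"
    have ev: "eventually (\<lambda>t. ?\<gamma> t \<in> ?V) (nhds 0)" by (rule eventually_direction[OF V z])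
    have sym: "eventually (\<lambda>t. ?\<gamma> t \<in> symmetric_matrices) (nhds 0)"
      by (rule eventually_mono[OF ev]) (use sym_open_subset[OF V] in blast)
    have ev': "eventually (\<lambda>t. ?\<psi> (?\<gamma> t) \<in> symmetric_matrices) (nhds 0)"
      by (rule eventually_mono[OF ev y(3)])
    have aut: "automorphy_inv (- transpose C) (transpose A) z = automorphy C D (?\<psi> z)"
      using symplectic.automorphy_inverse_moebius[OF inverse_symplectic y(1)[OF z]]
      by (simp add: matrix_distribs)
    have "curve_deriv (\<lambda>t. ?\<psi> (?\<gamma> t)) (Q p (?\<psi> z))"
      using symplectic.curve_deriv_moebius[OF inverse_symplectic curve_deriv_direction, of z p] y(1)[OF z] sym
      by (simp add: Q_def aut)
    then have "((\<lambda>t. F (?\<psi> (?\<gamma> t))) has_field_derivative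
        total_derivative F (?\<psi> (?\<gamma> 0)) (Q p (?\<psi> z))) (at 0)"
      using dF(1)[OF y(2)[OF z]] ev'
      by (intro complex_differentiable_at_curve[where \<gamma> = "\<lambda>t. ?\<psi> (?\<gamma> t)"])
        (simp_all add: curve_deriv_def)
    then show "((\<lambda>t. F (?\<psi> (?\<gamma> t))) has_field_derivative G p (?\<psi> z)) (at 0)"
      by (simp add: total_derivative_def G_def)
  qed
  have "times_differentiable_on k (\<lambda>\<Omega>. Q p \<Omega> $ i $ j) U" for p i j
  proof -
    have "times_differentiable_on k (\<lambda>\<Omega>. transpose (automorphy C D \<Omega>) $ i $ j) U" for i j
      using times_differentiable_on_automorphy[OF U(1)] by (simp add: transpose_def)
    then show ?thesis unfolding Q_def
      by (intro times_differentiable_on_matrix_mult[OF U(1)] times_differentiable_on_automorphy[OF U(1)]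
          times_differentiable_on_const)
  qed
  then have G: "times_differentiable_on k (G p) U" for p
    unfolding G_def
    by (intro times_differentiable_on_sum[OF U(1)] times_differentiable_on_mult[OF U(1)] dF(2))
  show ?case
  proof (rule times_differentiable_on_SucI)
    show "complex_differentiable_at (\<lambda>y. F (?\<psi> y)) z" if z: "z \<in> ?V" for z
      by (rule complex_differentiable_at_matrix_comp[OF V z y(3)
            matrix_differentiable_at_moebius[OF y(1)[OF z]] dF(1)[OF y(2)[OF z]]])
    show "times_differentiable_on k (pd (fst p) (snd p) (\<lambda>y. F (?\<psi> y))) ?V" if "p \<in> idx" for p
      by (rule times_differentiable_on_cong[OF V Suc.IH[OF G, of p]]) (simp add: pd that)
  qed
qed simp

end

section \<open>Bilinear forms and directions of rank one\<close>

definition bilinear_form :: "complex^2^2 \<Rightarrow> complex^2 \<Rightarrow> complex^2 \<Rightarrow> complex" where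
  "bilinear_form S u w = (\<Sum>i\<in>UNIV. \<Sum>j\<in>UNIV. u $ i * S $ i $ j * w $ j)"

definition outer :: "complex^2 \<Rightarrow> complex^2^2" where
  "outer \<eta> = (\<chi> i j. \<eta> $ i * \<eta> $ j)"

text \<open>A direction of rank one splits the quadratic expression into a product of two forms.
  This lets the derivative of a transformed edge weight factor in the same way as that of an
  original one.\<close>

lemma bilinear_form_outer:
  "bilinear_form (S ** outer \<eta> ** T) u w = bilinear_form S u \<eta> * bilinear_form T \<eta> w"
  by (simp add: bilinear_form_def outer_def matrix_matrix_mult_def sum_2 algebra_simps)

lemma vector_matrix_mult_outer:
  "u v* (S ** outer \<eta> ** T) = bilinear_form S u \<eta> *s (\<eta> v* T)"
  by (simp add: vec_eq_iff forall_2 bilinear_form_def outer_def matrix_matrix_mult_def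
      vector_matrix_mult_def sum_2 algebra_simps)

lemma transpose_mult_outer: "transpose N ** outer \<eta> ** N = outer (\<eta> v* N)"
  by (simp add: vec_eq_iff forall_2 outer_def transpose_def matrix_matrix_mult_def
      vector_matrix_mult_def sum_2 algebra_simps)

lemma transpose_eqD: "transpose S = S \<Longrightarrow> S $ 2 $ 1 = (S :: complex^2^2) $ 1 $ 2"
  by (auto simp: transpose_def vec_eq_iff)

lemma bilinear_form_commute:
  "transpose S = S \<Longrightarrow> bilinear_form S u w = bilinear_form S w u"
  by (drule transpose_eqD) (simp add: bilinear_form_def sum_2 algebra_simps)

lemma bilinear_form_scale:
  "bilinear_form S (k *s u) w = k * bilinear_form S u w"
  "bilinear_form S u (k *s w) = k * bilinear_form S u w"
  "bilinear_form (- S) u w = - bilinear_form S u w"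
  by (simp_all add: bilinear_form_def sum_2 algebra_simps)

lemma bilinear_form_has_field_derivative:
  fixes S :: "complex \<Rightarrow> complex^2^2" and u w :: "complex \<Rightarrow> complex^2"
  assumes "curve_deriv S S'"
    and "\<And>i. ((\<lambda>t. u t $ i) has_field_derivative u' $ i) (at 0)"
    and "\<And>i. ((\<lambda>t. w t $ i) has_field_derivative w' $ i) (at 0)"
  shows "((\<lambda>t. bilinear_form (S t) (u t) (w t)) has_field_derivative
    bilinear_form S' (u 0) (w 0) + bilinear_form (S 0) u' (w 0) + bilinear_form (S 0) (u 0) w') (at 0)"
proof -
  have "((\<lambda>t. bilinear_form (S t) (u t) (w t)) has_field_derivative
      (\<Sum>i\<in>UNIV. \<Sum>j\<in>UNIV. (u' $ i * S 0 $ i $ j + S' $ i $ j * u 0 $ i) * w 0 $ j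
        + w' $ j * (u 0 $ i * S 0 $ i $ j))) (at 0)"
    unfolding bilinear_form_def using assms
    by (intro DERIV_sum DERIV_mult) (auto simp: curve_deriv_def)
  then show ?thesis by (simp add: bilinear_form_def sum_2 algebra_simps)
qed

lemma vector_matrix_has_field_derivative:
  fixes N :: "complex \<Rightarrow> complex^2^2" and u :: "complex \<Rightarrow> complex^2"
  assumes "curve_deriv N N'" and "\<And>i. ((\<lambda>t. u t $ i) has_field_derivative u' $ i) (at 0)"
  shows "((\<lambda>t. (u t v* N t) $ j) has_field_derivative (u' v* N 0 + u 0 v* N') $ j) (at 0)"
proof -
  have "((\<lambda>t. \<Sum>i\<in>UNIV. N t $ i $ j * u t $ i) has_field_derivative
      (\<Sum>i\<in>UNIV. N' $ i $ j * u 0 $ i + u' $ i * N 0 $ i $ j)) (at 0)"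
    using assms by (intro DERIV_sum DERIV_mult) (auto simp: curve_deriv_def)
  then show ?thesis
    by (simp add: vector_matrix_mult_def sum_2 algebra_simps)
qed

text \<open>The symmetrised product is the direction in which log det M is differentiated in the
  transformation law of \<omega>; it accounts for the factor 1/2 there.\<close>

lemma trace_symmetrised:
  assumes "transpose S = S"
  shows "trace (S ** (\<chi> i j. 1 / 2 * (u $ i * w $ j + w $ i * u $ j))) = bilinear_form S u w"
  using transpose_eqD[OF assms]
  by (simp add: bilinear_form_def trace_def matrix_matrix_mult_def sum_2 field_simps)

text \<open>Jacobi's formula, verified from the entries of a matrix of size 2.\<close>

lemma det_has_field_derivative:
  fixes X :: "complex \<Rightarrow> complex^2^2"
  assumes X: "curve_deriv X K" and det: "det (X 0) \<noteq> 0"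
  shows "((\<lambda>t. det (X t)) has_field_derivative det (X 0) * trace (matrix_inv (X 0) ** K)) (at 0)"
proof -
  have d: "((\<lambda>t. X t $ i $ j) has_field_derivative K $ i $ j) (at 0)" for i j
    using X by (simp add: curve_deriv_def)
  have "((\<lambda>t. X t $ 1 $ 1 * X t $ 2 $ 2 - X t $ 1 $ 2 * X t $ 2 $ 1) has_field_derivative
      (K $ 1 $ 1 * X 0 $ 2 $ 2 + K $ 2 $ 2 * X 0 $ 1 $ 1) -
      (K $ 1 $ 2 * X 0 $ 2 $ 1 + K $ 2 $ 1 * X 0 $ 1 $ 2)) (at 0)"
    by (rule DERIV_diff[OF DERIV_mult[OF d[of 1 1] d[of 2 2]] DERIV_mult[OF d[of 1 2] d[of 2 1]]])
  then have "((\<lambda>t. det (X t)) has_field_derivative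
      (K $ 1 $ 1 * X 0 $ 2 $ 2 + K $ 2 $ 2 * X 0 $ 1 $ 1) -
      (K $ 1 $ 2 * X 0 $ 2 $ 1 + K $ 2 $ 1 * X 0 $ 1 $ 2)) (at 0)"
    by (simp add: det_2)
  moreover have "det (X 0) * trace (matrix_inv (X 0) ** K) =
      (K $ 1 $ 1 * X 0 $ 2 $ 2 + K $ 2 $ 2 * X 0 $ 1 $ 1) -
      (K $ 1 $ 2 * X 0 $ 2 $ 1 + K $ 2 $ 1 * X 0 $ 1 $ 2)"
    using det by (simp add: trace_def matrix_matrix_mult_def sum_2 matrix_inv_2 field_simps)
  ultimately show ?thesis by simp
qed

section \<open>The weight\<close>

locale log_automorphy = symplectic +
  fixes W :: "(complex^2^2) set" and l :: "complex^2^2 \<Rightarrow> complex"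
  assumes W: "sym_open W" "W \<subseteq> regular C D"
    and cont: "continuous_on W l"
    and exp_l: "\<And>\<Omega>. \<Omega> \<in> W \<Longrightarrow> exp (l \<Omega>) = det (automorphy C D \<Omega>)"
begin

text \<open>The branch \<open>l\<close> is only assumed continuous. Near \<Omega> it is compared
  with a function \<open>g\<close> built from the principal logarithm. Both have the same
  exponential, and by continuity each is within distance 1 of \<open>l \<Omega>\<close>; a
  difference below 2 leaves no room for a nonzero multiple of 2 pi i.\<close>

lemma complex_differentiable_at_log:
  assumes \<Omega>: "\<Omega> \<in> W"
  shows "complex_differentiable_at l \<Omega>"
proof -
  let ?d = "\<lambda>\<Omega>. det (automorphy C D \<Omega>)"
  have d: "?d \<Omega> \<noteq> 0" if "\<Omega> \<in> W" for \<Omega> using that W by (auto simp: regular_def)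
  have sym: "\<Omega> \<in> symmetric_matrices" using \<Omega> sym_open_subset[OF W(1)] by auto
  \<comment> \<open>Dividing by the determinant at \<Omega> places the argument of \<open>Ln\<close>
    near 1, away from the branch cut.\<close>
  define g where "g = (\<lambda>\<Omega>'. l \<Omega> + Ln (?d \<Omega>' * inverse (?d \<Omega>)))"
  have "complex_differentiable_at g \<Omega>"
    unfolding g_def
  proof (intro complex_differentiable_at_add complex_differentiable_at_const
      complex_differentiable_at_comp[where f = Ln])
    show "complex_differentiable_at (\<lambda>\<Omega>'. ?d \<Omega>' * inverse (?d \<Omega>)) \<Omega>"
      by (intro complex_differentiable_at_mult complex_differentiable_at_const
          complex_differentiable_at_det matrix_differentiable_at_automorphy sym)
    have "?d \<Omega> * inverse (?d \<Omega>) = 1" using d[OF \<Omega>] by simp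
    then show "(Ln has_field_derivative 1) (at (?d \<Omega> * inverse (?d \<Omega>)))"
      using has_field_derivative_Ln[of 1] by simp
  qed
  then obtain k where k: "(g has_derivative (\<lambda>H. \<Sum>p\<in>idx. k p * H $ fst p $ snd p))
      (at \<Omega> within symmetric_matrices)"
    unfolding complex_differentiable_at_iff by blast
  have g0: "g \<Omega> = l \<Omega>" using d[OF \<Omega>] by (simp add: g_def)
  have at: "at \<Omega> within symmetric_matrices = at \<Omega> within W"
    using at_within_sym_open[OF W(1) \<Omega>] by simp
  have "(g \<longlongrightarrow> l \<Omega>) (at \<Omega> within W)"
    using has_derivative_continuous[OF k] by (simp add: continuous_within g0 at)
  then have "eventually (\<lambda>\<Omega>'. dist (g \<Omega>') (l \<Omega>) < 1) (at \<Omega> within W)"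
    by (rule tendstoD) simp
  moreover have "(l \<longlongrightarrow> l \<Omega>) (at \<Omega> within W)"
    using cont \<Omega> by (simp add: continuous_on_def)
  then have "eventually (\<lambda>\<Omega>'. dist (l \<Omega>') (l \<Omega>) < 1) (at \<Omega> within W)"
    by (rule tendstoD) simp
  moreover have "eventually (\<lambda>\<Omega>'. \<Omega>' \<in> W) (at \<Omega> within W)"
    by (simp add: eventually_at_filter)
  ultimately have "eventually (\<lambda>\<Omega>'. g \<Omega>' = l \<Omega>') (at \<Omega> within W)"
  proof eventually_elim
    case (elim \<Omega>')
    have "dist (g \<Omega>') (l \<Omega>') < 2"
      using dist_triangle2[of "g \<Omega>'" "l \<Omega>'" "l \<Omega>"] elim by simp
    then have "\<bar>Im (g \<Omega>' - l \<Omega>')\<bar> < 2"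
      using abs_Im_le_cmod[of "g \<Omega>' - l \<Omega>'"] by (simp add: dist_norm)
    then have "\<bar>Im (g \<Omega>') - Im (l \<Omega>')\<bar> < 2 * pi" using pi_gt3 by simp
    moreover have "exp (g \<Omega>') = exp (l \<Omega>')"
      using d[OF \<Omega>] d[OF elim(3)] by (simp add: g_def exp_add exp_l[OF \<Omega>] exp_l[OF elim(3)])
    ultimately show ?case by (rule exp_complex_eqI)
  qed
  then have "(l has_derivative (\<lambda>H. \<Sum>p\<in>idx. k p * H $ fst p $ snd p))
      (at \<Omega> within symmetric_matrices)"
    using has_derivative_transform_eventually[OF k, of l] g0 sym by (simp add: at)
  then show ?thesis unfolding complex_differentiable_at_iff by blast
qed

text \<open>Once \<open>l\<close> is known to be differentiable, differentiating
  \<open>exp l = det M\<close> and comparing with Jacobi's formula determines its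
  derivative.\<close>

lemma log_has_field_derivative:
  assumes \<gamma>: "curve_deriv \<gamma> H" "\<gamma> 0 \<in> W"
    and sym: "eventually (\<lambda>t. \<gamma> t \<in> symmetric_matrices) (nhds 0)"
  shows "((\<lambda>t. l (\<gamma> t)) has_field_derivative trace (automorphy_inv C D (\<gamma> 0) ** C ** H)) (at 0)"
    "total_derivative l (\<gamma> 0) H = trace (automorphy_inv C D (\<gamma> 0) ** C ** H)"
proof -
  let ?d = "det (automorphy C D (\<gamma> 0))"
  have d0: "?d \<noteq> 0" using \<gamma>(2) W(2) by (auto simp: regular_def)
  have l: "((\<lambda>t. l (\<gamma> t)) has_field_derivative total_derivative l (\<gamma> 0) H) (at 0)"
    using complex_differentiable_at_log[OF \<gamma>(2)] sym \<gamma>(1)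
    by (intro complex_differentiable_at_curve[where \<gamma> = \<gamma>]) (auto simp: curve_deriv_def)
  have "((\<lambda>t. exp (l (\<gamma> t))) has_field_derivative exp (l (\<gamma> 0)) * total_derivative l (\<gamma> 0) H) (at 0)"
    by (rule DERIV_chain'[OF l DERIV_exp])
  moreover have ev: "eventually (\<lambda>t. exp (l (\<gamma> t)) = det (automorphy C D (\<gamma> t))) (nhds 0)"
    using eventually_curve[OF W(1) \<gamma>(2,1) sym] by eventually_elim (rule exp_l)
  ultimately have "((\<lambda>t. det (automorphy C D (\<gamma> t))) has_field_derivative
      ?d * total_derivative l (\<gamma> 0) H) (at 0)"
    using exp_l[OF \<gamma>(2)] by (simp only: DERIV_cong_ev[OF refl ev refl])
  from DERIV_unique[OF this det_has_field_derivative[OF curve_deriv_automorphy[OF \<gamma>(1)] d0]]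
  show *: "total_derivative l (\<gamma> 0) H = trace (automorphy_inv C D (\<gamma> 0) ** C ** H)"
    using d0 by (simp add: automorphy_inv_def matrix_mul_assoc)
  show "((\<lambda>t. l (\<gamma> t)) has_field_derivative trace (automorphy_inv C D (\<gamma> 0) ** C ** H)) (at 0)"
    using l unfolding * .
qed

text \<open>Closed under partial derivatives, so that its members have derivatives of all orders.\<close>

inductive weight_algebra :: "complex \<Rightarrow> (complex^2^2 \<Rightarrow> complex) \<Rightarrow> bool" for k where
  "weight_algebra k (\<lambda>_. a)"
| "weight_algebra k (\<lambda>\<Omega>. automorphy_inv C D \<Omega> $ i $ j)"
| "weight_algebra k (\<lambda>\<Omega>. exp (k * l \<Omega>))"
| "weight_algebra k f \<Longrightarrow> weight_algebra k g \<Longrightarrow> weight_algebra k (\<lambda>\<Omega>. f \<Omega> + g \<Omega>)"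
| "weight_algebra k f \<Longrightarrow> weight_algebra k g \<Longrightarrow> weight_algebra k (\<lambda>\<Omega>. f \<Omega> * g \<Omega>)"

lemma weight_algebra_sum:
  "(\<And>i. i \<in> I \<Longrightarrow> weight_algebra k (f i)) \<Longrightarrow> weight_algebra k (\<lambda>\<Omega>. \<Sum>i\<in>I. f i \<Omega>)"
  by (induction I rule: infinite_finite_induct) (simp_all add: weight_algebra.intros)

lemma weight_algebra_matrix_mult:
  fixes \<Phi> \<Psi> :: "complex^2^2 \<Rightarrow> complex^2^2"
  assumes "\<And>i j. weight_algebra k (\<lambda>\<Omega>. \<Phi> \<Omega> $ i $ j)" "\<And>i j. weight_algebra k (\<lambda>\<Omega>. \<Psi> \<Omega> $ i $ j)"
  shows "weight_algebra k (\<lambda>\<Omega>. (\<Phi> \<Omega> ** \<Psi> \<Omega>) $ i $ j)"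
proof -
  have "weight_algebra k (\<lambda>\<Omega>. \<Sum>l\<in>UNIV. \<Phi> \<Omega> $ i $ l * \<Psi> \<Omega> $ l $ j)"
    by (intro weight_algebra_sum weight_algebra.intros(5) assms)
  then show ?thesis by (simp add: matrix_matrix_mult_def)
qed

lemma complex_differentiable_at_weight_algebra:
  assumes "weight_algebra k f" "\<Omega> \<in> W"
  shows "complex_differentiable_at f \<Omega>"
  using assms(1)
proof induction
  case (2 i j)
  then show ?case
    using matrix_differentiable_at_automorphy_inv[of \<Omega> C D] W(2) assms(2)
    by (auto simp: matrix_differentiable_at_def)
next
  case 3
  show ?case
    by (intro complex_differentiable_at_comp[OF DERIV_exp] complex_differentiable_at_mult
        complex_differentiable_at_const complex_differentiable_at_log assms)
qed (simp_all add: complex_differentiable_at_add complex_differentiable_at_mult)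

lemma eventually_direction_symmetric:
  assumes "\<Omega> \<in> W"
  shows "eventually (\<lambda>t. \<Omega> + sym_direction p t \<in> symmetric_matrices) (nhds 0)"
  by (rule eventually_mono[OF eventually_direction[OF W(1) assms]])
    (use sym_open_subset[OF W(1)] in blast)

text \<open>The logarithm itself is not among the generators: the derivative of the exponential
  involves only the trace of N C H, with N the inverse factor and H a constant direction. The
  derivative of N is - N C H N, again built from entries of N.\<close>

lemma pd_weight_algebra:
  assumes "weight_algebra k f" "p \<in> idx"
  shows "\<exists>g. weight_algebra k g \<and> (\<forall>\<Omega>\<in>W. pd (fst p) (snd p) f \<Omega> = g \<Omega>)"
  using assms(1)
proof induction
  case (1 a)
  show ?case by (intro exI[of _ "\<lambda>_. 0"]) (simp add: weight_algebra.intros)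
next
  case (2 i j)
  let ?N = "automorphy_inv C D"
  have "pd (fst p) (snd p) (\<lambda>\<Omega>. ?N \<Omega> $ i $ j) \<Omega> =
      (- 1) * (?N \<Omega> ** C ** sym_direction p 1 ** ?N \<Omega>) $ i $ j" if "\<Omega> \<in> W" for \<Omega>
    using curve_deriv_automorphy_inv[OF curve_deriv_direction, of \<Omega> p C D] that W(2)
      eventually_direction_symmetric[OF that]
    by (intro pd_eqI) (auto simp: curve_deriv_def)
  moreover have "weight_algebra k (\<lambda>\<Omega>. (- 1) * (?N \<Omega> ** C ** sym_direction p 1 ** ?N \<Omega>) $ i $ j)"
    by (intro weight_algebra.intros weight_algebra_matrix_mult)
  ultimately show ?case by blast
next
  case 3
  let ?N = "automorphy_inv C D"
  have "pd (fst p) (snd p) (\<lambda>\<Omega>. exp (k * l \<Omega>)) \<Omega> =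
      exp (k * l \<Omega>) * (k * (\<Sum>i\<in>UNIV. (?N \<Omega> ** C ** sym_direction p 1) $ i $ i))" if "\<Omega> \<in> W" for \<Omega>
  proof (rule pd_eqI)
    have "((\<lambda>t. l (\<Omega> + sym_direction p t)) has_field_derivative
        trace (?N \<Omega> ** C ** sym_direction p 1)) (at 0)"
      using log_has_field_derivative(1)[OF curve_deriv_direction, of \<Omega> p] that
        eventually_direction_symmetric[OF that] by simp
    then have "((\<lambda>t. k * l (\<Omega> + sym_direction p t)) has_field_derivative
        k * trace (?N \<Omega> ** C ** sym_direction p 1)) (at 0)" by (rule DERIV_cmult)
    from DERIV_chain'[OF this DERIV_exp]
    show "((\<lambda>t. exp (k * l (\<Omega> + sym_direction p t))) has_field_derivative
      exp (k * l \<Omega>) * (k * (\<Sum>i\<in>UNIV. (?N \<Omega> ** C ** sym_direction p 1) $ i $ i))) (at 0)"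
      by (simp add: trace_def)
  qed
  moreover have "weight_algebra k
      (\<lambda>\<Omega>. exp (k * l \<Omega>) * (k * (\<Sum>i\<in>UNIV. (?N \<Omega> ** C ** sym_direction p 1) $ i $ i)))"
    by (intro weight_algebra.intros weight_algebra_sum weight_algebra_matrix_mult)
  ultimately show ?case by blast
next
  case (4 f g)
  then obtain f' g' where fg: "weight_algebra k f'" "\<forall>\<Omega>\<in>W. pd (fst p) (snd p) f \<Omega> = f' \<Omega>"
    "weight_algebra k g'" "\<forall>\<Omega>\<in>W. pd (fst p) (snd p) g \<Omega> = g' \<Omega>" by blast
  have "pd (fst p) (snd p) (\<lambda>\<Omega>. f \<Omega> + g \<Omega>) \<Omega> = f' \<Omega> + g' \<Omega>" if "\<Omega> \<in> W" for \<Omega>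
    using pd_add[OF complex_differentiable_at_weight_algebra[OF 4(1) that]
        complex_differentiable_at_weight_algebra[OF 4(2) that] _ assms(2)]
      sym_open_subset[OF W(1)] that fg by auto
  then show ?case using fg by (blast intro: weight_algebra.intros)
next
  case (5 f g)
  then obtain f' g' where fg: "weight_algebra k f'" "\<forall>\<Omega>\<in>W. pd (fst p) (snd p) f \<Omega> = f' \<Omega>"
    "weight_algebra k g'" "\<forall>\<Omega>\<in>W. pd (fst p) (snd p) g \<Omega> = g' \<Omega>" by blast
  have "pd (fst p) (snd p) (\<lambda>\<Omega>. f \<Omega> * g \<Omega>) \<Omega> = f' \<Omega> * g \<Omega> + g' \<Omega> * f \<Omega>" if "\<Omega> \<in> W" for \<Omega>
    using pd_mult[OF complex_differentiable_at_weight_algebra[OF 5(1) that]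
        complex_differentiable_at_weight_algebra[OF 5(2) that] _ assms(2)]
      sym_open_subset[OF W(1)] that fg by auto
  moreover have "weight_algebra k (\<lambda>\<Omega>. f' \<Omega> * g \<Omega> + g' \<Omega> * f \<Omega>)"
    by (intro weight_algebra.intros fg 5)
  ultimately show ?case by blast
qed

lemma times_differentiable_on_weight:
  assumes "sym_open U" "U \<subseteq> W"
  shows "times_differentiable_on n (\<lambda>\<Omega>. exp (k * l \<Omega>)) U"
  using assms
  by (intro times_differentiable_on_coinduct[of U "weight_algebra k"] weight_algebra.intros)
    (use complex_differentiable_at_weight_algebra pd_weight_algebra in blast)+

end

section \<open>Modular transformation of graph sums\<close>

lemma virasoro_graphs_0: "virasoro_graphs 0 = {{}}"
  by (auto simp: virasoro_graphs_def)

lemma graph_sum_0: "graph_sum 0 c e \<nu> J = J 0"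
  by (simp add: graph_sum_def virasoro_graphs_0 graph_value_def chains_def cycles_def)

context log_automorphy
begin

text \<open>The weighted function expressed in the transformed coordinates. On it the derivatives
  with respect to these coordinates become ordinary partial derivatives.\<close>

definition transported :: "complex \<Rightarrow> (complex^2^2 \<Rightarrow> complex) \<Rightarrow> complex^2^2 \<Rightarrow> complex" where
  "transported c F y = exp (c / 2 * l (inverse_moebius y)) * F (inverse_moebius y)"

lemma transported_moebius:
  "\<Omega> \<in> W \<Longrightarrow> transported c F (moebius A B C D \<Omega>) = exp (c / 2 * l \<Omega>) * F \<Omega>"
  using W(2) by (auto simp: transported_def moebius_inverse)

lemma times_differentiable_on_transported:
  assumes "sym_open U" "U \<subseteq> W" "times_differentiable_on n F U"
  shows "times_differentiable_on n (transported c F) (moebius A B C D ` U)"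
  unfolding transported_def[abs_def]
  using assms W(2) times_differentiable_on_weight[of U n "c / 2"]
  by (intro times_differentiable_on_inverse_moebius[of U n "\<lambda>\<Omega>. exp (c / 2 * l \<Omega>) * F \<Omega>"]
      times_differentiable_on_mult) auto

definition slope :: "complex^2^2 \<Rightarrow> complex^2^2" where
  "slope \<Omega> = automorphy_inv C D \<Omega> ** C"

text \<open>One rule serves loops and other edges alike: division by 6 turns the transformation law
  of \<open>s\<close> into the diagonal case of the law of \<omega>.\<close>

definition edge_transform where
  "edge_transform \<Omega> \<nu> e i j = e i j - bilinear_form (slope \<Omega>) (\<nu> i) (\<nu> j)"

definition nu_transform where
  "nu_transform \<Omega> \<nu> i = \<nu> i v* automorphy_inv C D \<Omega>"

lemma transpose_slope: "\<Omega> \<in> W \<Longrightarrow> transpose (slope \<Omega>) = slope \<Omega>"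
  unfolding slope_def using W(2) by (intro transpose_inv_times) auto

text \<open>The variables \<open>e\<close>, \<open>\<nu>\<close> and \<Omega> are generalised in the
  induction, because the identity of order n is needed along a whole curve before it can be
  differentiated at 0. The additional order of differentiability in the premise for
  \<open>Suc n\<close> makes this derivative exist.\<close>

lemma graph_sum_transform:
  assumes U: "sym_open U" "U \<subseteq> W"
  shows "\<Omega> \<in> U \<Longrightarrow> times_differentiable_on n F U \<Longrightarrow>
    (\<And>i j. i \<in> {1..n} \<Longrightarrow> j \<in> {1..n} \<Longrightarrow> e i j = e j i) \<Longrightarrow>
    graph_sum n c (edge_transform \<Omega> \<nu> e) (nu_transform \<Omega> \<nu>)
        (jet pd (transported c F) (moebius A B C D \<Omega>)) =
      exp (c / 2 * l \<Omega>) * graph_sum n c e \<nu> (jet pd F \<Omega>)"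
proof (induction n arbitrary: e \<nu> \<Omega>)
  case 0
  then show ?case
    using U(2) by (auto simp: graph_sum_0 jet_def transported_moebius)
next
  case (Suc n)
  note \<Omega> = Suc.prems(1) and F = Suc.prems(2) and sym = Suc.prems(3)
  define v where "v = Suc n"
  define \<eta> where "\<eta> = \<nu> v"
  define H where "H = outer \<eta>"
  define S where "S = slope \<Omega>"
  define N where "N = automorphy_inv C D \<Omega>"
  \<comment> \<open>Only the tangent at 0 matters, so curves affine in \<open>t\<close> can replace
    integral curves of the vector field.\<close>
  define \<gamma> where "\<gamma> = (\<lambda>t. \<Omega> + (\<chi> i j. t * H $ i $ j))"
  define et where "et = (\<lambda>t i j. e i j + t * (e i v * e v j))"
  define \<nu>t where "\<nu>t = (\<lambda>t i. \<nu> i + (t * e i v) *s \<eta>)"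
  define e\<gamma> where "e\<gamma> = edge_transform \<Omega> \<nu> e"
  define \<nu>\<gamma> where "\<nu>\<gamma> = nu_transform \<Omega> \<nu>"
  let ?G = "transported c F" and ?\<phi> = "moebius A B C D"
  have \<Omega>W: "\<Omega> \<in> W" "\<Omega> \<in> regular C D" using \<Omega> U(2) W(2) by auto
  have \<Omega>S: "\<Omega> \<in> symmetric_matrices" using \<Omega>W by (simp add: regular_def)
  have tS: "transpose S = S" unfolding S_def by (rule transpose_slope[OF \<Omega>W(1)])
  have \<gamma>0: "\<gamma> 0 = \<Omega>" by (simp add: \<gamma>_def vec_eq_iff)
  have et0: "et 0 = e" and \<nu>t0: "\<nu>t 0 = \<nu>" by (auto simp: et_def \<nu>t_def)
  have d\<gamma>: "curve_deriv \<gamma> H"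
    by (auto simp: curve_deriv_def \<gamma>_def intro!: derivative_eq_intros)
  have "\<gamma> t \<in> symmetric_matrices" for t
    unfolding \<gamma>_def
    by (rule symmetric_matrices_add[OF \<Omega>S]) (simp add: symmetric_matrices_iff H_def outer_def mult.commute)
  then have evS: "eventually (\<lambda>t. \<gamma> t \<in> symmetric_matrices) (nhds 0)"
    by (rule always_eventually[OF allI])
  have evU: "eventually (\<lambda>t. \<gamma> t \<in> U) (nhds 0)"
    by (rule eventually_curve[OF U(1) _ d\<gamma> evS]) (simp add: \<gamma>0 \<Omega>)
  have \<gamma>0r: "\<gamma> 0 \<in> regular C D" "\<gamma> 0 \<in> W" using \<gamma>0 \<Omega>W by simp_all
  have dN: "curve_deriv (\<lambda>t. automorphy_inv C D (\<gamma> t)) (- (S ** H ** N))"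
    using curve_deriv_automorphy_inv[OF d\<gamma> \<gamma>0r(1) evS] by (simp add: \<gamma>0 S_def N_def slope_def)
  have dS: "curve_deriv (\<lambda>t. slope (\<gamma> t)) (- (S ** H ** S))"
    using curve_deriv_mult[OF dN curve_deriv_const, of C]
    by (simp add: slope_def S_def N_def matrix_distribs matrix_mul_assoc)
  have d\<nu>: "((\<lambda>t. \<nu>t t i $ a) has_field_derivative (e i v *s \<eta>) $ a) (at 0)" for i a
    unfolding \<nu>t_def by (auto intro!: derivative_eq_intros)
  have de: "((\<lambda>t. et t i j) has_field_derivative e i v * e v j) (at 0)" for i j
    unfolding et_def by (auto intro!: derivative_eq_intros)
  have bil: "bilinear_form S \<eta> w = bilinear_form S w \<eta>" for w
    by (rule bilinear_form_commute[OF tS])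
  \<comment> \<open>The four terms of the derivative form a product: e_iv e_vj, minus the two mixed
    terms with one factor S each, plus (\<nu>_i S \<eta>) (\<eta> S \<nu>_j) from the derivative of
    S.\<close>
  have de\<gamma>: "((\<lambda>t. edge_transform (\<gamma> t) (\<nu>t t) (et t) i j) has_field_derivative e\<gamma> i v * e\<gamma> v j) (at 0)"
    if "i \<in> {1..n}" "j \<in> {1..n}" for i j
  proof -
    have "e j v = e v j" using that by (intro sym) (auto simp: v_def)
    moreover have "((\<lambda>t. edge_transform (\<gamma> t) (\<nu>t t) (et t) i j) has_field_derivative
        e i v * e v j - (bilinear_form (- (S ** H ** S)) (\<nu>t 0 i) (\<nu>t 0 j) +
          bilinear_form (slope (\<gamma> 0)) (e i v *s \<eta>) (\<nu>t 0 j) +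
          bilinear_form (slope (\<gamma> 0)) (\<nu>t 0 i) (e j v *s \<eta>))) (at 0)"
      unfolding edge_transform_def
      by (intro DERIV_diff de bilinear_form_has_field_derivative dS d\<nu>)
    ultimately show ?thesis
      by (simp add: \<nu>t0 \<gamma>0 S_def[symmetric] H_def bilinear_form_outer bilinear_form_scale e\<gamma>_def
          edge_transform_def \<eta>_def[symmetric] algebra_simps)
  qed
  have d\<nu>\<gamma>: "((\<lambda>t. nu_transform (\<gamma> t) (\<nu>t t) i $ a) has_field_derivative (e\<gamma> i v *s \<nu>\<gamma> v) $ a) (at 0)"
    for i a
  proof -
    have "((\<lambda>t. nu_transform (\<gamma> t) (\<nu>t t) i $ a) has_field_derivative
        ((e i v *s \<eta>) v* automorphy_inv C D (\<gamma> 0) + \<nu>t 0 i v* (- (S ** H ** N))) $ a) (at 0)"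
      unfolding nu_transform_def by (intro vector_matrix_has_field_derivative dN d\<nu>)
    moreover have "(e i v *s \<eta>) v* N + \<nu> i v* (- (S ** H ** N)) = e\<gamma> i v *s \<nu>\<gamma> v"
    proof -
      have "\<nu> i v* (- (S ** H ** N)) = - (bilinear_form S (\<nu> i) \<eta> *s (\<eta> v* N))"
        using vector_matrix_mult_outer[of "\<nu> i" S \<eta> N]
        by (simp add: H_def vec_eq_iff vector_matrix_mult_def sum_negf)
      moreover have "(e i v *s \<eta>) v* N = e i v *s (\<eta> v* N)"
        by (simp add: vec_eq_iff vector_matrix_mult_def sum_distrib_left mult_ac)
      ultimately show ?thesis
        by (simp add: e\<gamma>_def \<nu>\<gamma>_def edge_transform_def nu_transform_def \<eta>_def[symmetric]
            S_def[symmetric] N_def[symmetric] vec_eq_iff algebra_simps)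
    qed
    ultimately show ?thesis by (simp only: \<gamma>0 \<nu>t0 N_def[symmetric])
  qed
  have V: "sym_open (?\<phi> ` U)" using U W(2) by (intro sym_open_moebius_image) auto
  have evV: "eventually (\<lambda>t. ?\<phi> (\<gamma> t) \<in> symmetric_matrices) (nhds 0)"
    by (rule eventually_mono[OF evU]) (use sym_open_subset[OF V] in blast)
  have G: "times_differentiable_on (Suc n) ?G (?\<phi> ` U)"
    by (rule times_differentiable_on_transported[OF U F])
  \<comment> \<open>The image curve again has a tangent of rank one, now built from the transformed
    differential at \<open>v\<close>.\<close>
  have "curve_deriv (\<lambda>t. ?\<phi> (\<gamma> t)) (outer (\<nu>\<gamma> v))"
    using curve_deriv_moebius[OF d\<gamma> \<gamma>0r(1) evS]
    by (simp add: \<gamma>0 H_def transpose_mult_outer \<nu>\<gamma>_def nu_transform_def \<eta>_def)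
  then have dJG: "((\<lambda>t. jet pd ?G (?\<phi> (\<gamma> t)) m) has_field_derivative
      (\<Sum>a\<in>idx. tensor (\<nu>\<gamma> v) (\<nu>\<gamma> v) a * jet pd ?G (?\<phi> (\<gamma> 0)) (m + Poly_Mapping.single a 1))) (at 0)"
    if "param_degree m \<le> n" for m
    using that \<Omega> evV
    by (intro jet_has_field_derivative[OF V _ G, of "\<lambda>t. ?\<phi> (\<gamma> t)"])
      (simp_all add: \<gamma>0 curve_deriv_def tensor_def outer_def)
  have dJF: "((\<lambda>t. jet pd F (\<gamma> t) m) has_field_derivative
      (\<Sum>a\<in>idx. tensor \<eta> \<eta> a * jet pd F (\<gamma> 0) (m + Poly_Mapping.single a 1))) (at 0)"
    if "param_degree m \<le> n" for m
    using that \<Omega> evS d\<gamma>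
    by (intro jet_has_field_derivative[OF U(1) _ F, of \<gamma>])
      (simp_all add: \<gamma>0 curve_deriv_def tensor_def outer_def H_def)
  have left: "((\<lambda>t. graph_sum n c (edge_transform (\<gamma> t) (\<nu>t t) (et t)) (nu_transform (\<gamma> t) (\<nu>t t))
        (jet pd ?G (?\<phi> (\<gamma> t)))) has_field_derivative
      graph_sum_deriv n c e\<gamma> \<nu>\<gamma> (jet pd ?G (?\<phi> \<Omega>)) (\<lambda>i j. e\<gamma> i v * e\<gamma> v j) (\<lambda>i. e\<gamma> i v *s \<nu>\<gamma> v)
        (\<lambda>m. \<Sum>a\<in>idx. tensor (\<nu>\<gamma> v) (\<nu>\<gamma> v) a * jet pd ?G (?\<phi> \<Omega>) (m + Poly_Mapping.single a 1))) (at 0)"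
    using graph_sum_has_field_derivative[of n "\<lambda>t. edge_transform (\<gamma> t) (\<nu>t t) (et t)", OF de\<gamma> d\<nu>\<gamma> dJG]
    by (simp only: \<gamma>0 et0 \<nu>t0 e\<gamma>_def[symmetric] \<nu>\<gamma>_def[symmetric])
  have right: "((\<lambda>t. graph_sum n c (et t) (\<nu>t t) (jet pd F (\<gamma> t))) has_field_derivative
      graph_sum_deriv n c e \<nu> (jet pd F \<Omega>) (\<lambda>i j. e i v * e v j) (\<lambda>i. e i v *s \<eta>)
        (\<lambda>m. \<Sum>a\<in>idx. tensor \<eta> \<eta> a * jet pd F \<Omega> (m + Poly_Mapping.single a 1))) (at 0)"
    using graph_sum_has_field_derivative[of n et, OF de d\<nu> dJF]
    by (simp only: \<gamma>0 et0 \<nu>t0)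
  let ?d = "graph_sum_deriv n c e \<nu> (jet pd F \<Omega>) (\<lambda>i j. e i v * e v j) (\<lambda>i. e i v *s \<eta>)
        (\<lambda>m. \<Sum>a\<in>idx. tensor \<eta> \<eta> a * jet pd F \<Omega> (m + Poly_Mapping.single a 1))"
  have "trace (S ** H) = bilinear_form S \<eta> \<eta>"
    by (simp add: H_def outer_def bilinear_form_def trace_def matrix_matrix_mult_def sum_2 algebra_simps)
  then have "((\<lambda>t. l (\<gamma> t)) has_field_derivative bilinear_form S \<eta> \<eta>) (at 0)"
    using log_has_field_derivative(1)[OF d\<gamma> \<gamma>0r(2) evS] by (simp add: \<gamma>0 S_def slope_def)
  from DERIV_mult[OF DERIV_chain'[OF DERIV_cmult[OF this] DERIV_exp] right, of "c / 2"]
  have right': "((\<lambda>t. exp (c / 2 * l (\<gamma> t)) * graph_sum n c (et t) (\<nu>t t) (jet pd F (\<gamma> t)))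
      has_field_derivative exp (c / 2 * l \<Omega>) * (c / 2 * bilinear_form S \<eta> \<eta>) *
        graph_sum n c e \<nu> (jet pd F \<Omega>) + ?d * exp (c / 2 * l \<Omega>)) (at 0)"
    by (simp only: \<gamma>0 et0 \<nu>t0)
  have F': "times_differentiable_on n F U" by (rule times_differentiable_on_Suc_imp[OF F])
  \<comment> \<open>The perturbed edge weights must remain symmetric, as the induction hypothesis is
    applied to them for small \<open>t\<close>.\<close>
  have "et t i j = et t j i" if "i \<in> {1..n}" "j \<in> {1..n}" for t i j
  proof -
    have "e i j = e j i" "e i v = e v i" "e j v = e v j"
      using that by (auto intro!: sym simp: v_def)
    then show ?thesis by (simp add: et_def)
  qed
  then have IH: "graph_sum n c (edge_transform (\<gamma> t) (\<nu>t t) (et t)) (nu_transform (\<gamma> t) (\<nu>t t))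
      (jet pd ?G (?\<phi> (\<gamma> t))) = exp (c / 2 * l (\<gamma> t)) * graph_sum n c (et t) (\<nu>t t) (jet pd F (\<gamma> t))"
    if "\<gamma> t \<in> U" for t
    using that F' by (intro Suc.IH) auto
  have "eventually (\<lambda>t. graph_sum n c (edge_transform (\<gamma> t) (\<nu>t t) (et t)) (nu_transform (\<gamma> t) (\<nu>t t))
      (jet pd ?G (?\<phi> (\<gamma> t))) = exp (c / 2 * l (\<gamma> t)) * graph_sum n c (et t) (\<nu>t t) (jet pd F (\<gamma> t)))
      (nhds 0)"
    using evU by (rule eventually_mono) (rule IH)
  with left have "((\<lambda>t. exp (c / 2 * l (\<gamma> t)) * graph_sum n c (et t) (\<nu>t t) (jet pd F (\<gamma> t)))
      has_field_derivative
      graph_sum_deriv n c e\<gamma> \<nu>\<gamma> (jet pd ?G (?\<phi> \<Omega>)) (\<lambda>i j. e\<gamma> i v * e\<gamma> v j) (\<lambda>i. e\<gamma> i v *s \<nu>\<gamma> v)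
        (\<lambda>m. \<Sum>a\<in>idx. tensor (\<nu>\<gamma> v) (\<nu>\<gamma> v) a * jet pd ?G (?\<phi> \<Omega>) (m + Poly_Mapping.single a 1))) (at 0)"
    by (simp only: DERIV_cong_ev[OF refl _ refl])
  \<comment> \<open>Both sides of the identity of order n have now been differentiated along the
    same curve. The left derivative is the second term of \<open>graph_sum_Suc\<close> for the
    transformed data.\<close>
  note deriv = DERIV_unique[OF this right']
  have e\<gamma>sym: "e\<gamma> i v = e\<gamma> v i" if "i \<in> {1..n}" for i
    using that sym[of i v] bilinear_form_commute[OF tS] by (simp add: e\<gamma>_def edge_transform_def S_def v_def)
  have esym: "e i v = e v i" if "i \<in> {1..n}" for i
    using that by (intro sym) (auto simp: v_def)
  have "graph_sum (Suc n) c e\<gamma> \<nu>\<gamma> (jet pd ?G (?\<phi> \<Omega>)) =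
      c / 2 * e\<gamma> v v * graph_sum n c e\<gamma> \<nu>\<gamma> (jet pd ?G (?\<phi> \<Omega>)) +
      (exp (c / 2 * l \<Omega>) * (c / 2 * bilinear_form S \<eta> \<eta>) *
        graph_sum n c e \<nu> (jet pd F \<Omega>) + ?d * exp (c / 2 * l \<Omega>))"
    using graph_sum_Suc[of v n e\<gamma> c \<nu>\<gamma> "jet pd ?G (?\<phi> \<Omega>)", OF v_def e\<gamma>sym] by (simp only: deriv)
  moreover have "graph_sum n c e\<gamma> \<nu>\<gamma> (jet pd ?G (?\<phi> \<Omega>)) =
      exp (c / 2 * l \<Omega>) * graph_sum n c e \<nu> (jet pd F \<Omega>)"
    using IH[of 0] \<Omega> by (simp only: \<gamma>0 et0 \<nu>t0 e\<gamma>_def \<nu>\<gamma>_def)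
  moreover have "graph_sum (Suc n) c e \<nu> (jet pd F \<Omega>) =
      c / 2 * e v v * graph_sum n c e \<nu> (jet pd F \<Omega>) + ?d"
    unfolding \<eta>_def by (rule graph_sum_Suc[of v n e, OF v_def esym])
  moreover have "e\<gamma> v v = e v v - bilinear_form S \<eta> \<eta>"
    by (simp add: e\<gamma>_def edge_transform_def S_def \<eta>_def)
  ultimately show ?case
    unfolding e\<gamma>_def[symmetric] \<nu>\<gamma>_def[symmetric] by (simp add: algebra_simps)
qed

end

section \<open>The Siegel upper half plane\<close>

text \<open>Sylvester's criterion replaces the condition on all vectors by two strict inequalities
  between continuous functions of \<Omega>.\<close>

lemma sym_open_siegel: "sym_open siegel"
proof -
  let ?T = "{\<Omega> :: complex^2^2. 0 < Im (\<Omega> $ 1 $ 1) \<and>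
      0 < Im (\<Omega> $ 1 $ 1) * Im (\<Omega> $ 2 $ 2) - (Im (\<Omega> $ 1 $ 2))\<^sup>2}"
  have pos: "(\<forall>x::real^2. x \<noteq> 0 \<longrightarrow> x \<bullet> ((\<chi> i j. Im (\<Omega> $ i $ j)) *v x) > 0) \<longleftrightarrow> \<Omega> \<in> ?T"
    if "\<Omega> \<in> symmetric_matrices" for \<Omega>
  proof -
    define a b d where "a = Im (\<Omega> $ 1 $ 1)" and "b = Im (\<Omega> $ 1 $ 2)" and "d = Im (\<Omega> $ 2 $ 2)"
    have sym: "\<Omega> $ 2 $ 1 = \<Omega> $ 1 $ 2" using that unfolding symmetric_matrices_iff by blast
    have q: "x \<bullet> ((\<chi> i j. Im (\<Omega> $ i $ j)) *v x) = a * (x $ 1)\<^sup>2 + 2 * b * (x $ 1 * x $ 2) + d * (x $ 2)\<^sup>2"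
      for x :: "real^2"
      by (simp add: inner_vec_def matrix_vector_mult_def sum_2 a_def b_def d_def sym
          power2_eq_square algebra_simps)
    have "(\<forall>x::real^2. x \<noteq> 0 \<longrightarrow>
        0 < a * (x $ 1)\<^sup>2 + 2 * b * (x $ 1 * x $ 2) + d * (x $ 2)\<^sup>2) \<longleftrightarrow> 0 < a \<and> 0 < a * d - b\<^sup>2"
      (is "?L \<longleftrightarrow> ?R")
    proof
      assume L: ?L
      have "vector [1, 0] \<noteq> (0 :: real^2)" by (simp add: vec_eq_iff forall_2 vector_2)
      with L have "0 < a * ((vector [1, 0] :: real^2) $ 1)\<^sup>2 + 2 * b * ((vector [1, 0] :: real^2) $ 1 *
          (vector [1, 0] :: real^2) $ 2) + d * ((vector [1, 0] :: real^2) $ 2)\<^sup>2" by blast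
      then have a: "0 < a" by (simp add: vector_2)
      \<comment> \<open>At the vector (-b, a) the quadratic form takes the value a (a d -
        b^2).\<close>
      then have "vector [- b, a] \<noteq> (0 :: real^2)" by (simp add: vec_eq_iff forall_2 vector_2)
      with L have "0 < a * ((vector [- b, a] :: real^2) $ 1)\<^sup>2 + 2 * b * ((vector [- b, a] :: real^2) $ 1 *
          (vector [- b, a] :: real^2) $ 2) + d * ((vector [- b, a] :: real^2) $ 2)\<^sup>2" by blast
      then have "0 < a * (a * d - b\<^sup>2)" by (simp add: vector_2 power2_eq_square algebra_simps)
      with a show ?R by (simp add: zero_less_mult_iff)
    next
      assume R: ?R
      show ?L
      proof (intro allI impI)
        fix x :: "real^2" assume "x \<noteq> 0"
        then have x: "x $ 1 \<noteq> 0 \<or> x $ 2 \<noteq> 0" by (simp add: vec_eq_iff forall_2)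
        \<comment> \<open>This is a times the quadratic form, with the square completed.\<close>
        have "0 < (a * x $ 1 + b * x $ 2)\<^sup>2 + (a * d - b\<^sup>2) * (x $ 2)\<^sup>2"
        proof (cases "x $ 2 = 0")
          case True
          then show ?thesis using x R by simp
        next
          case False
          then show ?thesis using R by (intro add_nonneg_pos mult_pos_pos) auto
        qed
        also have "\<dots> = a * (a * (x $ 1)\<^sup>2 + 2 * b * (x $ 1 * x $ 2) + d * (x $ 2)\<^sup>2)"
          by (simp add: power2_eq_square algebra_simps)
        finally show "0 < a * (x $ 1)\<^sup>2 + 2 * b * (x $ 1 * x $ 2) + d * (x $ 2)\<^sup>2"
          using R by (simp add: zero_less_mult_iff)
      qed
    qed
    then show ?thesis by (simp add: q a_def b_def d_def)
  qed
  have "open ?T"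
    by (intro open_Collect_conj open_Collect_less continuous_intros)
  moreover have "siegel = symmetric_matrices \<inter> ?T"
    unfolding siegel_def using pos by blast
  ultimately show ?thesis unfolding sym_open_def openin_open by blast
qed

lemma cmat_matrix_mult: "cmat (A ** B) = cmat A ** cmat B"
  by (simp add: cmat_def matrix_matrix_mult_def vec_eq_iff)

lemma cmat_transpose: "cmat (transpose A) = transpose (cmat A)"
  by (simp add: cmat_def transpose_def vec_eq_iff)

lemma cmat_diff: "cmat (A - B) = cmat A - cmat B"
  by (simp add: cmat_def vec_eq_iff)

lemma cmat_one: "cmat (mat 1) = mat 1"
  by (simp add: cmat_def mat_def vec_eq_iff)

lemma modN_eq: "modN C D \<Omega> = automorphy_inv (cmat C) (cmat D) \<Omega>"
  by (simp add: modN_def modM_def automorphy_inv_def automorphy_def)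

lemma modact_eq: "modact A B C D = moebius (cmat A) (cmat B) (cmat C) (cmat D)"
  by (simp add: fun_eq_iff modact_def moebius_def modN_eq)

lemma log_automorphy_siegel:
  assumes "sp4 A B C D" and l: "log_det_branch C D l" and ne: "siegel \<noteq> {}"
  shows "log_automorphy (cmat A) (cmat B) (cmat C) (cmat D) siegel l"
proof -
  have exp_l: "exp (l \<Omega>) = det (automorphy (cmat C) (cmat D) \<Omega>)" if "\<Omega> \<in> siegel" for \<Omega>
    using l that by (simp add: log_det_branch_def modM_def automorphy_def)
  \<comment> \<open>The determinant is an exponential by the choice of the branch, and therefore has
    no zero on the half plane.\<close>
  have reg: "siegel \<subseteq> regular (cmat C) (cmat D)"
  proof
    fix \<Omega> assume "\<Omega> \<in> siegel"
    moreover from this have "det (automorphy (cmat C) (cmat D) \<Omega>) \<noteq> 0" by (simp flip: exp_l)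
    ultimately show "\<Omega> \<in> regular (cmat C) (cmat D)" by (simp add: regular_def siegel_def)
  qed
  have "cmat (transpose A ** D - transpose C ** B) = cmat (mat 1)"
    "cmat (A ** transpose B) = cmat (B ** transpose A)"
    "cmat (C ** transpose D) = cmat (D ** transpose C)"
    "cmat (transpose A ** C) = cmat (transpose C ** A)"
    "cmat (transpose B ** D) = cmat (transpose D ** B)"
    using assms(1) by (simp_all only: sp4_def)
  note rels = this[unfolded cmat_matrix_mult cmat_transpose cmat_diff cmat_one]
  show ?thesis
  proof
    show "regular (cmat C) (cmat D) \<noteq> {}" using reg ne by blast
    show "continuous_on siegel l" using l by (simp add: log_det_branch_def)
  qed (use rels sym_open_siegel reg exp_l in blast)+
qed

text \<open>Each \<open>pd_gamma\<close> is \<open>pd\<close> conjugated by the modular map. In an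
  iteration the return to \<Omega> and the next change of coordinates cancel, but only on the image
  of the half plane; its relative openness makes this enough for differentiation.\<close>

lemma pd_gamma_funpow:
  assumes "sym_open (modact A B C D ` siegel)" "inj_on (modact A B C D) siegel"
    and "\<And>\<Omega>. \<Omega> \<in> siegel \<Longrightarrow> F \<Omega> = G (modact A B C D \<Omega>)"
  shows "\<Omega> \<in> siegel \<Longrightarrow>
    (pd_gamma A B C D a b ^^ k) F \<Omega> = (pd a b ^^ k) G (modact A B C D \<Omega>)"
proof (induction k arbitrary: \<Omega>)
  case (Suc k)
  let ?\<phi> = "modact A B C D"
  have "pd a b ((pd_gamma A B C D a b ^^ k) F \<circ> inv_into siegel ?\<phi>) (?\<phi> \<Omega>) =
      pd a b ((pd a b ^^ k) G) (?\<phi> \<Omega>)"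
    using Suc.IH Suc.prems
    by (intro pd_cong[OF assms(1)]) (auto simp: inv_into_f_f[OF assms(2)])
  moreover have "pd_gamma A B C D a b f \<Omega> = pd a b (f \<circ> inv_into siegel ?\<phi>) (?\<phi> \<Omega>)" for f
    by (simp add: pd_gamma_def)
  ultimately show ?case by simp
qed (simp add: assms(3))

lemma jet_pd_gamma:
  assumes "sym_open (modact A B C D ` siegel)" "inj_on (modact A B C D) siegel"
    and "\<And>\<Omega>. \<Omega> \<in> siegel \<Longrightarrow> F \<Omega> = G (modact A B C D \<Omega>)" and "\<Omega> \<in> siegel"
  shows "jet (pd_gamma A B C D) F \<Omega> = jet pd G (modact A B C D \<Omega>)"
  unfolding jet_def by (intro ext pd_gamma_funpow[OF assms(1,2)] assms(3,4))

theorem theorem4p6: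
  fixes X :: "'a topology" and \<A> :: "'a chart set"
    and \<alpha> \<beta> :: "2 \<Rightarrow> real \<Rightarrow> 'a"
    and \<omega> :: "'a biform" and s :: "'a form" and \<nu> :: "'a chart \<Rightarrow> 'a \<Rightarrow> complex^2"
    and \<Omega> :: "complex^2^2"
    and c :: complex and n :: nat
    and z :: "nat \<Rightarrow> 'a" and \<kappa> :: "nat \<Rightarrow> 'a chart"
    and A B C D :: "int^2^2"
    and l F :: "complex^2^2 \<Rightarrow> complex" and U :: "(complex^2^2) set"
  assumes "compact_riemann_surface X \<A>"
    and "canonical_homology_basis X \<A> \<alpha> \<beta>"
    and "normalised_bidifferential \<A> \<alpha> \<omega> s"
    and "normalised_differentials \<A> \<alpha> \<beta> \<omega> \<nu>"
    and "period_matrix \<A> \<beta> \<nu> \<Omega>"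
    and "inj_on z {1..n}"
    and "\<forall>i\<in>{1..n}. \<kappa> i \<in> \<A> \<and> z i \<in> fst (\<kappa> i)"
    and "sp4 A B C D"
    and "log_det_branch C D l"
    and "openin (top_of_set siegel) U" and "\<Omega> \<in> U"
    and "times_differentiable_on n F U"
  defines "sz \<equiv> \<lambda>i. s (\<kappa> i) (z i)"
    and "\<omega>z \<equiv> \<lambda>i j. \<omega> (\<kappa> i) (z i) (\<kappa> j) (z j)"
    and "\<nu>z \<equiv> \<lambda>i. \<nu> (\<kappa> i) (z i)"
  shows "virasoro_op n c (s_gamma l \<Omega> \<nu>z sz) (omega_gamma l \<Omega> \<nu>z \<omega>z) (nu_gamma C D \<Omega> \<nu>z)
           (pd_gamma A B C D) (\<lambda>\<Omega>'. exp (c / 2 * l \<Omega>') * F \<Omega>') \<Omega>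
         = exp (c / 2 * l \<Omega>) * virasoro_op n c sz \<omega>z \<nu>z pd F \<Omega>"
proof -
  have \<Omega>: "\<Omega> \<in> siegel" using assms(10,11) openin_imp_subset by blast
  interpret log_automorphy "cmat A" "cmat B" "cmat C" "cmat D" siegel l
    using assms(8,9) \<Omega> by (intro log_automorphy_siegel) auto
  have U: "sym_open U" "U \<subseteq> siegel"
    using assms(10) W(1) openin_trans openin_imp_subset unfolding sym_open_def by blast+
  let ?\<phi> = "modact A B C D" and ?e = "edge_weight sz \<omega>z"
  \<comment> \<open>Half of the sum is the derivative of \<open>l\<close> in the symmetrised
    direction \<open>?H\<close>, hence the trace of the slope times \<open>?H\<close>.\<close>
  have bil: "(\<Sum>(a, b)\<in>idx. (u $ a * w $ b + w $ a * u $ b) * pd a b l \<Omega>) =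
      2 * bilinear_form (slope \<Omega>) u w" for u w
  proof -
    let ?H = "\<chi> i j. 1 / 2 * (u $ i * w $ j + w $ i * u $ j)"
    let ?\<gamma> = "\<lambda>t. \<Omega> + (\<chi> i j. t * ?H $ i $ j)"
    have \<gamma>0: "?\<gamma> 0 = \<Omega>" by (simp add: vec_eq_iff)
    have \<Omega>S: "\<Omega> \<in> symmetric_matrices" using \<Omega> by (simp add: siegel_def)
    have "curve_deriv ?\<gamma> ?H"
      by (auto simp: curve_deriv_def intro!: derivative_eq_intros)
    moreover have "?\<gamma> t \<in> symmetric_matrices" for t
      by (rule symmetric_matrices_add[OF \<Omega>S]) (simp add: symmetric_matrices_iff algebra_simps)
    then have "eventually (\<lambda>t. ?\<gamma> t \<in> symmetric_matrices) (nhds 0)"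
      by (rule always_eventually[OF allI])
    ultimately have "total_derivative l \<Omega> ?H = trace (slope \<Omega> ** ?H)"
      using log_has_field_derivative(2)[of ?\<gamma> ?H] \<Omega> unfolding \<gamma>0 slope_def by blast
    also have "\<dots> = bilinear_form (slope \<Omega>) u w"
      by (rule trace_symmetrised[OF transpose_slope[OF \<Omega>]])
    finally have "bilinear_form (slope \<Omega>) u w = total_derivative l \<Omega> ?H" ..
    then show ?thesis by (simp add: total_derivative_def sum_idx field_simps)
  qed
  have edge: "edge_weight (s_gamma l \<Omega> \<nu>z sz) (omega_gamma l \<Omega> \<nu>z \<omega>z) = edge_transform \<Omega> \<nu>z ?e"
  proof (intro ext)
    fix i j
    have "omega_gamma l \<Omega> \<nu>z \<omega>z i j = \<omega>z i j - bilinear_form (slope \<Omega>) (\<nu>z i) (\<nu>z j)"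
      by (simp add: omega_gamma_def bil)
    \<comment> \<open>On the diagonal the two products in \<open>bil\<close> coincide, so the sum is
      twice \<open>nabla\<close>.\<close>
    moreover have "2 * nabla (\<nu>z i) l \<Omega> = 2 * bilinear_form (slope \<Omega>) (\<nu>z i) (\<nu>z i)"
      unfolding bil[symmetric] by (simp add: nabla_def sum_idx algebra_simps)
    ultimately show "edge_weight (s_gamma l \<Omega> \<nu>z sz) (omega_gamma l \<Omega> \<nu>z \<omega>z) i j =
        edge_transform \<Omega> \<nu>z ?e i j"
      by (cases "i = j")
        (simp_all add: edge_weight_def edge_transform_def s_gamma_def diff_divide_distrib)
  qed
  have nu: "nu_gamma C D \<Omega> \<nu>z = nu_transform \<Omega> \<nu>z"
    by (simp add: fun_eq_iff nu_gamma_def nu_transform_def modN_eq)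
  have "inj_on ?\<phi> siegel"
    by (rule inj_on_inverseI[of _ inverse_moebius])
      (use W(2) in \<open>auto simp: modact_eq intro: moebius_inverse\<close>)
  moreover have "sym_open (?\<phi> ` siegel)"
    unfolding modact_eq by (rule sym_open_moebius_image[OF W])
  ultimately have jet: "jet (pd_gamma A B C D) (\<lambda>\<Omega>'. exp (c / 2 * l \<Omega>') * F \<Omega>') \<Omega> =
      jet pd (transported c F) (?\<phi> \<Omega>)"
    using \<Omega> by (intro jet_pd_gamma) (simp_all add: modact_eq transported_moebius)
  \<comment> \<open>Distinct labels stand for distinct points, where the bidifferential is
    symmetric; a loop weight is trivially symmetric.\<close>
  have "?e i j = ?e j i" if ij: "i \<in> {1..n}" "j \<in> {1..n}" for i j
  proof (cases "i = j")
    case False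
    then have "z i \<noteq> z j" using ij assms(6) by (meson inj_onD)
    then have "\<omega>z i j = \<omega>z j i"
      using assms(3,7) ij unfolding \<omega>z_def normalised_bidifferential_def by blast
    then show ?thesis using False by (simp add: edge_weight_def)
  qed simp
  then show ?thesis
    unfolding virasoro_op_eq_graph_sum edge nu jet modact_eq
    by (intro graph_sum_transform[OF U assms(11,12)])
qed

end
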